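(* Let $G$ be a locally compact group such that for every $t\in G$ the conjugacy class $t^G=\{gtg^{-1}:g\in G\}$ is precompact (has compact closure) in $G$. Then $\mathrm{TLIM}(G)\subset\mathrm{TIM}(G)$.
   Context: All groups are Hausdorff. $L_1(G)$ is formed with respect to left Haar measure. $L_\infty(G)$ is the algebra of bounded locally measurable functions on $G$ modulo equality off locally null sets; it is the dual of $L_1(G)$ via $\langle T,f\rangle=\int_G Tf$. A mean on $L_\infty(G)$ is a linear functional $m\ge0$ with $m(1)=1$. $P_1(G)=\{f\in L_1(G): f\ge 0,\ \|f\|_1=1\}$. For $T\in L_\infty(G)$ and $f\in L_1(G)$, define $fT,Tf\in L_\infty(G)$ by $\langle fT,g\rangle=\langle T,f*g\rangle$ and $\langle Tf,g\rangle=\langle T,g*f\rangle$ for $g\in L_1(G)$. A mean $m$ is topological left-invariant if $m(fT)=m(T)$ for all $f\in P_1(G)$, $T\in L_\infty(G)$; topological right-invariant if $m(Tf)=m(T)$ for all such $f,T$. $\mathrm{TLIM}(G)$ is the set of topological left-invariant means on $L_\infty(G)$, and $\mathrm{TIM}(G)$ is the set of means that are both topological left- and right-invariant. *)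

theory Defs
  imports "HOL-Analysis.Analysis"
begin

text \<open>
  Topological groups are the library's type class \<open>topological_group_add\<close>. Its group operation,
  although written additively, is not assumed to be commutative: \<open>g * h\<close> and \<open>g\<^sup>-\<^sup>1\<close> of the
  multiplicative notation are \<open>g + h\<close> and \<open>- g\<close>, and \<open>g * t * g\<^sup>-\<^sup>1\<close> is \<open>g + t - g\<close>.
\<close>

definition conj_class :: "'a::group_add \<Rightarrow> 'a set" where
  "conj_class t = {g + t - g | g. True}"

definition precompact :: "'a::topological_space set \<Rightarrow> bool" where
  "precompact S \<longleftrightarrow> compact (closure S)"


subsection \<open>Haar measure\<close>

definition radon_measure :: "'a::t2_space measure \<Rightarrow> bool" where
  "radon_measure M \<longleftrightarrow>
     sets M = sets borel \<and>
     (\<forall>K. compact K \<longrightarrow> emeasure M K < \<infinity>) \<and>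
     (\<forall>B \<in> sets borel. emeasure M B = (INF U \<in> {U. open U \<and> B \<subseteq> U}. emeasure M U)) \<and>
     (\<forall>U. open U \<longrightarrow> emeasure M U = (SUP K \<in> {K. compact K \<and> K \<subseteq> U}. emeasure M K))"

definition left_haar_measure :: "'a::{topological_group_add, t2_space} measure \<Rightarrow> bool" where
  "left_haar_measure M \<longleftrightarrow>
     radon_measure M \<and>
     emeasure M UNIV \<noteq> 0 \<and>
     (\<forall>g. \<forall>B \<in> sets borel. emeasure M ((\<lambda>x. g + x) ` B) = emeasure M B)"


subsection \<open>The spaces \<open>L\<^sub>1\<close> and \<open>L\<^sub>\<infinity>\<close>\<close>

text \<open>
  As usual in the library, elements of \<open>L\<^sub>1\<close> and \<open>L\<^sub>\<infinity>\<close> are represented by functions; the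
  identification of functions that agree (locally) almost everywhere appears as the requirement
  that functionals on \<open>L\<^sub>\<infinity>\<close> respect it. Local measurability and local nullity are tested on the
  Borel sets of finite measure. Writing \<open>null_sets\<close> instead of \<open>emeasure M _ = 0\<close> matters, because
  \<open>emeasure\<close> is \<open>0\<close> on non-measurable sets.
\<close>

definition locally_null :: "'a measure \<Rightarrow> 'a set \<Rightarrow> bool" where
  "locally_null M N \<longleftrightarrow>
     (\<forall>F \<in> sets M. emeasure M F < \<infinity> \<longrightarrow> N \<inter> F \<in> null_sets M)"

definition locally_measurable :: "'a measure \<Rightarrow> ('a \<Rightarrow> complex) \<Rightarrow> bool" where
  "locally_measurable M T \<longleftrightarrow>
     (\<forall>F \<in> sets M. emeasure M F < \<infinity> \<longrightarrow> T \<in> borel_measurable (restrict_space M F))"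

definition L1 :: "'a measure \<Rightarrow> ('a \<Rightarrow> complex) set" where
  "L1 M = {f. integrable M f}"

definition Linf :: "'a measure \<Rightarrow> ('a \<Rightarrow> complex) set" where
  "Linf M = {T. locally_measurable M T \<and> bounded (range T)}"

definition P1 :: "'a measure \<Rightarrow> ('a \<Rightarrow> complex) set" where
  "P1 M = {f \<in> L1 M. (AE x in M. f x \<in> \<real>\<^sub>\<ge>\<^sub>0) \<and> (\<integral>x. norm (f x) \<partial>M) = 1}"

definition pairing :: "'a measure \<Rightarrow> ('a \<Rightarrow> complex) \<Rightarrow> ('a \<Rightarrow> complex) \<Rightarrow> complex" where
  "pairing M T f = (\<integral>x. T x * f x \<partial>M)"

definition conv :: "'a::group_add measure \<Rightarrow> ('a \<Rightarrow> complex) \<Rightarrow> ('a \<Rightarrow> complex) \<Rightarrow> 'a \<Rightarrow> complex" where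
  "conv M f g x = (\<integral>y. f y * g (- y + x) \<partial>M)"

text \<open>
  The elements \<open>fT\<close> and \<open>Tf\<close> of \<open>L\<^sub>\<infinity> = L\<^sub>1\<^sup>*\<close>. The defining equations determine them up to
  equality off a locally null set, so \<open>SOME\<close> picks a representative.
\<close>

definition left_act :: "'a::group_add measure \<Rightarrow> ('a \<Rightarrow> complex) \<Rightarrow> ('a \<Rightarrow> complex) \<Rightarrow> 'a \<Rightarrow> complex" where
  "left_act M f T =
     (SOME S. S \<in> Linf M \<and> (\<forall>g \<in> L1 M. pairing M S g = pairing M T (conv M f g)))"

definition right_act :: "'a::group_add measure \<Rightarrow> ('a \<Rightarrow> complex) \<Rightarrow> ('a \<Rightarrow> complex) \<Rightarrow> 'a \<Rightarrow> complex" where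
  "right_act M T f =
     (SOME S. S \<in> Linf M \<and> (\<forall>g \<in> L1 M. pairing M S g = pairing M T (conv M g f)))"


subsection \<open>Invariant means\<close>

text \<open>Only the values of a functional on \<open>Linf M\<close> are meaningful.\<close>

definition linear_functional :: "'a measure \<Rightarrow> (('a \<Rightarrow> complex) \<Rightarrow> complex) \<Rightarrow> bool" where
  "linear_functional M m \<longleftrightarrow>
     (\<forall>S \<in> Linf M. \<forall>T \<in> Linf M. locally_null M {x. S x \<noteq> T x} \<longrightarrow> m S = m T) \<and>
     (\<forall>S \<in> Linf M. \<forall>T \<in> Linf M. m (\<lambda>x. S x + T x) = m S + m T) \<and>
     (\<forall>c. \<forall>T \<in> Linf M. m (\<lambda>x. c * T x) = c * m T)"

definition mean :: "'a measure \<Rightarrow> (('a \<Rightarrow> complex) \<Rightarrow> complex) \<Rightarrow> bool" where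
  "mean M m \<longleftrightarrow>
     linear_functional M m \<and>
     (\<forall>T \<in> Linf M. locally_null M {x. T x \<notin> \<real>\<^sub>\<ge>\<^sub>0} \<longrightarrow> m T \<in> \<real>\<^sub>\<ge>\<^sub>0) \<and>
     m (\<lambda>x. 1) = 1"

definition top_left_invariant :: "'a::group_add measure \<Rightarrow> (('a \<Rightarrow> complex) \<Rightarrow> complex) \<Rightarrow> bool" where
  "top_left_invariant M m \<longleftrightarrow> (\<forall>f \<in> P1 M. \<forall>T \<in> Linf M. m (left_act M f T) = m T)"

definition top_right_invariant :: "'a::group_add measure \<Rightarrow> (('a \<Rightarrow> complex) \<Rightarrow> complex) \<Rightarrow> bool" where
  "top_right_invariant M m \<longleftrightarrow> (\<forall>f \<in> P1 M. \<forall>T \<in> Linf M. m (right_act M T f) = m T)"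

definition TLIM :: "'a::group_add measure \<Rightarrow> (('a \<Rightarrow> complex) \<Rightarrow> complex) set" where
  "TLIM M = {m. mean M m \<and> top_left_invariant M m}"

definition TIM :: "'a::group_add measure \<Rightarrow> (('a \<Rightarrow> complex) \<Rightarrow> complex) set" where
  "TIM M = {m. mean M m \<and> top_left_invariant M m \<and> top_right_invariant M m}"

end

theory Submission
  imports Defs
begin

text \<open>
  Conjugates of a compact set stay in a compact set, hence \<open>G\<close> is unimodular. For \<open>f\<close> continuous
  with compact support, \<open>Tf(y) = \<integral> T(yx)f(x)dx\<close>; by topological left invariance \<open>T\<close> may be replaced
  by \<open>S = hT\<close>, which is uniformly continuous under left translation, and \<open>Sf\<close> by \<open>h(Sf)\<close>. Writing
  \<open>yx = (yxy\<^sup>-\<^sup>1)y\<close> gives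
  \<open>h(Sf)(y) = \<integral> q(s,y) S(sy) ds\<close> with \<open>q(s,y) = \<integral> f(x) h(syx\<^sup>-\<^sup>1y\<^sup>-\<^sup>1) dx\<close>, where \<open>s\<close> ranges over a
  compact set because conjugates of the support of \<open>f\<close> do. The integrand is norm continuous in \<open>s\<close>, so
  the mean commutes with the integral; left invariance under \<open>s\<close> turns the integrand into
  \<open>q(s,s\<^sup>-\<^sup>1y) S(y)\<close>, and \<open>\<integral> q(s,s\<^sup>-\<^sup>1y) ds = \<integral> f \<integral> h\<close>. Density of such \<open>f\<close> in \<open>L\<^sub>1\<close> does the rest.
\<close>

text \<open>In \<open>Sf(y)\<close> the left factor \<open>y x y^-1\<close> depends on
  \<open>y\<close>. So \<open>Sf\<close> averages left translates of \<open>S\<close> by amounts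
  that vary with \<open>y\<close>, and left invariance cannot be applied to it. Averaging once more
  with \<open>h\<close> moves this dependence out of the point and into a continuous weight, while
  \<open>S\<close> is moved by an \<open>s\<close> that does not depend on \<open>y\<close>.
  Precompact conjugacy classes enter twice: they confine \<open>s\<close> to one compact set for all
  \<open>y\<close>, and they bound the modular function from below, which makes it trivial.

  The Haar measure need not be sigma-finite, and a mean is continuous only for the supremum norm, so
  neither the Fubini theorem for sigma-finite measures nor a limit theorem for the mean applies. One
  device serves in both places: a linear functional bounded in the supremum norm commutes with the
  integral of a norm continuous, compactly supported family, because Riemann sums converge
  uniformly. It is applied to the mean and to integration against \<open>T\<close>. Integrable
  functions are then reached through sequences with suitable majorants.\<close>

lemmas group_normalize = diff_conv_add_uminus add.assoc minus_add add_minus_cancel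
  minus_add_cancel minus_minus left_minus right_minus add_0_left add_0_right minus_zero

subsection \<open>Continuous functions with compact support\<close>

definition compact_support :: "('a::topological_space \<Rightarrow> 'b::zero) \<Rightarrow> bool" where
  "compact_support f \<longleftrightarrow> (\<exists>K. compact K \<and> (\<forall>x. x \<notin> K \<longrightarrow> f x = 0))"

definition Cc :: "('a::topological_space \<Rightarrow> 'b::{topological_space, zero}) set" where
  "Cc = {f. continuous_on UNIV f \<and> compact_support f}"

lemma CcE:
  assumes "f \<in> Cc"
  obtains K where "compact K" "\<And>x. x \<notin> K \<Longrightarrow> f x = 0"
  using assms unfolding Cc_def compact_support_def by blast

lemma CcI:
  assumes "continuous_on UNIV f" "compact K" "\<And>x. x \<notin> K \<Longrightarrow> f x = 0"
  shows "f \<in> Cc"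
  using assms unfolding Cc_def compact_support_def by blast

lemma Cc_continuous: "f \<in> Cc \<Longrightarrow> continuous_on UNIV f"
  by (simp add: Cc_def)

lemma continuous_on_Cc:
  "f \<in> Cc \<Longrightarrow> continuous_on S g \<Longrightarrow> continuous_on S (\<lambda>x. f (g x))"
  using continuous_on_compose2[OF Cc_continuous] by blast

lemma Cc_bounded:
  fixes f :: "'a::topological_space \<Rightarrow> 'b::real_normed_vector"
  assumes "f \<in> Cc"
  obtains B where "B > 0" "\<And>x. norm (f x) \<le> B"
proof -
  obtain K where K: "compact K" "\<And>x. x \<notin> K \<Longrightarrow> f x = 0" using CcE[OF assms] by blast
  have "compact (f ` K)"
    using K(1) Cc_continuous[OF assms] by (meson compact_continuous_image continuous_on_subset subset_UNIV)
  then obtain B where B: "B > 0" "\<And>y. y \<in> f ` K \<Longrightarrow> norm y \<le> B"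
    using compact_imp_bounded bounded_pos by metis
  show ?thesis
  proof (rule that[OF B(1)])
    show "norm (f x) \<le> B" for x using B K(2)[of x] by (cases "x \<in> K") auto
  qed
qed

lemma compact_set_add:
  fixes A B :: "'a::topological_group_add set"
  assumes "compact A" "compact B"
  shows "compact {a + b | a b. a \<in> A \<and> b \<in> B}"
proof -
  have "compact ((\<lambda>(a, b). a + b) ` (A \<times> B))"
    by (intro compact_continuous_image compact_Times assms)
       (auto simp: case_prod_unfold intro!: continuous_intros)
  moreover have "(\<lambda>(a, b). a + b) ` (A \<times> B) = {a + b | a b. a \<in> A \<and> b \<in> B}" by auto
  ultimately show ?thesis by simp
qed

lemma compact_uminus_image:
  fixes A :: "'a::topological_group_add set"
  assumes "compact A"
  shows "compact (uminus ` A)"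
  by (intro compact_continuous_image assms continuous_intros)

lemma open_vimage_cont: "open U \<Longrightarrow> continuous_on UNIV f \<Longrightarrow> open (f -` U)"
  using open_vimage by blast

lemma Hausdorff_euclidean_t2: "Hausdorff_space (euclidean :: 'a::t2_space topology)"
  unfolding Hausdorff_space_def disjnt_def by (auto dest!: hausdorff)

lemma locally_compact_nbhd:
  fixes x :: "'a::t2_space"
  assumes "locally_compact_space (euclidean :: 'a topology)"
  obtains U K where "open U" "compact K" "x \<in> U" "U \<subseteq> K"
proof -
  have "\<exists>U K. openin euclidean U \<and> compactin euclidean K \<and> x \<in> U \<and> U \<subseteq> K"
    using assms unfolding locally_compact_space_def by simp
  then show ?thesis using that by (auto simp: compactin_euclidean_iff)
qed

lemma locally_compact_nbhd_compact:
  fixes K :: "'a::t2_space set"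
  assumes "locally_compact_space (euclidean :: 'a topology)" "compact K"
  obtains V L where "open V" "compact L" "K \<subseteq> V" "V \<subseteq> L"
proof -
  have "\<exists>U L. openin euclidean U \<and> compactin euclidean L \<and> closedin euclidean L \<and> K \<subseteq> U \<and> U \<subseteq> L"
    using iffD1[OF locally_compact_space_compact_closed_compact[OF disjI1[OF Hausdorff_euclidean_t2]] assms(1)]
      assms(2) by (simp add: compactin_euclidean_iff)
  then show ?thesis using that by (auto simp: compactin_euclidean_iff)
qed

lemma Cc_Urysohn:
  fixes K U :: "'a::t2_space set"
  assumes lc: "locally_compact_space (euclidean :: 'a topology)"
    and "compact K" "open U" "K \<subseteq> U"
  obtains f :: "'a \<Rightarrow> real" where "f \<in> Cc" "\<And>x. 0 \<le> f x" "\<And>x. f x \<le> 1"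
    "\<And>x. x \<in> K \<Longrightarrow> f x = 1" "\<And>x. x \<notin> U \<Longrightarrow> f x = 0"
proof -
  obtain V L where V: "open V" "compact L" "K \<subseteq> V" "V \<subseteq> L"
    using locally_compact_nbhd_compact[OF lc \<open>compact K\<close>] by blast
  have "completely_regular_space (euclidean :: 'a topology)"
    using completely_regular_eq_regular_space[OF lc]
      locally_compact_Hausdorff_imp_regular_space[OF lc Hausdorff_euclidean_t2] by simp
  \<comment> \<open>Shrinking \<open>U\<close> to \<open>V \<inter> U\<close>, which lies in the
    compact \<open>L\<close>, is what makes the support of the Urysohn function compact.\<close>
  moreover have "closed (- (V \<inter> U))" using V assms by auto
  moreover have "disjnt K (- (V \<inter> U))" using V assms by (auto simp: disjnt_def)
  ultimately obtain f where f: "continuous_map euclidean (subtopology euclidean {0..1}) f"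
    "f ` (- (V \<inter> U)) \<subseteq> {0::real}" "f ` K \<subseteq> {1}"
    using Urysohn_completely_regular_compact_closed[of 0 1 "euclidean :: 'a topology" K "- (V \<inter> U)"] assms
    by (auto simp: compactin_euclidean_iff)
  have c: "continuous_on UNIV f" and r: "\<And>x. f x \<in> {0..1}"
    using f(1) by (auto simp: continuous_map_in_subtopology Pi_iff)
  show ?thesis
  proof (rule that)
    show "f \<in> Cc" using c V f(2) by (intro CcI[of f L]) auto
  qed (use r f in \<open>auto simp: image_subset_iff\<close>)
qed

text \<open>The set where \<open>k\<close> stays within \<open>e\<close> of its values over
  \<open>y0\<close> is open and contains \<open>K\<close> times \<open>{y0}\<close>, so by the tube
  lemma it contains a whole strip. This stands in for uniform continuity on compact sets, as the
  spaces carry no metric.\<close>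

lemma tube_uniform:
  fixes k :: "'a::topological_space \<Rightarrow> 'b::topological_space \<Rightarrow> 'c::metric_space"
  assumes "continuous_on UNIV (\<lambda>(x, y). k x y)" "compact K" "e > 0"
  obtains V where "open V" "y0 \<in> V" "\<And>x y. x \<in> K \<Longrightarrow> y \<in> V \<Longrightarrow> dist (k x y) (k x y0) < e"
proof -
  let ?W = "{p. dist (k (fst p) (snd p)) (k (fst p) y0) < e}"
  have 1: "continuous_on UNIV (\<lambda>p. k (fst p) (snd p))"
    using assms(1) by (simp add: case_prod_unfold)
  have 2: "continuous_on UNIV (\<lambda>p::'a \<times> 'b. k (fst p) y0)"
    using continuous_on_compose2[OF 1, of UNIV "\<lambda>p::'a \<times> 'b. (fst p, y0)"]
    by (simp add: continuous_on_Pair continuous_on_fst)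
  have "open ?W" by (intro open_Collect_less continuous_intros 1 2)
  then have "open (prod.swap -` ?W)"
    by (rule open_vimage) (intro continuous_on_swap)
  moreover have "{y0} \<times> K \<subseteq> prod.swap -` ?W" using assms(3) by auto
  ultimately obtain V where UV: "open V" "y0 \<in> V" "V \<times> K \<subseteq> prod.swap -` ?W"
    using Elementary_Topology.tube_lemma[OF assms(2), of "prod.swap -` ?W" y0] by blast
  show ?thesis
  proof (rule that[OF UV(1,2)])
    fix x y assume "x \<in> K" "y \<in> V"
    then have "(x, y) \<in> ?W" using UV(3) by force
    then show "dist (k x y) (k x y0) < e" by simp
  qed
qed

lemma Cc_left_uniformly_continuous:
  fixes f :: "'a::{topological_group_add, t2_space} \<Rightarrow> 'b::real_normed_vector"
  assumes lc: "locally_compact_space (euclidean :: 'a topology)" and f: "f \<in> Cc" "e > 0"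
  obtains V where "open V" "0 \<in> V" "\<And>u x. u \<in> V \<Longrightarrow> norm (f (u + x) - f x) < e"
proof -
  obtain K where K: "compact K" "\<And>x. x \<notin> K \<Longrightarrow> f x = 0" using CcE[OF f(1)] by blast
  obtain W L where L: "open W" "compact L" "0 \<in> W" "W \<subseteq> (L :: 'a set)"
    by (rule locally_compact_nbhd[OF lc, where x = 0])
  \<comment> \<open>The tube argument is uniform only over a compact set of \<open>x\<close>.
    Outside this enlargement of \<open>K\<close>, neither \<open>x\<close> nor \<open>u + x\<close>
    with \<open>u\<close> in \<open>W\<close> meets \<open>K\<close>, so both values of
    \<open>f\<close> vanish.\<close>
  define K' where "K' = {a + b | a b. a \<in> uminus ` L \<and> b \<in> K} \<union> K"
  have "compact K'" unfolding K'_def by (intro compact_Un compact_set_add compact_uminus_image L K)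
  moreover have "continuous_on UNIV (\<lambda>(x, u). f (u + x))"
    by (auto simp: case_prod_unfold intro!: continuous_on_Cc[OF f(1)] continuous_intros)
  ultimately obtain V where V: "open V" "0 \<in> V"
    "\<And>x u. x \<in> K' \<Longrightarrow> u \<in> V \<Longrightarrow> dist (f (u + x)) (f (0 + x)) < e"
    using tube_uniform[of "\<lambda>x u. f (u + x)" K' e 0] f(2) by blast
  show ?thesis
  proof (rule that[of "V \<inter> W"])
    fix u x assume u: "u \<in> V \<inter> W"
    show "norm (f (u + x) - f x) < e"
    proof (cases "x \<in> K'")
      case True
      then show ?thesis using V(3)[of x u] u by (simp add: dist_norm)
    next
      case False
      then have "x \<notin> K" by (auto simp: K'_def)
      moreover have "u + x \<notin> K"
      proof
        assume "u + x \<in> K"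
        then have "- u + (u + x) \<in> K'" using u L unfolding K'_def by blast
        with False show False by (simp add: add.assoc[symmetric])
      qed
      ultimately show ?thesis using K f(2) by simp
    qed
  qed (use V L in auto)
qed

lemma Cc_compose_uminus:
  fixes f :: "'a::{topological_group_add, t2_space} \<Rightarrow> 'b::{topological_space, zero}"
  assumes "f \<in> Cc" shows "(\<lambda>x. f (- x)) \<in> Cc"
proof -
  obtain K where K: "compact K" "\<And>x. x \<notin> K \<Longrightarrow> f x = 0" using CcE[OF assms] by blast
  have "f (- x) = 0" if "x \<notin> uminus ` K" for x
    by (rule K(2)) (use that in \<open>metis image_eqI minus_minus\<close>)
  moreover have "continuous_on UNIV (\<lambda>x. f (- x))"
    by (intro continuous_on_Cc[OF assms] continuous_intros)
  ultimately show ?thesis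
    using CcI[OF _ compact_uminus_image[OF K(1)]] by blast
qed

lemma Cc_right_uniformly_continuous:
  fixes f :: "'a::{topological_group_add, t2_space} \<Rightarrow> 'b::real_normed_vector"
  assumes lc: "locally_compact_space (euclidean :: 'a topology)" and f: "f \<in> Cc" "e > 0"
  obtains V where "open V" "0 \<in> V" "\<And>u x. u \<in> V \<Longrightarrow> norm (f (x + u) - f x) < e"
proof -
  obtain V where V: "open V" "0 \<in> V" "\<And>u x. u \<in> V \<Longrightarrow> norm (f (- (u + x)) - f (- x)) < e"
    using Cc_left_uniformly_continuous[OF lc Cc_compose_uminus[OF f(1)] f(2)] by blast
  show ?thesis
  proof (rule that[of "uminus -` V"])
    show "open (uminus -` V)" by (intro open_vimage_cont V continuous_intros)
    show "norm (f (x + u) - f x) < e" if "u \<in> uminus -` V" for u x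
      using V(3)[of "- u" "- x"] that by (simp add: minus_add)
  qed (use V in auto)
qed

lemma Cc_translate:
  fixes f :: "'a::{topological_group_add, t2_space} \<Rightarrow> 'b::{topological_space, zero}"
  assumes "f \<in> Cc" shows "(\<lambda>x. f (a + x + b)) \<in> Cc"
proof -
  obtain K where K: "compact K" "\<And>x. x \<notin> K \<Longrightarrow> f x = 0" using CcE[OF assms] by blast
  have "f (a + x + b) = 0" if "x \<notin> (\<lambda>x. - a + x - b) ` K" for x
  proof (rule K(2), rule notI)
    assume "a + x + b \<in> K"
    then have "- a + (a + x + b) - b \<in> (\<lambda>x. - a + x - b) ` K" by blast
    then show False using that by (simp add: add.assoc[symmetric])
  qed
  moreover have "compact ((\<lambda>x. - a + x - b) ` K)"
    by (intro compact_continuous_image K continuous_intros)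
  ultimately show ?thesis
    by (intro CcI continuous_on_Cc[OF assms] continuous_intros) auto
qed

subsection \<open>Conjugates of compact sets\<close>

text \<open>Pigeonhole: \<open>C\<close> is covered by finitely many open sets \<open>W b\<close>
  whose points differ by elements of \<open>U\<close>, and two terms of the sequence must fall into
  the same one. This avoids convergent subsequences, which a compact set need not provide.\<close>

lemma separated_sequence_not_compact:
  fixes s :: "nat \<Rightarrow> 'a::{topological_group_add, t2_space}"
  assumes U: "open U" "0 \<in> U" and sep: "\<And>i n. i < n \<Longrightarrow> - s i + s n \<notin> U"
    and C: "compact C" "range s \<subseteq> C"
  shows False
proof -
  have "continuous_on UNIV (\<lambda>p::'a \<times> 'a. - fst p + snd p)" by (intro continuous_intros)
  then have op: "open ((\<lambda>p::'a \<times> 'a. - fst p + snd p) -` U)"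
    using U(1) by (rule open_vimage_cont[rotated])
  have "\<exists>W. open W \<and> b \<in> W \<and> (\<forall>x\<in>W. \<forall>y\<in>W. - x + y \<in> U)" for b
  proof -
    have "(b, b) \<in> (\<lambda>p::'a \<times> 'a. - fst p + snd p) -` U" using U by simp
    then obtain A B where "open A" "open B" "(b, b) \<in> A \<times> B" "A \<times> B \<subseteq> (\<lambda>p::'a \<times> 'a. - fst p + snd p) -` U"
      using op unfolding open_prod_def by meson
    then show ?thesis by (intro exI[of _ "A \<inter> B"]) force
  qed
  then obtain W where W: "\<And>b. open (W b)" "\<And>b. b \<in> W b" "\<And>b x y. x \<in> W b \<Longrightarrow> y \<in> W b \<Longrightarrow> - x + y \<in> U"
    by metis
  obtain D where D: "D \<subseteq> C" "finite D" "C \<subseteq> \<Union>(W ` D)"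
    using compactE_image[OF C(1), of C W] W(1,2) by (metis UN_iff subsetI)
  have "\<forall>n. \<exists>b\<in>D. s n \<in> W b" using D C by blast
  then obtain b where b: "\<And>n. b n \<in> D" "\<And>n. s n \<in> W (b n)" by metis
  have "finite (range b)" using D(2) b(1) by (meson finite_subset image_subsetI)
  then have "\<not> inj b" using finite_imageD infinite_UNIV_nat by blast
  then obtain i n where "i < n" "b i = b n" unfolding inj_def by (metis linorder_neqE_nat)
  then show False using W(3)[of "s i" "b i" "s n"] b(2)[of i] b(2)[of n] sep by metis
qed

text \<open>Greedy choice: each term avoids the \<open>U\<close>-translates of all earlier ones. A
  sequence is wanted because Baire's theorem will act on a countable union indexed by it.\<close>

lemma separated_sequence_exists:
  fixes U :: "'a::group_add set"
  assumes "\<not> (\<exists>F. finite F \<and> F \<subseteq> S \<and> (\<forall>x\<in>S. \<exists>y\<in>F. - y + x \<in> U))"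
  shows "\<exists>s :: nat \<Rightarrow> 'a. range s \<subseteq> S \<and> (\<forall>n. \<forall>i<n. - s i + s n \<notin> U)"
proof -
  from assms have no: "\<And>F. finite F \<Longrightarrow> F \<subseteq> S \<Longrightarrow> \<exists>x\<in>S. \<forall>y\<in>F. - y + x \<notin> U" by metis
  define P where "P F x \<longleftrightarrow> x \<in> S \<and> (\<forall>y\<in>F. - y + x \<notin> U)" for F x
  obtain nx where nx: "\<And>F. finite F \<Longrightarrow> F \<subseteq> S \<Longrightarrow> P F (nx F)" using no unfolding P_def by metis
  define s where "s = wfrec less_than (\<lambda>s n. nx (s ` {..<n::nat}))"
  have s: "s n = nx (s ` {..<n})" for n
    unfolding s_def by (subst wfrec) (auto simp: cut_def intro!: arg_cong[where f = nx] image_cong)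
  have "s n \<in> S" for n
  proof (induction n rule: less_induct)
    case (less n)
    then have "s ` {..<n} \<subseteq> S" by auto
    then show ?case using nx[of "s ` {..<n}"] s[of n] by (simp add: P_def)
  qed
  then have sS: "range s \<subseteq> S" by auto
  have "- s i + s n \<notin> U" if "i < n" for i n
  proof -
    have "P (s ` {..<n}) (s n)" using nx[of "s ` {..<n}"] s[of n] sS by auto
    then show ?thesis using that by (auto simp: P_def)
  qed
  with sS show ?thesis by blast
qed

text \<open>The centres come from \<open>S\<close> itself, not from the ambient compact set;
  \<open>compact_conjugates\<close> relies on this to turn a finite \<open>F\<close> inside a range
  into finitely many indices.\<close>

lemma compact_covers:
  fixes U :: "'a::{topological_group_add, t2_space} set"
  assumes "compact C" "open U" "0 \<in> U" "S \<subseteq> C"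
  shows "\<exists>F. finite F \<and> F \<subseteq> S \<and> (\<forall>x\<in>S. \<exists>y\<in>F. - y + x \<in> U)"
proof (rule ccontr)
  assume "\<not> ?thesis"
  then obtain s :: "nat \<Rightarrow> 'a" where s: "range s \<subseteq> S" "\<And>n i. i < n \<Longrightarrow> - s i + s n \<notin> U"
    using separated_sequence_exists by metis
  show False
    using separated_sequence_not_compact[OF assms(2,3) s(2) assms(1)] s(1) assms(4) by blast
qed

text \<open>A sequence of conjugates \<open>g n + k n - g n\<close> leaving every compact set would contradict Baire's
  theorem, applied to the sets \<open>A m\<close> of those \<open>x\<close> whose conjugates by the \<open>g n\<close> all lie in \<open>ZL m\<close>.\<close>

lemma compact_conjugates:
  fixes K :: "'a::{topological_group_add, t2_space} set"
  assumes lc: "locally_compact_space (euclidean :: 'a topology)"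
    and fc: "\<And>t::'a. precompact (conj_class t)"
    and K: "compact K"
  obtains C where "compact C" "\<And>k g. k \<in> K \<Longrightarrow> g + k - g \<in> C"
proof -
  define S where "S = {g + k - g | g k. k \<in> K}"
  obtain U L where U: "open U" "compact L" "0 \<in> U" "U \<subseteq> (L::'a set)"
    by (rule locally_compact_nbhd[OF lc, where x = 0])
  have conj: "g + t - g \<in> closure (conj_class t)" for g t :: 'a
    using closure_subset[of "conj_class t"] by (auto simp: conj_class_def)
  have cc: "compact (closure (conj_class t))" for t :: 'a
    using fc unfolding precompact_def .
  have "\<exists>F. finite F \<and> F \<subseteq> S \<and> (\<forall>x\<in>S. \<exists>y\<in>F. - y + x \<in> U)"
  proof (rule ccontr)
    assume "\<not> ?thesis"
    then obtain s :: "nat \<Rightarrow> 'a" where s: "range s \<subseteq> S" "\<And>n i. i < n \<Longrightarrow> - s i + s n \<notin> U"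
      using separated_sequence_exists by metis
    have "\<exists>g k. s n = g + k - g \<and> k \<in> K" for n
      using s(1) unfolding S_def by (auto simp: subset_iff)
    then obtain g k where gk: "\<And>n. s n = g n + k n - g n" "\<And>n. k n \<in> K" by metis
    define Z where "Z m = (\<Union>n\<le>m. (\<lambda>x. g n + x - g n) ` L)" for m
    have Zc: "compact (Z m)" for m
      unfolding Z_def
      by (intro compact_UN compact_continuous_image U continuous_intros) auto
    define ZL where "ZL m = {a + b | a b. a \<in> Z m \<and> b \<in> L}" for m
    have ZLc: "compact (ZL m)" for m
      unfolding ZL_def by (intro compact_set_add Zc U)
    define A where "A m = L \<inter> (\<Inter>n. (\<lambda>x. g n + x - g n) -` ZL m)" for m
    have Acl: "closed (A m)" for m
      unfolding A_def
      by (intro closed_Int closed_INT compact_imp_closed U ballI closed_vimage ZLc continuous_intros)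
    \<comment> \<open>The class of \<open>x\<close> is precompact, so finitely many of the
      conjugates of \<open>x\<close> by the \<open>g n\<close> cover all of them up to
      \<open>U\<close>. Any \<open>m\<close> above their indices works.\<close>
    have "L \<subseteq> (\<Union>m. A m)"
    proof
      fix x assume x: "x \<in> L"
      let ?S = "range (\<lambda>n. g n + x - g n)"
      have "?S \<subseteq> closure (conj_class x)" using conj by auto
      from compact_covers[OF cc U(1,3) this]
      obtain F where F: "finite F" "F \<subseteq> ?S" "\<forall>z\<in>?S. \<exists>y\<in>F. - y + z \<in> U" by metis
      obtain J where J: "finite J" "F = (\<lambda>n. g n + x - g n) ` J"
        using finite_subset_image[OF F(1,2)] by blast
      obtain m where m: "\<And>j. j \<in> J \<Longrightarrow> j \<le> m" using J(1) by (meson Max_ge)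
      have "g n + x - g n \<in> ZL m" for n
      proof -
        obtain y where y: "y \<in> F" "- y + (g n + x - g n) \<in> U" using F(3) by blast
        have "y \<in> Z m" using y(1) J(2) m x unfolding Z_def by auto
        moreover have "g n + x - g n = y + (- y + (g n + x - g n))" by (simp only: add_minus_cancel)
        ultimately show ?thesis unfolding ZL_def using y(2) U(4) by blast
      qed
      then show "x \<in> (\<Union>m. A m)" using x unfolding A_def by auto
    qed
    then have "U \<subseteq> interior (\<Union>(range A))" using U by (intro interior_maximal) auto
    then have "interior (\<Union>(range A)) \<noteq> {}" using U(3) by auto
    then have "\<exists>m. interior (A m) \<noteq> {}"
      using Baire_category_alt[of "euclidean :: 'a topology" "range A"] lc Acl
        locally_compact_Hausdorff_imp_regular_space[OF lc Hausdorff_euclidean_t2]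
      by auto
    then obtain m x0 where x0: "x0 \<in> interior (A m)" by blast
    \<comment> \<open>Finitely many translates of the interior of \<open>A m\<close> cover
      \<open>K\<close>, so \<open>k n\<close> is \<open>a\<close>, then \<open>- x0\<close>, then
      some \<open>w\<close> in \<open>A m\<close>. Conjugating the three factors separately by
      \<open>g n\<close> puts the first two into closures of single conjugacy classes and the last
      into \<open>ZL m\<close>, hence \<open>s n\<close> into a compact set.\<close>
    define W where "W a = (\<lambda>x. x0 - a + x) -` interior (A m)" for a
    have "K \<subseteq> (\<Union>a\<in>K. W a)" using x0 by (auto simp: W_def)
    moreover have "open (W a)" for a
      unfolding W_def by (intro open_vimage_cont open_interior continuous_intros)
    ultimately obtain D where D: "D \<subseteq> K" "finite D" "K \<subseteq> (\<Union>a\<in>D. W a)"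
      using compactE_image[OF K, of K W] by metis
    define E where "E a = {p + q | p q. p \<in> {b + c | b c. b \<in> closure (conj_class a)
        \<and> c \<in> closure (conj_class (- x0))} \<and> q \<in> ZL m}" for a
    have "compact (\<Union>a\<in>D. E a)"
      using D(2) unfolding E_def by (intro compact_UN compact_set_add cc ZLc) auto
    moreover have "range s \<subseteq> (\<Union>a\<in>D. E a)"
    proof safe
      fix n
      obtain a where a: "a \<in> D" "k n \<in> W a" using gk(2) D(3) by blast
      define w where "w = x0 - a + k n"
      have "w \<in> A m" using a(2) interior_subset unfolding W_def w_def by blast
      then have "g n + w - g n \<in> ZL m" unfolding A_def by blast
      moreover have "s n = (g n + a - g n) + (g n + (- x0) - g n) + (g n + w - g n)"
        unfolding gk(1) w_def by (simp only: group_normalize)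
      ultimately have "s n \<in> E a"
        unfolding E_def using conj[of "g n" a] conj[of "g n" "- x0"] by blast
      then show "s n \<in> (\<Union>a\<in>D. E a)" using a(1) by blast
    qed
    ultimately show False
      using separated_sequence_not_compact[OF U(1,3) s(2)] by blast
  qed
  then obtain F where F: "finite F" "\<forall>x\<in>S. \<exists>y\<in>F. - y + x \<in> U" by metis
  show ?thesis
  proof (rule that)
    show "compact {a + b | a b. a \<in> F \<and> b \<in> L}"
      by (intro compact_set_add U finite_imp_compact F)
    fix k g :: 'a assume "k \<in> K"
    then have "g + k - g \<in> S" unfolding S_def by blast
    then obtain y where y: "y \<in> F" "- y + (g + k - g) \<in> U" using F(2) by blast
    have "g + k - g = y + (- y + (g + k - g))" by (simp only: add_minus_cancel)
    then show "g + k - g \<in> {a + b | a b. a \<in> F \<and> b \<in> L}" using y U(4) by blast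
  qed
qed

section \<open>Bounded continuous functions\<close>

definition BC :: "('a::topological_space \<Rightarrow> complex) set" where
  "BC = {f. continuous_on UNIV f \<and> bounded (range f)}"

lemma BCI: "continuous_on UNIV f \<Longrightarrow> (\<And>x. norm (f x) \<le> B) \<Longrightarrow> f \<in> BC"
  unfolding BC_def bounded_iff by blast

lemma BCE:
  assumes "f \<in> BC"
  obtains B where "continuous_on UNIV f" "B > 0" "\<And>x. norm (f x) \<le> B"
proof -
  obtain B where "B > 0" "\<And>x. x \<in> range f \<Longrightarrow> norm x \<le> B"
    using assms unfolding BC_def bounded_pos by blast
  moreover have "continuous_on UNIV f" using assms by (simp add: BC_def)
  ultimately show ?thesis using that[of B] by auto
qed

lemma BC_add: "f \<in> BC \<Longrightarrow> g \<in> BC \<Longrightarrow> (\<lambda>x. f x + g x) \<in> BC"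
  by (auto simp: BC_def image_image intro!: continuous_intros bounded_plus_comp)

lemma BC_mult:
  assumes "f \<in> BC" "g \<in> BC" shows "(\<lambda>x. f x * g x) \<in> BC"
proof -
  obtain B where B: "continuous_on UNIV f" "B > 0" "\<And>x. norm (f x) \<le> B" using BCE[OF assms(1)] by metis
  obtain C where C: "continuous_on UNIV g" "C > 0" "\<And>x. norm (g x) \<le> C" using BCE[OF assms(2)] by metis
  show ?thesis
    by (rule BCI[where B = "B * C"])
       (use B C in \<open>auto simp: norm_mult intro!: continuous_intros mult_mono intro: order_trans[OF norm_ge_zero]\<close>)
qed

lemma BC_const: "(\<lambda>x. c) \<in> BC"
  by (rule BCI[of _ "norm c"]) auto

lemma BC_cmult: "f \<in> BC \<Longrightarrow> (\<lambda>x. c * f x) \<in> BC"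
  by (intro BC_mult BC_const)

lemma BC_sum: "(\<And>i. i \<in> I \<Longrightarrow> f i \<in> BC) \<Longrightarrow> (\<lambda>x. \<Sum>i\<in>I. f i x) \<in> BC"
  by (induction I rule: infinite_finite_induct) (auto intro!: BC_const BC_add)

subsection \<open>Integration with respect to a Haar measure\<close>

text \<open>Each new open set is stripped of the earlier ones. The result provides the pieces of the
  Riemann sums below.\<close>

lemma finite_borel_partition:
  fixes V :: "'c \<Rightarrow> 'a::topological_space set"
  assumes "finite D" "\<And>c. c \<in> D \<Longrightarrow> open (V c)"
  shows "\<exists>A. (\<forall>c\<in>D. A c \<in> sets borel \<and> A c \<subseteq> V c) \<and> disjoint_family_on A D \<and> (\<Union>c\<in>D. A c) = (\<Union>c\<in>D. V c)"
  using assms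
proof (induction D rule: finite_induct)
  case empty
  then show ?case by (auto simp: disjoint_family_on_def)
next
  case (insert d D)
  then obtain A where A: "\<forall>c\<in>D. A c \<in> sets borel \<and> A c \<subseteq> V c" "disjoint_family_on A D"
    "(\<Union>c\<in>D. A c) = (\<Union>c\<in>D. V c)" by (metis insert_iff)
  define A' where "A' = A(d := V d - (\<Union>c\<in>D. V c))"
  have "open (\<Union>c\<in>D. V c)" using insert by auto
  then have "\<forall>c\<in>insert d D. A' c \<in> sets borel \<and> A' c \<subseteq> V c"
    using A insert by (auto simp: A'_def)
  moreover have "disjoint_family_on A' (insert d D)"
    using A insert(2) unfolding disjoint_family_on_def A'_def by auto
  moreover have "(\<Union>c\<in>insert d D. A' c) = (\<Union>c\<in>insert d D. V c)"
  proof -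
    have "(\<Union>c\<in>D. A' c) = (\<Union>c\<in>D. A c)" using insert(2) by (auto simp: A'_def)
    then show ?thesis using A(3) by (auto simp: A'_def)
  qed
  ultimately show ?case by blast
qed

locale lc_haar =
  fixes M :: "'a::{topological_group_add, t2_space} measure"
  assumes lc: "locally_compact_space (euclidean :: 'a topology)"
    and haar: "left_haar_measure M"
begin

lemma radon: "radon_measure M"
  using haar unfolding left_haar_measure_def by blast

lemma sets_M [measurable_cong, simp]: "sets M = sets borel"
  by (rule conjunct1[OF radon[unfolded radon_measure_def]])

lemma space_M [simp]: "space M = UNIV"
  using sets_eq_imp_space_eq[OF sets_M] by simp

lemma measurable_M: "measurable M N = measurable borel N" "measurable N M = measurable N borel"
  by (intro measurable_cong_sets refl sets_M)+

lemma compact_sets [simp]: "compact K \<Longrightarrow> (K :: 'a set) \<in> sets borel"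
  by (intro borel_closed compact_imp_closed)

lemma emeasure_compact: "compact K \<Longrightarrow> emeasure M K < \<infinity>"
  using conjunct1[OF conjunct2[OF radon[unfolded radon_measure_def]]] by blast

lemma outer_regular:
  "B \<in> sets borel \<Longrightarrow> emeasure M B = (INF U \<in> {U. open U \<and> B \<subseteq> U}. emeasure M U)"
  using conjunct1[OF conjunct2[OF conjunct2[OF radon[unfolded radon_measure_def]]]] by blast

lemma inner_regular:
  "open U \<Longrightarrow> emeasure M U = (SUP K \<in> {K. compact K \<and> K \<subseteq> U}. emeasure M K)"
  using conjunct2[OF conjunct2[OF conjunct2[OF radon[unfolded radon_measure_def]]]] by blast

lemma emeasure_translate: "B \<in> sets borel \<Longrightarrow> emeasure M ((\<lambda>x. g + x) ` B) = emeasure M B"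
  using haar unfolding left_haar_measure_def by blast

lemma continuous_borel: "continuous_on UNIV f \<Longrightarrow> f \<in> borel_measurable M"
  unfolding measurable_M by (rule borel_measurable_continuous_onI)

lemma translate_measurable: "(\<lambda>x. g + x) \<in> measurable M M" for g
  unfolding measurable_M by (intro borel_measurable_continuous_onI continuous_intros)

lemma distr_translate: "distr M M (\<lambda>x. g + x) = M"
proof (rule measure_eqI)
  fix B assume "B \<in> sets (distr M M (\<lambda>x. g + x))"
  then have B: "B \<in> sets borel" by simp
  have "(\<lambda>x. g + x) -` B = (\<lambda>x. - g + x) ` B"
  proof safe
    fix x assume "g + x \<in> B"
    then show "x \<in> (\<lambda>x. - g + x) ` B"
      by (intro image_eqI[of _ _ "g + x"]) (simp_all add: add.assoc[symmetric])
  qed (simp add: add.assoc[symmetric])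
  then show "emeasure (distr M M (\<lambda>x. g + x)) B = emeasure M B"
    using B emeasure_translate[OF B, of "- g"] translate_measurable[of g]
    by (simp add: emeasure_distr)
qed simp

lemma integral_left_translate:
  fixes f :: "'a \<Rightarrow> 'c::{banach, second_countable_topology}"
  assumes "f \<in> borel_measurable M"
  shows "(\<integral>x. f (g + x) \<partial>M) = (\<integral>x. f x \<partial>M)"
  using integral_distr[OF translate_measurable assms, of g] by (simp add: distr_translate)

lemma Cc_borel:
  fixes f :: "'a \<Rightarrow> 'c::{topological_space, zero}"
  shows "f \<in> Cc \<Longrightarrow> f \<in> borel_measurable M"
  by (intro continuous_borel) (auto simp: Cc_def)

lemma integrable_indicator_compact: "compact K \<Longrightarrow> integrable M (indicator K :: 'a \<Rightarrow> real)"
  using emeasure_compact[of K] by simp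

lemma integrable_bounded_support:
  fixes f :: "'a \<Rightarrow> 'c::{banach, second_countable_topology}"
  assumes "f \<in> borel_measurable M" "compact K" "\<And>x. x \<notin> K \<Longrightarrow> f x = 0" "\<And>x. norm (f x) \<le> B"
  shows "integrable M f"
proof (rule Bochner_Integration.integrable_bound)
  show "integrable M (\<lambda>x. B * indicator K x)"
    using integrable_indicator_compact[OF assms(2)] by simp
  show "AE x in M. norm (f x) \<le> norm (B * indicator K x)"
  proof (rule AE_I2)
    fix x show "norm (f x) \<le> norm (B * indicator K x)"
      using assms(3)[of x] assms(4)[of x] by (cases "x \<in> K") auto
  qed
qed fact

lemma norm_integral_bounded_support:
  fixes f :: "'a \<Rightarrow> 'c::{banach, second_countable_topology}"
  assumes "f \<in> borel_measurable M" "compact K" "\<And>x. x \<notin> K \<Longrightarrow> f x = 0" "\<And>x. norm (f x) \<le> B"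
  shows "norm (\<integral>x. f x \<partial>M) \<le> B * measure M K"
proof -
  have "norm (\<integral>x. f x \<partial>M) \<le> (\<integral>x. norm (f x) \<partial>M)" by (rule integral_norm_bound)
  also have "\<dots> \<le> (\<integral>x. B * indicator K x \<partial>M)"
  proof (rule integral_mono)
    show "integrable M (\<lambda>x. norm (f x))" using integrable_bounded_support[OF assms] by simp
    show "integrable M (\<lambda>x. B * indicator K x)"
      using integrable_indicator_compact[OF assms(2)] by simp
    show "norm (f x) \<le> B * indicator K x" for x
      using assms(3)[of x] assms(4)[of x] by (cases "x \<in> K") auto
  qed
  also have "\<dots> = B * measure M K" by simp
  finally show ?thesis .
qed

lemma Cc_integrable:
  fixes f :: "'a \<Rightarrow> 'c::{banach, second_countable_topology}"
  assumes "f \<in> Cc" shows "integrable M f"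
proof -
  obtain B where B: "B > 0" "\<And>x. norm (f x) \<le> B" using Cc_bounded[OF assms] by metis
  obtain K where K: "compact K" "\<And>x. x \<notin> K \<Longrightarrow> f x = 0" using CcE[OF assms] by metis
  show ?thesis by (rule integrable_bounded_support[OF Cc_borel[OF assms] K B(2)])
qed

text \<open>If \<open>U\<close> were null, finitely many of its left translates would cover any
  given compact set. Every compact set would then be null, and by inner regularity so would the
  whole group.\<close>

lemma open_pos:
  assumes "open U" "U \<noteq> {}" shows "emeasure M U > 0"
proof (rule ccontr)
  assume "\<not> ?thesis"
  then have 0: "emeasure M U = 0" by (simp add: not_gr_zero)
  obtain u where u: "u \<in> U" using assms(2) by blast
  have "emeasure M K = 0" if K: "compact K" for K
  proof -
    define W where "W k = (\<lambda>x. k - u + x) ` U" for k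
    have W: "W k = (\<lambda>x. u - k + x) -` U" for k
    proof (intro set_eqI iffI)
      fix x assume "x \<in> (\<lambda>x. u - k + x) -` U"
      then have "u - k + x \<in> U" by simp
      then show "x \<in> W k" unfolding W_def
        by (intro image_eqI[of _ _ "u - k + x"]) (simp_all only: group_normalize)
    next
      fix x assume "x \<in> W k"
      then obtain y where "y \<in> U" "x = k - u + y" unfolding W_def by blast
      then show "x \<in> (\<lambda>x. u - k + x) -` U" by (simp only: group_normalize vimage_eq)
    qed
    have op: "open (W k)" for k unfolding W by (intro open_vimage_cont assms continuous_intros)
    have "K \<subseteq> (\<Union>k\<in>K. W k)" using u by (auto simp: W)
    then obtain D where D: "D \<subseteq> K" "finite D" "K \<subseteq> (\<Union>k\<in>D. W k)"
      using compactE_image[OF K, of K W] op by metis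
    have "emeasure M K \<le> emeasure M (\<Union>k\<in>D. W k)"
      by (rule emeasure_mono[OF D(3)]) (simp add: open_UN op borel_open)
    also have "\<dots> \<le> (\<Sum>k\<in>D. emeasure M (W k))"
      by (rule emeasure_subadditive_finite[OF D(2)]) (use op in auto)
    also have "\<dots> = 0"
      using 0 emeasure_translate[of U] assms unfolding W_def by simp
    finally show ?thesis by simp
  qed
  then have "emeasure M UNIV \<le> 0"
    unfolding inner_regular[OF open_UNIV] by (intro SUP_least) simp
  then have "emeasure M UNIV = 0" by simp
  then show False using haar unfolding left_haar_measure_def by simp
qed

text \<open>The parameter space is arbitrary, so sequences and dominated convergence do not decide
  continuity. Instead the support stays in one compact set while \<open>p\<close> varies near a
  point, and on that set \<open>tube_uniform\<close> makes the integrand uniformly close.\<close>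

lemma continuous_parameter_integral:
  fixes k :: "'a \<Rightarrow> 'p::topological_space \<Rightarrow> complex"
  assumes k: "continuous_on UNIV (\<lambda>(x, p). k x p)" 
    and loc: "\<And>p. \<exists>U K. open U \<and> p \<in> U \<and> compact K \<and> (\<forall>x p. x \<notin> K \<longrightarrow> p \<in> U \<longrightarrow> k x p = 0)"
  shows "continuous_on UNIV (\<lambda>p. \<integral>x. k x p \<partial>M)"
  unfolding continuous_on_def
proof (intro ballI tendstoI)
  fix p0 :: 'p and e :: real assume e: "e > 0"
  obtain U K where U: "open U" "p0 \<in> U" and K: "compact K" "\<And>x p. x \<notin> K \<Longrightarrow> p \<in> U \<Longrightarrow> k x p = 0"
    using loc[of p0] by metis
  \<comment> \<open>The summand 1 keeps the denominator positive when \<open>K\<close> is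
    null.\<close>
  define d where "d = e / (measure M K + 1)"
  have mK: "measure M K + 1 > 0" using measure_nonneg[of M K] by linarith
  have d: "d > 0" using e mK by (simp add: d_def)
  obtain V where V: "open V" "p0 \<in> V" "\<And>x y. x \<in> K \<Longrightarrow> y \<in> V \<Longrightarrow> dist (k x y) (k x p0) < d"
    using tube_uniform[OF k K(1) d] by metis
  have kp: "continuous_on UNIV (\<lambda>x. k x p)" for p
    using continuous_on_compose2[OF k, of UNIV "\<lambda>x. (x, p)"] by (simp add: continuous_on_Pair)
  have I: "integrable M (\<lambda>x. k x p)" if "p \<in> U" for p
    by (intro Cc_integrable CcI[OF kp K(1)]) (use K that in auto)
  have "dist (\<integral>x. k x p \<partial>M) (\<integral>x. k x p0 \<partial>M) < e" if p: "p \<in> V \<inter> U" for p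
  proof -
    have "dist (\<integral>x. k x p \<partial>M) (\<integral>x. k x p0 \<partial>M) = norm (\<integral>x. k x p - k x p0 \<partial>M)"
      using I[of p] I[of p0] U p by (simp add: dist_norm)
    also have "\<dots> \<le> d * measure M K"
    proof (rule norm_integral_bounded_support[OF _ K(1)])
      show "(\<lambda>x. k x p - k x p0) \<in> borel_measurable M"
        by (intro continuous_borel continuous_intros kp)
      show "norm (k x p - k x p0) \<le> d" for x
        using V(3)[of x p] K(2)[of x p] K(2)[of x p0] p U d by (cases "x \<in> K") (auto simp: dist_norm)
    qed (use K p U in auto)
    also have "\<dots> < d * (measure M K + 1)" using d by simp
    also have "\<dots> = e" using mK by (simp add: d_def)
    finally show ?thesis .
  qed
  then show "\<forall>\<^sub>F p in at p0 within UNIV. dist (\<integral>x. k x p \<partial>M) (\<integral>x. k x p0 \<partial>M) < e"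
    using V(1,2) U open_Int[OF V(1) U(1)] unfolding eventually_at_topological by blast
qed

text \<open>The index \<open>c\<close> of a piece doubles as its sample point, and it may lie
  outside \<open>A c\<close>.\<close>

lemma riemann_sum:
  fixes h :: "'a \<Rightarrow> complex"
  assumes h: "integrable M h" and L: "compact L" "\<And>s. s \<notin> L \<Longrightarrow> h s = 0"
    and D: "finite D" "\<And>c. c \<in> D \<Longrightarrow> A c \<in> sets borel" "disjoint_family_on A D" "L \<subseteq> (\<Union>c\<in>D. A c)"
    and e: "\<And>c s. c \<in> D \<Longrightarrow> s \<in> A c \<Longrightarrow> norm (h s - h c) \<le> e" "e \<ge> 0"
  shows "norm ((\<integral>s. h s \<partial>M) - (\<Sum>c\<in>D. of_real (measure M (A c \<inter> L)) * h c)) \<le> e * measure M L"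
proof -
  have AL: "emeasure M (A c \<inter> L) < \<infinity>" for c
    using emeasure_mono[of "A c \<inter> L" L M] emeasure_compact[OF L(1)] L(1)
    by (simp add: le_less_trans)
  define S where "S s = (\<Sum>c\<in>D. complex_of_real (indicator (A c \<inter> L) s) * h c)" for s
  have Si: "integrable M (\<lambda>s. complex_of_real (indicator (A c \<inter> L) s) * h c)" if "c \<in> D" for c
    using AL[of c] D(2)[OF that] L(1)
    by (intro integrable_mult_left integrable_of_real integrable_real_indicator) auto
  have "(\<integral>s. S s \<partial>M) = (\<Sum>c\<in>D. (\<integral>s. complex_of_real (indicator (A c \<inter> L) s) * h c \<partial>M))"
    unfolding S_def by (intro Bochner_Integration.integral_sum Si)
  also have "\<dots> = (\<Sum>c\<in>D. of_real (measure M (A c \<inter> L)) * h c)"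
    by (intro sum.cong refl) (simp add: integral_of_real)
  finally have "(\<integral>s. h s \<partial>M) - (\<Sum>c\<in>D. of_real (measure M (A c \<inter> L)) * h c) = (\<integral>s. h s - S s \<partial>M)"
    using h Si unfolding S_def by simp
  moreover have "norm (\<integral>s. h s - S s \<partial>M) \<le> e * measure M L"
  proof (rule norm_integral_bounded_support[OF _ L(1)])
    show "(\<lambda>s. h s - S s) \<in> borel_measurable M"
      using h Si unfolding S_def by (intro borel_measurable_integrable) simp
    show "h s - S s = 0" if "s \<notin> L" for s using L(2) that by (simp add: S_def)
    show "norm (h s - S s) \<le> e" for s
    proof (cases "s \<in> L")
      case True
      then obtain c where c: "c \<in> D" "s \<in> A c" using D(4) by blast
      have "s \<notin> A c'" if "c' \<in> D" "c' \<noteq> c" for c'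
        using D(3) c that unfolding disjoint_family_on_def by blast
      then have "S s = (\<Sum>c'\<in>D. if c' = c then h c else 0)"
        unfolding S_def using c True by (intro sum.cong refl) auto
      then show ?thesis using D(1) c e by simp
    qed (use L e in \<open>simp add: S_def\<close>)
  qed
  ultimately show ?thesis by simp
qed

text \<open>For Riemann sums the exchange is linearity of \<open>m\<close>. Partitioning
  \<open>L\<close> into pieces on which \<open>F s\<close> stays within \<open>e\<close> of a sample
  \<open>F c\<close>, uniformly in \<open>y\<close>, makes the sums close to the integral in the
  supremum norm, and boundedness of \<open>m\<close> controls the error. All assumptions on
  \<open>m\<close> concern \<open>BC\<close>, so that means and integrals against a bounded function
  both fit.\<close>

lemma interchange:
  fixes F :: "'a \<Rightarrow> 'b::topological_space \<Rightarrow> complex" and m :: "('b \<Rightarrow> complex) \<Rightarrow> complex"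
  assumes add: "\<And>f g. f \<in> BC \<Longrightarrow> g \<in> BC \<Longrightarrow> m (\<lambda>y. f y + g y) = m f + m g"
    and scale: "\<And>c f. f \<in> BC \<Longrightarrow> m (\<lambda>y. c * f y) = c * m f"
    and bound: "\<And>f B. f \<in> BC \<Longrightarrow> (\<And>y. norm (f y) \<le> B) \<Longrightarrow> norm (m f) \<le> C * B" "C \<ge> 0"
    and F: "\<And>s. F s \<in> BC" and L: "compact L" "\<And>s y. s \<notin> L \<Longrightarrow> F s y = 0"
    and cont: "\<And>s e. e > 0 \<Longrightarrow> \<exists>V. open V \<and> s \<in> V \<and> (\<forall>s'\<in>V. \<forall>y. norm (F s' y - F s y) < e)"
    and G: "(\<lambda>y. \<integral>s. F s y \<partial>M) \<in> BC"
  shows "m (\<lambda>y. \<integral>s. F s y \<partial>M) = (\<integral>s. m (F s) \<partial>M)"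
proof -
  have zero: "m (\<lambda>y. 0) = 0" using scale[OF BC_const, of 0 0] by simp
  have diff: "m (\<lambda>y. f y - g y) = m f - m g" if "f \<in> BC" "g \<in> BC" for f g
    using add[OF that(1) BC_cmult[OF that(2), of "-1"]] scale[OF that(2), of "-1"] by simp
  have msum: "m (\<lambda>y. \<Sum>c\<in>D. a c * F c y) = (\<Sum>c\<in>D. a c * m (F c))" for D a
  proof (induction D rule: infinite_finite_induct)
    case (insert d D)
    have "m (\<lambda>y. \<Sum>c\<in>insert d D. a c * F c y) = m (\<lambda>y. a d * F d y + (\<Sum>c\<in>D. a c * F c y))"
      using insert by simp
    also have "\<dots> = a d * m (F d) + (\<Sum>c\<in>D. a c * m (F c))"
      using insert by (subst add) (auto intro!: BC_cmult BC_sum F simp: scale F)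
    finally show ?case using insert by simp
  qed (auto simp: zero)
  have mF: "norm (m (F s') - m (F s)) \<le> C * e" if "\<And>y. norm (F s' y - F s y) \<le> e" for s s' e
    using bound(1)[of "\<lambda>y. F s' y - F s y" e] that diff[OF F F]
      BC_add[OF F BC_cmult[OF F, of "-1"], of s' s] by simp
  have c1: "continuous_on UNIV (\<lambda>s. F s y)" for y
    unfolding continuous_on_def
  proof (intro ballI tendstoI)
    fix s e assume "(e::real) > 0"
    from cont[OF this, of s] show "\<forall>\<^sub>F s' in at s within UNIV. dist (F s' y) (F s y) < e"
      unfolding eventually_at_topological dist_norm by blast
  qed
  have c2: "continuous_on UNIV (\<lambda>s. m (F s))"
    unfolding continuous_on_def
  proof (intro ballI tendstoI)
    fix s e assume e: "(e::real) > 0"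
    then have e': "e / (C + 1) > 0" using bound(2) by simp
    have *: "C * (e / (C + 1)) < e" using e bound(2) by (simp add: field_simps)
    obtain V where V: "open V" "s \<in> V" "\<forall>s'\<in>V. \<forall>y. norm (F s' y - F s y) < e / (C + 1)"
      using cont[OF e', of s] by blast
    have "dist (m (F s')) (m (F s)) < e" if "s' \<in> V" for s'
      using mF[of s' s "e / (C + 1)"] V(3) that * unfolding dist_norm by (meson le_less_trans less_imp_le)
    then show "\<forall>\<^sub>F s' in at s within UNIV. dist (m (F s')) (m (F s)) < e"
      using V unfolding eventually_at_topological by blast
  qed
  have I1: "integrable M (\<lambda>s. F s y)" for y
    by (intro Cc_integrable CcI[OF c1 L(1)] L(2))
  have m0: "m (F s) = 0" if "s \<notin> L" for s
  proof -
    have "F s = (\<lambda>y. 0)" using L(2)[OF that] by auto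
    then show ?thesis using zero by simp
  qed
  have I2: "integrable M (\<lambda>s. m (F s))"
    by (intro Cc_integrable CcI[OF c2 L(1)] m0)
  \<comment> \<open>The factor 2 counts two errors of size \<open>C * e * measure M L\<close>: one
    between \<open>m R\<close> and \<open>m\<close> of the integral, one from \<open>m R\<close>
    being a Riemann sum for the integral of \<open>m (F s)\<close> over the same pieces.\<close>
  have est: "norm (m (\<lambda>y. \<integral>s. F s y \<partial>M) - (\<integral>s. m (F s) \<partial>M)) \<le> e * (2 * C * measure M L)"
    if e: "e > 0" for e
  proof -
    obtain V where V: "\<And>s. open (V s)" "\<And>s. s \<in> V s" "\<And>s s' y. s' \<in> V s \<Longrightarrow> norm (F s' y - F s y) < e"
      using cont[OF e] by metis
    have "L \<subseteq> (\<Union>s\<in>L. V s)" using V(2) by blast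
    then obtain D where D: "D \<subseteq> L" "finite D" "L \<subseteq> (\<Union>s\<in>D. V s)"
      using compactE_image[OF L(1), of L V] V(1) by metis
    obtain A where A: "\<And>c. c \<in> D \<Longrightarrow> A c \<in> sets borel" "\<And>c. c \<in> D \<Longrightarrow> A c \<subseteq> V c"
      "disjoint_family_on A D" "(\<Union>c\<in>D. A c) = (\<Union>c\<in>D. V c)"
      using finite_borel_partition[OF D(2), of V] V(1) by metis
    define R where "R y = (\<Sum>c\<in>D. complex_of_real (measure M (A c \<inter> L)) * F c y)" for y
    have R: "R \<in> BC" unfolding R_def by (intro BC_sum BC_cmult F)
    have mR: "m R = (\<Sum>c\<in>D. complex_of_real (measure M (A c \<inter> L)) * m (F c))"
      unfolding R_def by (rule msum)
    have e1: "norm ((\<integral>s. F s y \<partial>M) - R y) \<le> e * measure M L" for y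
      unfolding R_def
      proof (rule riemann_sum[OF I1 L D(2) A(1,3)])
        show "norm (F s y - F c y) \<le> e" if "c \<in> D" "s \<in> A c" for c s
          using V(3)[of s c y] A(2)[OF that(1)] that by auto
      qed (use D A e in auto)
    have e2: "norm ((\<integral>s. m (F s) \<partial>M) - m R) \<le> C * e * measure M L"
      unfolding mR
    proof (rule riemann_sum[OF I2 L(1) m0 D(2) A(1,3)])
      show "norm (m (F s) - m (F c)) \<le> C * e" if "c \<in> D" "s \<in> A c" for c s
        by (rule mF, rule less_imp_le, rule V(3)) (use that A(2) in blast)
    qed (use D A bound e in auto)
    have "norm (m (\<lambda>y. (\<integral>s. F s y \<partial>M) - R y)) \<le> C * (e * measure M L)"
      using bound(1)[OF _ e1] BC_add[OF G BC_cmult[OF R, of "-1"]] by simp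
    then have "norm (m (\<lambda>y. \<integral>s. F s y \<partial>M) - m R) \<le> C * (e * measure M L)"
      by (simp add: diff[OF G R])
    with e2 show ?thesis
      using norm_triangle_sub[of "m (\<lambda>y. \<integral>s. F s y \<partial>M) - m R" "(\<integral>s. m (F s) \<partial>M) - m R"]
        norm_triangle_ineq4[of "m (\<lambda>y. \<integral>s. F s y \<partial>M) - m R" "(\<integral>s. m (F s) \<partial>M) - m R"]
      by (simp add: algebra_simps)
  qed
  define N where "N = norm (m (\<lambda>y. \<integral>s. F s y \<partial>M) - (\<integral>s. m (F s) \<partial>M))"
  define K where "K = 2 * C * measure M L"
  have "K \<ge> 0" using bound(2) by (simp add: K_def)
  have "N \<le> 0"
  proof (rule field_le_epsilon)
    fix e :: real assume "e > 0"
    then have "N \<le> e / (K + 1) * K" using est[of "e / (K + 1)"] \<open>K \<ge> 0\<close> by (simp add: N_def K_def)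
    also have "\<dots> \<le> e" using \<open>e > 0\<close> \<open>K \<ge> 0\<close> by (simp add: field_simps)
    finally show "N \<le> 0 + e" by simp
  qed
  then show ?thesis by (simp add: N_def)
qed

end

section \<open>The pairing of \<open>Linf\<close> with \<open>L1\<close>, and Fubini for continuous
  kernels with compact support\<close>

lemma LinfE:
  assumes "T \<in> Linf M"
  obtains B where "B > 0" "\<And>x. norm (T x) \<le> B"
proof -
  obtain B where "B > 0" "\<And>x. x \<in> range T \<Longrightarrow> norm x \<le> B"
    using assms unfolding Linf_def bounded_pos by blast
  then show ?thesis using that[of B] by auto
qed

text \<open>\<open>T\<close> is measurable only on sets of finite measure, but an integrable
  \<open>f\<close> vanishes off a countable union of such sets: Markov's inequality bounds the
  measure of each \<open>A n\<close>, and the product is zero on the rest.\<close>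

lemma Linf_mult_measurable:
  assumes T: "T \<in> Linf M" and f: "integrable M f"
  shows "(\<lambda>x. T x * f x) \<in> borel_measurable M"
proof -
  define A where "A n = {x \<in> space M. norm (f x) \<ge> 1 / (real n + 1)}" for n :: nat
  have A [measurable]: "A n \<in> sets M" for n
    using f unfolding A_def by measurable
  have Afin: "emeasure M (A n) < \<infinity>" for n
  proof -
    have "emeasure M (A n) \<le> ennreal (1 / (1 / (real n + 1)) * (\<integral>x. norm (f x) \<partial>M))"
      unfolding A_def by (rule integral_Markov_inequality) (use f in auto)
    then show ?thesis by (simp add: le_less_trans)
  qed
  define Z where "Z = {x \<in> space M. f x = 0}"
  have Z [measurable]: "Z \<in> sets M" using f unfolding Z_def by measurable
  show ?thesis
  proof (rule measurable_piecewise_restrict[of "insert Z (range A)"])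
    show "\<Omega> \<inter> space M \<in> sets M" if "\<Omega> \<in> insert Z (range A)" for \<Omega>
      using that by auto
    show "space M \<subseteq> \<Union>(insert Z (range A))"
    proof
      fix x assume x: "x \<in> space M"
      show "x \<in> \<Union>(insert Z (range A))"
      proof (cases "f x = 0")
        case False
        then obtain n where "inverse (real (Suc n)) < norm (f x)"
          using reals_Archimedean[of "norm (f x)"] by auto
        then have "x \<in> A n" using x by (simp add: A_def inverse_eq_divide add.commute)
        then show ?thesis by blast
      qed (use x in \<open>auto simp: Z_def\<close>)
    qed
    show "(\<lambda>x. T x * f x) \<in> borel_measurable (restrict_space M \<Omega>)" if "\<Omega> \<in> insert Z (range A)" for \<Omega>
    proof (cases "\<Omega> = Z")
      case True
      have "(\<lambda>x. T x * f x) \<in> borel_measurable (restrict_space M Z) \<longleftrightarrow>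
          (\<lambda>x. 0::complex) \<in> borel_measurable (restrict_space M Z)"
        by (rule measurable_cong) (auto simp: space_restrict_space Z_def)
      then show ?thesis using True by simp
    next
      case False
      with that obtain n where n: "\<Omega> = A n" by auto
      have "T \<in> borel_measurable (restrict_space M (A n))"
        using T A Afin unfolding Linf_def locally_measurable_def by blast
      moreover have "f \<in> borel_measurable (restrict_space M (A n))"
        using f by (intro measurable_restrict_space1) simp
      ultimately show ?thesis unfolding n by simp
    qed
  qed simp
qed

lemma Linf_mult_integrable:
  assumes T: "T \<in> Linf M" and f: "integrable M f"
  shows "integrable M (\<lambda>x. T x * f x)"
proof -
  obtain B where B: "B > 0" "\<And>x. norm (T x) \<le> B" using LinfE[OF T] by metis
  show ?thesis
  proof (rule Bochner_Integration.integrable_bound)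
    show "integrable M (\<lambda>x. B * norm (f x))" using f by simp
    show "AE x in M. norm (T x * f x) \<le> norm (B * norm (f x))"
      using B by (auto simp: norm_mult intro!: mult_right_mono)
  qed (rule Linf_mult_measurable[OF T f])
qed

lemma norm_Linf_integral_le:
  assumes T: "T \<in> Linf M" "\<And>x. norm (T x) \<le> B" and f: "integrable M f"
  shows "norm (\<integral>x. T x * f x \<partial>M) \<le> B * (\<integral>x. norm (f x) \<partial>M)"
proof -
  have "norm (\<integral>x. T x * f x \<partial>M) \<le> (\<integral>x. norm (T x * f x) \<partial>M)" by (rule integral_norm_bound)
  also have "\<dots> \<le> (\<integral>x. B * norm (f x) \<partial>M)"
    using integrable_norm[OF Linf_mult_integrable[OF T(1) f]] f T(2)
    by (intro integral_mono) (auto simp: norm_mult intro!: mult_right_mono)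
  finally show ?thesis by simp
qed

context lc_haar
begin

lemma BC_subset_Linf: "f \<in> BC \<Longrightarrow> f \<in> Linf M"
  using continuous_borel[of f]
  by (auto simp: BC_def Linf_def locally_measurable_def intro: measurable_restrict_space1)

text \<open>This is \<open>interchange\<close> for integration against \<open>T\<close>; it
  sidesteps the product measure altogether.\<close>

lemma fubini_Cc:
  assumes T: "T \<in> Linf M" and k: "continuous_on UNIV (\<lambda>(s, z). k s z)"
    and K: "compact K1" "compact K2" "\<And>s z. s \<notin> K1 \<Longrightarrow> k s z = 0" "\<And>s z. z \<notin> K2 \<Longrightarrow> k s z = 0"
  shows "(\<integral>z. T z * (\<integral>s. k s z \<partial>M) \<partial>M) = (\<integral>s. (\<integral>z. T z * k s z \<partial>M) \<partial>M)"
proof -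
  obtain B where B: "B > 0" "\<And>x. norm (T x) \<le> B" using LinfE[OF T] by metis
  \<comment> \<open>Cutting \<open>f\<close> off at \<open>K2\<close> makes the integral exist for
    every \<open>f\<close> in \<open>BC\<close> and bounds it by \<open>B * measure M K2\<close>
    times the supremum of \<open>f\<close>.\<close>
  define m where "m f = (\<integral>z. T z * (indicator K2 z * f z) \<partial>M)" for f :: "'a \<Rightarrow> complex"
  have I: "integrable M (\<lambda>z. indicator K2 z * f z)" if f: "f \<in> BC" for f :: "'a \<Rightarrow> complex"
  proof -
    obtain C where C: "continuous_on UNIV f" "C > 0" "\<And>x. norm (f x) \<le> C" using BCE[OF f] by metis
    have [measurable]: "f \<in> borel_measurable M" using continuous_borel[OF C(1)] .
    have [measurable]: "K2 \<in> sets M" using K(2) by simp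
    show ?thesis
    proof (rule integrable_bounded_support[OF _ K(2)])
      show "norm (indicator K2 x * f x) \<le> C" for x
        using C by (cases "x \<in> K2") (auto simp: less_imp_le)
    qed auto
  qed
  have I': "integrable M (\<lambda>z. T z * (indicator K2 z * f z))" if f: "f \<in> BC" for f :: "'a \<Rightarrow> complex"
    by (rule Linf_mult_integrable[OF T I[OF f]])
  have ks: "continuous_on UNIV (\<lambda>z. k s z)" for s
    using continuous_on_compose2[OF k, of UNIV "\<lambda>x. (s, x)"] by (simp add: continuous_on_Pair)
  have k': "continuous_on UNIV (\<lambda>(z, s). k s z)"
    using continuous_on_compose2[OF k, of UNIV "prod.swap"] by (simp add: continuous_on_swap case_prod_unfold)
  have ksBC: "(\<lambda>z. k s z) \<in> BC" for s
  proof -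
    have "(\<lambda>z. k s z) \<in> Cc" by (rule CcI[OF ks K(2) K(4)])
    then show ?thesis using Cc_bounded BCI[OF ks] by metis
  qed
  have m_eq: "m f = (\<integral>z. T z * f z \<partial>M)" if "\<And>z. z \<notin> K2 \<Longrightarrow> f z = 0" for f
    unfolding m_def using that by (intro Bochner_Integration.integral_cong refl) (auto simp: indicator_def)
  have 1: "m (\<lambda>y. \<integral>s. k s y \<partial>M) = (\<integral>s. m (\<lambda>z. k s z) \<partial>M)"
  proof (rule interchange[where F = k and C = "B * measure M K2" and L = K1])
    show "m (\<lambda>y. f y + g y) = m f + m g" if "f \<in> BC" "g \<in> BC" for f g
      unfolding m_def using I'[OF that(1)] I'[OF that(2)] by (simp add: algebra_simps)
    show "m (\<lambda>y. c * f y) = c * m f" for c f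
      unfolding m_def by (simp add: algebra_simps flip: integral_mult_right_zero)
    show "norm (m f) \<le> B * measure M K2 * C" if f: "f \<in> BC" "\<And>y. norm (f y) \<le> C" for f C
    proof -
      have C: "C \<ge> 0" using f(2)[of undefined] norm_ge_zero order_trans by blast
      have "norm (m f) \<le> (B * C) * measure M K2"
        unfolding m_def
      proof (rule norm_integral_bounded_support[OF _ K(2)])
        show "(\<lambda>z. T z * (indicator K2 z * f z)) \<in> borel_measurable M" using I'[OF f(1)] by simp
        show "norm (T x * (indicator K2 x * f x)) \<le> B * C" for x
          using B f(2)[of x] C by (cases "x \<in> K2") (auto simp: norm_mult intro!: mult_mono)
      qed auto
      then show ?thesis by (simp add: mult_ac)
    qed
    show "\<exists>V. open V \<and> s \<in> V \<and> (\<forall>s'\<in>V. \<forall>y. norm (k s' y - k s y) < e)" if e: "e > 0" for s e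
    proof -
      obtain V where V: "open V" "s \<in> V" "\<And>x y. x \<in> K2 \<Longrightarrow> y \<in> V \<Longrightarrow> dist (k y x) (k s x) < e"
        using tube_uniform[OF k' K(2) e] by metis
      have "norm (k s' y - k s y) < e" if "s' \<in> V" for s' y
        using V(3)[of y s'] that K(4)[of y] e by (cases "y \<in> K2") (auto simp: dist_norm)
      then show ?thesis using V by blast
    qed
    have "(\<lambda>y. \<integral>s. k s y \<partial>M) \<in> Cc"
    proof (rule CcI[OF _ K(2)])
      show "continuous_on UNIV (\<lambda>y. \<integral>s. k s y \<partial>M)"
        by (rule continuous_parameter_integral[OF k]) (use K(1,3) in blast)
    qed (simp add: K)
    then show "(\<lambda>y. \<integral>s. k s y \<partial>M) \<in> BC"
      using Cc_bounded BCI Cc_continuous by metis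
  qed (use K ksBC B in auto)
  have "m (\<lambda>y. \<integral>s. k s y \<partial>M) = (\<integral>z. T z * (\<integral>s. k s z \<partial>M) \<partial>M)"
    by (rule m_eq) (simp add: K)
  moreover have "m (\<lambda>z. k s z) = (\<integral>z. T z * k s z \<partial>M)" for s
    by (rule m_eq) (simp add: K)
  ultimately show ?thesis using 1 by simp
qed

lemma fubini_Cc_1:
  assumes k: "continuous_on UNIV (\<lambda>(s, z). k s z)"
    and K: "compact K1" "compact K2" "\<And>s z. s \<notin> K1 \<Longrightarrow> k s z = 0" "\<And>s z. z \<notin> K2 \<Longrightarrow> k s z = (0::complex)"
  shows "(\<integral>z. (\<integral>s. k s z \<partial>M) \<partial>M) = (\<integral>s. (\<integral>z. k s z \<partial>M) \<partial>M)"
  using fubini_Cc[OF BC_subset_Linf[OF BC_const[of 1]] k K] by simp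

lemma Cc_complex_of_real: "f \<in> Cc \<Longrightarrow> (\<lambda>x. complex_of_real (f x)) \<in> Cc"
  by (auto simp: Cc_def compact_support_def intro!: continuous_intros)

text \<open>Testing against \<open>\<phi>\<close> times the conjugate of \<open>d\<close> yields the
  integral of \<open>\<phi>\<close> times \<open>|d|^2\<close>, a nonnegative continuous function.
  If \<open>d w\<close> were nonzero, it would be positive on a nonempty open set, which is not null
  by \<open>open_pos\<close>.\<close>

lemma continuous_zero_of_integral_zero:
  fixes d :: "'a \<Rightarrow> complex"
  assumes d: "continuous_on UNIV d" and z: "\<And>f. f \<in> Cc \<Longrightarrow> (\<integral>x. f x * d x \<partial>M) = 0"
  shows "d w = 0"
proof (rule ccontr)
  assume nz: "d w \<noteq> 0"
  obtain \<phi> :: "'a \<Rightarrow> real" where \<phi>: "\<phi> \<in> Cc" "\<And>x. 0 \<le> \<phi> x" "\<And>x. x \<in> {w} \<Longrightarrow> \<phi> x = 1"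
    using Cc_Urysohn[OF lc compact_sing[of w] open_UNIV] by (metis subset_UNIV)
  define h where "h x = \<phi> x * (norm (d x))\<^sup>2" for x
  have hc: "continuous_on UNIV h"
    unfolding h_def using d Cc_continuous[OF \<phi>(1)] by (intro continuous_intros)
  obtain K where K: "compact K" "\<And>x. x \<notin> K \<Longrightarrow> \<phi> x = 0" using CcE[OF \<phi>(1)] by metis
  have h: "h \<in> Cc" by (rule CcI[OF hc K(1)]) (simp add: h_def K)
  define f where "f x = complex_of_real (\<phi> x) * cnj (d x)" for x
  have "f \<in> Cc"
    by (rule CcI[OF _ K(1)])
       (auto simp: f_def K intro!: continuous_intros d Cc_continuous[OF \<phi>(1)])
  then have "0 = (\<integral>x. f x * d x \<partial>M)" using z by simp
  also have "\<dots> = (\<integral>x. complex_of_real (h x) \<partial>M)"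
    by (intro Bochner_Integration.integral_cong refl)
       (simp add: f_def h_def mult_ac complex_norm_square del: of_real_power)
  also have "\<dots> = complex_of_real (\<integral>x. h x \<partial>M)" by simp
  finally have "(\<integral>x. h x \<partial>M) = 0" by simp
  then have "AE x in M. h x = 0"
    by (subst (asm) integral_nonneg_eq_0_iff_AE[OF Cc_integrable[OF h]]) (simp_all add: h_def \<phi>(2))
  then have "AE x in M. \<not> h x > 0" by auto
  moreover have op: "open {x. h x > 0}" by (intro open_Collect_less hc continuous_intros)
  ultimately have "emeasure M {x. h x > 0} = 0"
    using AE_iff_measurable[of "{x. h x > 0}" M "\<lambda>x. \<not> h x > 0"] by (simp add: borel_open)
  moreover have "w \<in> {x. h x > 0}" using nz \<phi>(3)[of w] by (simp add: h_def)
  ultimately show False using open_pos[OF op] by auto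
qed

end

lemma mem_set_add: "a \<in> A \<Longrightarrow> b \<in> B \<Longrightarrow> x = a + b \<Longrightarrow> x \<in> {a + b | a b. a \<in> A \<and> b \<in> B}"
  by blast

context lc_haar
begin

subsection \<open>Unimodularity\<close>

text \<open>Up to normalisation, \<open>rdens g\<close> is the density of the Haar measure with respect to its image under
  inversion; see \<open>integral_rdens\<close>.\<close>

definition rdens :: "('a \<Rightarrow> complex) \<Rightarrow> 'a \<Rightarrow> complex" where
  "rdens g w = (\<integral>x. g (w - x) \<partial>M)"

lemma rdens_continuous:
  assumes g: "g \<in> Cc" shows "continuous_on UNIV (rdens g)"
proof -
  obtain K where K: "compact K" "\<And>x. x \<notin> K \<Longrightarrow> g x = 0" using CcE[OF g] by metis
  show ?thesis unfolding rdens_def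
  proof (rule continuous_parameter_integral)
    show "continuous_on UNIV (\<lambda>(x, p). g (p - x))"
      by (auto simp: case_prod_unfold intro!: continuous_on_Cc[OF g] continuous_intros)
    fix w
    obtain U L where U: "open U" "compact L" "w \<in> U" "U \<subseteq> (L :: 'a set)"
      by (rule locally_compact_nbhd[OF lc, where x = w])
    have "g (p - x) = 0" if "x \<notin> {a + b | a b. a \<in> uminus ` K \<and> b \<in> L}" "p \<in> U" for x p
    proof (rule K(2), rule notI)
      assume "p - x \<in> K"
      then have "x \<in> {a + b | a b. a \<in> uminus ` K \<and> b \<in> L}"
        using that U by (intro mem_set_add[of "- (p - x)" _ p] imageI) (simp_all only: group_normalize, blast)
      with that show False by blast
    qed
    then show "\<exists>U K. open U \<and> w \<in> U \<and> compact K \<and> (\<forall>x p. x \<notin> K \<longrightarrow> p \<in> U \<longrightarrow> g (p - x) = 0)"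
      using U compact_set_add[OF compact_uminus_image[OF K(1)] U(2)] by blast
  qed
qed

text \<open>The double integral of \<open>g (- y) * f (- y + x)\<close> is taken in both orders,
  with \<open>y\<close> replaced by \<open>x + y\<close> in between. For fixed \<open>g\<close> and
  varying \<open>f\<close> this compares \<open>M\<close> with its image under inversion.\<close>

lemma integral_rdens:
  assumes f: "f \<in> Cc" and g: "g \<in> Cc"
  shows "(\<integral>x. f x \<partial>M) * (\<integral>y. g (- y) \<partial>M) = (\<integral>y. f (- y) * rdens g (- y) \<partial>M)"
proof -
  obtain Kf where Kf: "compact Kf" "\<And>x. x \<notin> Kf \<Longrightarrow> f x = 0" using CcE[OF f] by metis
  obtain Kg where Kg: "compact Kg" "\<And>x. x \<notin> Kg \<Longrightarrow> g x = 0" using CcE[OF g] by metis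
  define K where "K = {a + b | a b. a \<in> uminus ` Kg \<and> b \<in> Kf}"
  have K: "compact K" unfolding K_def by (intro compact_set_add compact_uminus_image Kf Kg)
  have "(\<integral>x. f x \<partial>M) * (\<integral>y. g (- y) \<partial>M) = (\<integral>y. g (- y) * (\<integral>x. f x \<partial>M) \<partial>M)"
    by simp
  also have "\<dots> = (\<integral>y. (\<integral>x. g (- y) * f (- y + x) \<partial>M) \<partial>M)"
    by (simp add: integral_left_translate[OF Cc_borel[OF f]])
  also have "\<dots> = (\<integral>x. (\<integral>y. g (- y) * f (- y + x) \<partial>M) \<partial>M)"
  proof (rule fubini_Cc_1[OF _ K compact_uminus_image[OF Kg(1)]])
    show "continuous_on UNIV (\<lambda>(x, y). g (- y) * f (- y + x))"
      by (auto simp: case_prod_unfold intro!: continuous_on_Cc[OF g] continuous_on_Cc[OF f] continuous_intros)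
    show z: "g (- y) * f (- y + x) = 0" if "y \<notin> uminus ` Kg" for x y
      using that Kg(2)[of "- y"] by (metis image_eqI minus_minus mult_zero_left)
    show "g (- y) * f (- y + x) = 0" if "x \<notin> K" for x y
    proof (rule ccontr)
      assume "\<not> ?thesis"
      then have "- y \<in> Kg" "- y + x \<in> Kf" using Kg Kf by auto
      then have "x \<in> K" unfolding K_def
        by (intro mem_set_add[of "- (- y)" _ "- y + x"] imageI) (simp_all only: group_normalize)
      with that show False by blast
    qed
  qed
  also have "\<dots> = (\<integral>x. (\<integral>y. g (- y - x) * f (- y) \<partial>M) \<partial>M)"
  proof (rule Bochner_Integration.integral_cong[OF refl])
    fix x
    have "(\<lambda>y. g (- y) * f (- y + x)) \<in> borel_measurable M"
      by (intro continuous_borel continuous_intros continuous_on_Cc[OF g] continuous_on_Cc[OF f])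
    from integral_left_translate[OF this, of x]
    show "(\<integral>y. g (- y) * f (- y + x) \<partial>M) = (\<integral>y. g (- y - x) * f (- y) \<partial>M)"
      by (simp add: minus_add add.assoc)
  qed
  also have "\<dots> = (\<integral>y. (\<integral>x. g (- y - x) * f (- y) \<partial>M) \<partial>M)"
  proof (rule fubini_Cc_1[OF _ compact_uminus_image[OF Kf(1)] K])
    show "continuous_on UNIV (\<lambda>(y, x). g (- y - x) * f (- y))"
      by (auto simp: case_prod_unfold intro!: continuous_on_Cc[OF g] continuous_on_Cc[OF f] continuous_intros)
    show z: "g (- y - x) * f (- y) = 0" if "y \<notin> uminus ` Kf" for x y
      using that Kf(2)[of "- y"] by (metis image_eqI minus_minus mult_zero_right)
    show "g (- y - x) * f (- y) = 0" if "x \<notin> K" for x y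
    proof (rule ccontr)
      assume "\<not> ?thesis"
      then have "- y \<in> Kf" "- y - x \<in> Kg" using Kg Kf by auto
      then have "x \<in> K" unfolding K_def
        by (intro mem_set_add[of "- (- y - x)" _ "- y"] imageI) (simp_all only: group_normalize)
      with that show False by blast
    qed
  qed
  also have "\<dots> = (\<integral>y. f (- y) * rdens g (- y) \<partial>M)"
    unfolding rdens_def by (simp add: mult.commute)
  finally show ?thesis .
qed

end

locale fc_haar = lc_haar +
  assumes fc: "\<And>t::'a. precompact (conj_class t)"
begin

text \<open>The quotient \<open>d w / d 0\<close> is a homomorphism into the positive reals, namely
  the modular function up to convention. The precompact classes bound it below by a positive
  constant, and such a homomorphism is trivial: a value below 1 would have powers tending to 0, and
  a value above 1 would have an inverse below 1.\<close>

lemma rdens_const: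
  obtains g0 :: "'a \<Rightarrow> complex" and c where "g0 \<in> Cc" "c \<noteq> 0" "\<And>w. rdens g0 w = c" "(\<integral>y. g0 (- y) \<partial>M) = c"
proof -
  obtain U L where U: "open U" "compact L" "0 \<in> U" "U \<subseteq> (L :: 'a set)"
    by (rule locally_compact_nbhd[OF lc, where x = 0])
  \<comment> \<open>The function \<open>\<phi>\<close> will be 1 on all conjugates of negatives of
    elements of \<open>L\<close>. Since \<open>d w\<close> is also the integral of
    \<open>\<phi> (w - x - w)\<close>, this gives \<open>d w \<ge> measure M L\<close> for all
    \<open>w\<close> at once.\<close>
  obtain C where C: "compact C" "\<And>k g. k \<in> uminus ` L \<Longrightarrow> g + k - g \<in> C"
    using compact_conjugates[OF lc fc compact_uminus_image[OF U(2)]] by metis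
  obtain \<phi> :: "'a \<Rightarrow> real" where \<phi>: "\<phi> \<in> Cc" "\<And>x. 0 \<le> \<phi> x" "\<And>x. x \<in> C \<Longrightarrow> \<phi> x = 1"
    using Cc_Urysohn[OF lc C(1) open_UNIV] by (metis subset_UNIV)
  define d where "d w = (\<integral>x. \<phi> (w - x) \<partial>M)" for w
  define g0 where "g0 x = complex_of_real (\<phi> x)" for x
  have g0: "g0 \<in> Cc" unfolding g0_def by (rule Cc_complex_of_real[OF \<phi>(1)])
  have r: "rdens g0 w = of_real (d w)" for w unfolding rdens_def g0_def d_def by simp
  have rho: "(\<integral>y. g0 (- y) \<partial>M) = of_real (d 0)" unfolding g0_def d_def by simp
  define c where "c = measure M L"
  have "emeasure M L > 0"
    using open_pos[OF U(1)] U(3) emeasure_mono[OF U(4), of M] U(2) by (auto intro: less_le_trans)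
  then have c: "c > 0"
    using emeasure_compact[OF U(2)] unfolding c_def measure_def by (simp add: enn2real_positive_iff)
  have dc: "d w \<ge> c" for w
  proof -
    have int: "integrable M (\<lambda>x. \<phi> (w - x - w))"
      using Cc_integrable[OF Cc_compose_uminus[OF Cc_translate[OF \<phi>(1), of w "- w"]]] by simp
    have "(\<lambda>x. \<phi> (w - x)) \<in> borel_measurable M"
      by (intro continuous_borel continuous_intros continuous_on_Cc[OF \<phi>(1)])
    from integral_left_translate[OF this, of w]
    have "d w = (\<integral>x. \<phi> (w - x - w) \<partial>M)" unfolding d_def
      by (simp only: group_normalize)
    also have "\<dots> \<ge> (\<integral>x. indicator L x \<partial>M)"
    proof (rule integral_mono[OF integrable_indicator_compact[OF U(2)] int])
      show "indicator L x \<le> \<phi> (w - x - w)" for x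
        using \<phi>(2)[of "w - x - w"] \<phi>(3)[of "w - x - w"] C(2)[of "- x" w] by (auto simp: indicator_def)
    qed
    finally show ?thesis by (simp add: c_def)
  qed
  \<comment> \<open>By \<open>integral_rdens\<close> applied to \<open>g\<close> and to
    \<open>g0\<close>, with the constants multiplied crosswise, both sides have the same integral
    against every function in \<open>Cc\<close> after inversion; being continuous, they
    agree.\<close>
  have proportional: "of_real (d 0) * rdens g w = (\<integral>y. g (- y) \<partial>M) * rdens g0 w" if g: "g \<in> Cc" for g w
  proof -
    define D where "D w = of_real (d 0) * rdens g w - (\<integral>y. g (- y) \<partial>M) * rdens g0 w" for w
    have Dc: "continuous_on UNIV D"
      unfolding D_def by (intro continuous_intros rdens_continuous g g0)
    have Dc': "continuous_on UNIV (\<lambda>x. D (- x))"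
      using continuous_on_compose2[OF Dc, of UNIV uminus] by (simp add: continuous_on_minus)
    have rc: "continuous_on UNIV (\<lambda>x. rdens h (- x))" if "h \<in> Cc" for h
      using continuous_on_compose2[OF rdens_continuous[OF that], of UNIV uminus] by (simp add: continuous_on_minus)
    have int: "integrable M (\<lambda>x. f x * rdens h (- x))" if fh: "f \<in> Cc" "h \<in> Cc" for f h
    proof -
      obtain K where K: "compact K" "\<And>x. x \<notin> K \<Longrightarrow> f x = 0" using CcE[OF fh(1)] by metis
      show ?thesis
        by (rule Cc_integrable, rule CcI[OF _ K(1)])
           (auto simp: K intro!: continuous_intros rc fh(2) Cc_continuous[OF fh(1)])
    qed
    have "D (- (- w)) = 0"
    proof (rule continuous_zero_of_integral_zero[OF Dc'])
      fix f :: "'a \<Rightarrow> complex" assume f: "f \<in> Cc"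
      note f' = Cc_compose_uminus[OF f]
      have "(\<integral>x. f x * D (- x) \<partial>M) = (\<integral>x. of_real (d 0) * (f x * rdens g (- x)) - (\<integral>y. g (- y) \<partial>M) * (f x * rdens g0 (- x)) \<partial>M)"
        unfolding D_def by (simp add: algebra_simps)
      also have "\<dots> = of_real (d 0) * (\<integral>x. f x * rdens g (- x) \<partial>M) - (\<integral>y. g (- y) \<partial>M) * (\<integral>x. f x * rdens g0 (- x) \<partial>M)"
        by (subst Bochner_Integration.integral_diff)
           (intro Bochner_Integration.integrable_mult_right int f g g0 | simp)+
      also have "\<dots> = 0"
        using integral_rdens[OF f' g, symmetric] integral_rdens[OF f' g0, symmetric] rho by (simp add: mult_ac)
      finally show "(\<integral>x. f x * D (- x) \<partial>M) = 0" .
    qed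
    then show ?thesis by (simp add: D_def)
  qed
  \<comment> \<open>Proportionality is applied to the translate \<open>g0 (t + x)\<close>: its
    \<open>rdens\<close> at \<open>w\<close> is \<open>d (t + w)\<close>, and its integral after
    inversion is \<open>d t\<close>.\<close>
  have hom: "d 0 * d (t + w) = d t * d w" for t w
  proof -
    have "(\<lambda>x. g0 (t + x)) \<in> Cc" using Cc_translate[OF g0, of t 0] by simp
    from proportional[OF this, of w]
    have "complex_of_real (d 0) * rdens g0 (t + w) = rdens g0 t * rdens g0 w"
      unfolding rdens_def by (simp only: group_normalize)
    then show ?thesis unfolding r of_real_mult[symmetric] of_real_eq_iff .
  qed
  define \<delta> where "\<delta> t = d t / d 0" for t
  have d0: "d 0 > 0" using dc[of 0] c by linarith
  have \<delta>hom: "\<delta> (t + w) = \<delta> t * \<delta> w" for t w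
    using hom[of t w] d0 by (simp add: \<delta>_def field_simps)
  have \<delta>c: "\<delta> t \<ge> c / d 0" for t using dc[of t] d0 by (simp add: \<delta>_def divide_right_mono)
  have not_less: "\<not> \<delta> t < 1" for t
  proof
    assume "\<delta> t < 1"
    moreover have "c / d 0 > 0" using c d0 by simp
    ultimately obtain n where n: "\<delta> t ^ n < c / d 0" using real_arch_pow_inv by blast
    have "\<delta> (((\<lambda>x. t + x) ^^ n) 0) = \<delta> t ^ n"
      by (induction n) (use d0 in \<open>auto simp: \<delta>hom\<close>, simp add: \<delta>_def)
    with n \<delta>c show False by (metis not_le)
  qed
  have "\<delta> t = 1" for t
  proof -
    have "\<delta> 0 = 1" using d0 by (simp add: \<delta>_def)
    then have "\<delta> t * \<delta> (- t) = 1" using \<delta>hom[of t "- t"] by simp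
    moreover have "\<delta> t \<ge> 1" "\<delta> (- t) \<ge> 1" using not_less[of t] not_less[of "- t"] by simp_all
    ultimately show ?thesis
      by (metis antisym mult.right_neutral mult_left_mono order_trans zero_le_one)
  qed
  then have "d t = d 0" for t unfolding \<delta>_def by (metis divide_eq_1_iff)
  then show ?thesis using that[OF g0, of "of_real (d 0)"] r rho d0 by auto
qed

lemma integral_uminus_Cc:
  fixes f :: "'a \<Rightarrow> complex"
  assumes "f \<in> Cc" shows "(\<integral>x. f (- x) \<partial>M) = (\<integral>x. f x \<partial>M)"
proof -
  obtain g0 c where g: "g0 \<in> Cc" "c \<noteq> 0" "\<And>w. rdens g0 w = c" "(\<integral>y. g0 (- y) \<partial>M) = c"
    using rdens_const by metis
  show ?thesis using integral_rdens[OF assms g(1)] g by simp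
qed

text \<open>Inversion invariance passes from \<open>Cc\<close> to open sets by inner regularity and
  Urysohn functions, and in \<open>emeasure_uminus_le\<close> on to Borel sets by outer regularity.
  One inequality is enough each time, because inversion is an involution.\<close>

lemma emeasure_uminus_open_le:
  assumes U: "open U" shows "emeasure M U \<le> emeasure M (uminus -` U)"
  unfolding inner_regular[OF U]
proof (rule SUP_least)
  fix K assume "K \<in> {K. compact K \<and> K \<subseteq> U}"
  then have K: "compact K" "K \<subseteq> U" by auto
  obtain \<phi> :: "'a \<Rightarrow> real" where \<phi>: "\<phi> \<in> Cc" "\<And>x. 0 \<le> \<phi> x" "\<And>x. \<phi> x \<le> 1"
    "\<And>x. x \<in> K \<Longrightarrow> \<phi> x = 1" "\<And>x. x \<notin> U \<Longrightarrow> \<phi> x = 0"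
    using Cc_Urysohn[OF lc K(1) U K(2)] by metis
  have op: "open (uminus -` U)" by (intro open_vimage_cont U continuous_intros)
  have eq: "(\<integral>x. \<phi> (- x) \<partial>M) = (\<integral>x. \<phi> x \<partial>M)"
    using integral_uminus_Cc[OF Cc_complex_of_real[OF \<phi>(1)]] by simp
  have "emeasure M K = (\<integral>\<^sup>+x. indicator K x \<partial>M)" using K by simp
  also have "\<dots> \<le> (\<integral>\<^sup>+x. ennreal (\<phi> x) \<partial>M)"
    using \<phi> by (intro nn_integral_mono) (auto simp: indicator_def)
  also have "\<dots> = ennreal (\<integral>x. \<phi> x \<partial>M)"
    using \<phi> by (intro nn_integral_eq_integral Cc_integrable) auto
  also have "\<dots> = (\<integral>\<^sup>+x. ennreal (\<phi> (- x)) \<partial>M)"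
    unfolding eq[symmetric] using \<phi>
    by (intro nn_integral_eq_integral[symmetric] Cc_integrable Cc_compose_uminus) auto
  also have "\<dots> \<le> (\<integral>\<^sup>+x. indicator (uminus -` U) x \<partial>M)"
    using \<phi> by (intro nn_integral_mono) (auto simp: indicator_def)
  also have "\<dots> = emeasure M (uminus -` U)" using op by (simp add: borel_open)
  finally show "emeasure M K \<le> emeasure M (uminus -` U)" .
qed

lemma emeasure_uminus_open:
  assumes U: "open U" shows "emeasure M (uminus -` U) = emeasure M U"
proof -
  have "open (uminus -` U)" by (intro open_vimage_cont U continuous_intros)
  from emeasure_uminus_open_le[OF this] emeasure_uminus_open_le[OF U]
  show ?thesis by (simp add: vimage_def)
qed

lemma uminus_measurable: "uminus \<in> measurable M M"
  unfolding measurable_M by (intro borel_measurable_continuous_onI continuous_intros)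

lemma emeasure_uminus_le:
  assumes B: "B \<in> sets borel" shows "emeasure M (uminus -` B) \<le> emeasure M B"
  unfolding outer_regular[OF B]
proof (rule INF_greatest)
  fix U assume "U \<in> {U. open U \<and> B \<subseteq> U}"
  then have U: "open U" "B \<subseteq> U" by auto
  have op: "open (uminus -` U)" by (intro open_vimage_cont U continuous_intros)
  have "emeasure M (uminus -` B) \<le> emeasure M (uminus -` U)"
    using U op by (intro emeasure_mono) (auto simp: borel_open)
  then show "emeasure M (uminus -` B) \<le> emeasure M U" using emeasure_uminus_open[OF U(1)] by simp
qed

lemma distr_uminus: "distr M M uminus = M"
proof (rule measure_eqI)
  fix B assume "B \<in> sets (distr M M uminus)"
  then have B: "B \<in> sets borel" by simp
  have B': "uminus -` B \<in> sets borel"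
    using measurable_sets[OF uminus_measurable, of B] B by simp
  show "emeasure (distr M M uminus) B = emeasure M B"
    using emeasure_uminus_le[OF B] emeasure_uminus_le[OF B'] B
    by (auto simp: emeasure_distr[OF uminus_measurable] vimage_def intro: antisym)
qed simp

lemma distr_right_translate: "distr M M (\<lambda>x. x + g) = M"
proof -
  have "(\<lambda>x. x + g) = uminus \<circ> ((\<lambda>x. - g + x) \<circ> uminus)"
    by (auto simp: fun_eq_iff minus_add)
  then have "distr M M (\<lambda>x. x + g) = distr (distr (distr M M uminus) M (\<lambda>x. - g + x)) M uminus"
    by (simp only: distr_distr[OF uminus_measurable measurable_comp[OF uminus_measurable translate_measurable]]
        distr_distr[OF translate_measurable uminus_measurable])
  then show ?thesis by (simp add: distr_uminus distr_translate)
qed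

lemma right_translate_measurable: "(\<lambda>x. x + g) \<in> measurable M M"
  unfolding measurable_M by (intro borel_measurable_continuous_onI continuous_intros)

lemma integral_uminus:
  fixes f :: "'a \<Rightarrow> 'c::{banach, second_countable_topology}"
  assumes "f \<in> borel_measurable M"
  shows "(\<integral>x. f (- x) \<partial>M) = (\<integral>x. f x \<partial>M)"
  using integral_distr[OF uminus_measurable assms] by (simp add: distr_uminus)

lemma integral_right_translate:
  fixes f :: "'a \<Rightarrow> 'c::{banach, second_countable_topology}"
  assumes "f \<in> borel_measurable M"
  shows "(\<integral>x. f (x + g) \<partial>M) = (\<integral>x. f x \<partial>M)"
  using integral_distr[OF right_translate_measurable assms] by (simp add: distr_right_translate)

end

section \<open>Integrable majorants, and closure properties of \<open>Cc\<close>\<close>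

text \<open>Supplies majorants for dominated convergence: the supremum of an increasing sequence
  with bounded integrals, made real-valued. As \<open>enn2real\<close> sends infinity to 0, the
  bound is claimed only where the supremum is finite, which is almost everywhere.\<close>

lemma nn_monotone_dominated:
  fixes a :: "nat \<Rightarrow> 'a \<Rightarrow> real"
  assumes [measurable]: "\<And>n. a n \<in> borel_measurable M" and nn: "\<And>n x. 0 \<le> a n x"
    and mono: "\<And>n x. a n x \<le> a (Suc n) x" and C: "\<And>n. (\<integral>\<^sup>+x. ennreal (a n x) \<partial>M) \<le> ennreal C"
  shows "\<exists>w. integrable M w \<and> (AE x in M. \<forall>n. a n x \<le> w x)"
proof -
  define S where "S x = (SUP n. ennreal (a n x))" for x
  have [measurable]: "S \<in> borel_measurable M" unfolding S_def by measurable
  have "(\<integral>\<^sup>+x. S x \<partial>M) = (SUP n. \<integral>\<^sup>+x. ennreal (a n x) \<partial>M)"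
    unfolding S_def by (rule nn_integral_monotone_convergence_SUP_AE) (auto intro!: ennreal_leI mono)
  also have "\<dots> \<le> ennreal C" by (intro SUP_least C)
  finally have S: "(\<integral>\<^sup>+x. S x \<partial>M) < \<infinity>" by (simp add: le_less_trans)
  define w where "w x = enn2real (S x)" for x
  have "integrable M w"
  proof (rule integrableI_bounded)
    show "w \<in> borel_measurable M" unfolding w_def by measurable
    have "(\<integral>\<^sup>+x. ennreal (norm (w x)) \<partial>M) \<le> (\<integral>\<^sup>+x. S x \<partial>M)"
      by (intro nn_integral_mono) (simp add: w_def ennreal_enn2real_if)
    then show "(\<integral>\<^sup>+x. ennreal (norm (w x)) \<partial>M) < \<infinity>" using S by (rule le_less_trans)
  qed
  moreover have "AE x in M. S x \<noteq> \<infinity>" using S by (intro nn_integral_PInf_AE) auto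
  then have "AE x in M. \<forall>n. a n x \<le> w x"
  proof eventually_elim
    fix x assume "S x \<noteq> \<infinity>"
    then have "ennreal (w x) = S x" by (simp add: w_def ennreal_enn2real_if)
    moreover have "ennreal (a n x) \<le> S x" for n unfolding S_def by (rule SUP_upper) simp
    ultimately show "\<forall>n. a n x \<le> w x" by (metis ennreal_le_iff enn2real_nonneg w_def)
  qed
  ultimately show ?thesis by blast
qed

lemma Cc_add:
  fixes f g :: "'a::t2_space \<Rightarrow> 'b::real_normed_vector"
  assumes "f \<in> Cc" "g \<in> Cc" shows "(\<lambda>x. f x + g x) \<in> Cc"
proof -
  obtain K where K: "compact K" "\<And>x. x \<notin> K \<Longrightarrow> f x = 0" using CcE[OF assms(1)] by metis
  obtain L where L: "compact L" "\<And>x. x \<notin> L \<Longrightarrow> g x = 0" using CcE[OF assms(2)] by metis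
  show ?thesis
  proof (rule CcI[OF _ compact_Un[OF K(1) L(1)]])
    show "continuous_on UNIV (\<lambda>x. f x + g x)"
      by (intro continuous_on_add Cc_continuous assms)
  qed (simp add: K L)
qed

lemma Cc_compose0:
  fixes f :: "'a::t2_space \<Rightarrow> 'b::real_normed_vector" and h :: "'b \<Rightarrow> 'c::real_normed_vector"
  assumes "f \<in> Cc" "continuous_on UNIV h" "h 0 = 0" shows "(\<lambda>x. h (f x)) \<in> Cc"
proof -
  obtain K where K: "compact K" "\<And>x. x \<notin> K \<Longrightarrow> f x = 0" using CcE[OF assms(1)] by metis
  show ?thesis
    by (rule CcI[OF _ K(1)])
       (auto simp: K assms(3) intro: continuous_on_compose2[OF assms(2) Cc_continuous[OF assms(1)]])
qed

lemma Cc_norm: "f \<in> Cc \<Longrightarrow> (\<lambda>x::'a::t2_space. norm (f x :: 'b::real_normed_vector)) \<in> Cc"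
  by (rule Cc_compose0) (auto intro!: continuous_intros)

lemma Cc_uminus: "f \<in> Cc \<Longrightarrow> (\<lambda>x::'a::t2_space. - (f x :: 'b::real_normed_vector)) \<in> Cc"
  by (rule Cc_compose0) (auto intro!: continuous_intros)

lemma Cc_diff: "f \<in> Cc \<Longrightarrow> g \<in> Cc \<Longrightarrow> (\<lambda>x::'a::t2_space. f x - g x :: 'b::real_normed_vector) \<in> Cc"
  using Cc_add[OF _ Cc_uminus, of f g] by simp

lemma Cc_zero: "(\<lambda>x. 0) \<in> Cc"
  by (rule CcI[where K = "{}"]) auto

lemma Cc_sum:
  "(\<And>i. i \<in> I \<Longrightarrow> f i \<in> Cc) \<Longrightarrow> (\<lambda>x::'a::t2_space. \<Sum>i\<in>I. f i x :: 'b::real_normed_vector) \<in> Cc"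
  by (induction I rule: infinite_finite_induct) (auto intro!: Cc_zero Cc_add)

lemma integral_norm_triangle:
  fixes f g h :: "'a \<Rightarrow> 'b::{banach, second_countable_topology}"
  assumes "integrable M f" "integrable M g" "integrable M h"
  shows "(\<integral>x. norm (f x - h x) \<partial>M) \<le> (\<integral>x. norm (f x - g x) \<partial>M) + (\<integral>x. norm (g x - h x) \<partial>M)"
proof -
  have "(\<integral>x. norm (f x - h x) \<partial>M) \<le> (\<integral>x. norm (f x - g x) + norm (g x - h x) \<partial>M)"
    using assms by (intro integral_mono) (auto intro: norm_diff_triangle_ineq[of "f _" "g _" "g _" "h _", simplified] order_trans[OF _ norm_triangle_ineq])
  then show ?thesis using assms by simp
qed

context lc_haar
begin

subsection \<open>Approximation in \<open>L\<^sub>1\<close>\<close>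

lemma indicator_approx:
  assumes A: "A \<in> sets borel" "emeasure M A < \<infinity>" and e: "e > 0"
  shows "\<exists>\<phi>::'a \<Rightarrow> real. \<phi> \<in> Cc \<and> (\<integral>x. \<bar>indicator A x - \<phi> x\<bar> \<partial>M) < e"
proof -
  have "emeasure M A < emeasure M A + ennreal (e/2)"
    using A e by (simp add: ennreal_less_top)
  then obtain U where U: "open U" "A \<subseteq> U" "emeasure M U < emeasure M A + ennreal (e/2)"
    using outer_regular[OF A(1)] by (auto simp: INF_less_iff)
  have Uf: "emeasure M U < \<infinity>" using U(3) A(2) by (auto intro: less_trans)
  \<comment> \<open>Inner regularity is available for open sets only, so \<open>K\<close>
    approximates \<open>U\<close> and may stick out of \<open>A\<close>. The error is therefore
    split into \<open>U\<close> minus \<open>A\<close> and \<open>U\<close> minus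
    \<open>K\<close>.\<close>
  have "\<exists>K. compact K \<and> K \<subseteq> U \<and> measure M U < measure M K + e/2"
  proof (rule ccontr)
    assume "\<not> ?thesis"
    then have *: "measure M K \<le> measure M U - e/2" if "compact K" "K \<subseteq> U" for K
      using that by (metis add.commute le_diff_eq not_less)
    have "emeasure M U \<le> ennreal (measure M U - e/2)"
      unfolding inner_regular[OF U(1)]
    proof (rule SUP_least)
      fix K assume "K \<in> {K. compact K \<and> K \<subseteq> U}"
      then show "emeasure M K \<le> ennreal (measure M U - e/2)"
        using * emeasure_compact[of K] by (auto simp: emeasure_eq_ennreal_measure intro: ennreal_leI)
    qed
    moreover have "measure M U - e/2 \<ge> 0" using *[of "{}"] by simp
    ultimately have "measure M U \<le> measure M U - e/2"
      using Uf by (simp add: emeasure_eq_ennreal_measure)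
    then show False using e by simp
  qed
  then obtain K where K: "compact K" "K \<subseteq> U" "measure M U < measure M K + e/2" by blast
  obtain \<phi> :: "'a \<Rightarrow> real" where \<phi>: "\<phi> \<in> Cc" "\<And>x. 0 \<le> \<phi> x" "\<And>x. \<phi> x \<le> 1"
    "\<And>x. x \<in> K \<Longrightarrow> \<phi> x = 1" "\<And>x. x \<notin> U \<Longrightarrow> \<phi> x = 0"
    using Cc_Urysohn[OF lc K(1) U(1) K(2)] by metis
  have iA: "integrable M (indicator A :: 'a \<Rightarrow> real)" using A by simp
  have iU: "integrable M (indicator U :: 'a \<Rightarrow> real)" using Uf U by (simp add: borel_open)
  have iK: "integrable M (indicator K :: 'a \<Rightarrow> real)" by (rule integrable_indicator_compact[OF K(1)])
  have "(\<integral>x. \<bar>indicator A x - \<phi> x\<bar> \<partial>M) \<le> (\<integral>x. (indicator U x - indicator A x) + (indicator U x - indicator K x) \<partial>M)"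
  proof (rule integral_mono)
    show "integrable M (\<lambda>x. \<bar>indicator A x - \<phi> x\<bar>)"
      using iA Cc_integrable[OF \<phi>(1)] by simp
    show "integrable M (\<lambda>x. (indicator U x - indicator A x) + (indicator U x - indicator K x) :: real)"
      using iA iU iK by (intro Bochner_Integration.integrable_add Bochner_Integration.integrable_diff)
    show "\<bar>indicator A x - \<phi> x\<bar> \<le> (indicator U x - indicator A x) + (indicator U x - indicator K x)" for x
      using \<phi>(2,3,4,5)[of x] U(2) K(2) by (auto simp: indicator_def split: if_splits)
  qed
  also have "\<dots> = (measure M U - measure M A) + (measure M U - measure M K)"
    using iA iU iK by simp
  also have "\<dots> < e"
  proof -
    have "ennreal (measure M U) < ennreal (measure M A + e/2)"
      using U(3) Uf A e by (simp add: emeasure_eq_ennreal_measure)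
    then have "measure M U < measure M A + e/2" by (simp add: ennreal_less_iff)
    then show ?thesis using K(3) by linarith
  qed
  finally show ?thesis using \<phi>(1) by blast
qed

lemma Cc_dense_L1:
  fixes f :: "'a \<Rightarrow> complex"
  assumes "integrable M f"
  shows "\<forall>e>0. \<exists>\<phi>\<in>Cc. (\<integral>x. norm (f x - \<phi> x) \<partial>M) < e"
  using assms
proof (induction rule: integrable_induct)
  case (base A c)
  show ?case
  proof (intro allI impI)
    fix e :: real assume e: "e > 0"
    have e': "e / (norm c + 1) > 0" using e by (simp add: add_nonneg_pos)
    have A: "A \<in> sets borel" "emeasure M A < \<infinity>" using base by auto
    obtain \<phi> :: "'a \<Rightarrow> real" where \<phi>: "\<phi> \<in> Cc" "(\<integral>x. \<bar>indicator A x - \<phi> x\<bar> \<partial>M) < e / (norm c + 1)"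
      using indicator_approx[OF A e'] by blast
    have "(\<lambda>x. \<phi> x *\<^sub>R c) \<in> Cc"
      by (rule Cc_compose0[OF \<phi>(1)]) (auto intro!: continuous_intros)
    moreover have "(\<integral>x. norm (indicator A x *\<^sub>R c - \<phi> x *\<^sub>R c) \<partial>M) < e"
    proof -
      have "(\<integral>x. norm (indicator A x *\<^sub>R c - \<phi> x *\<^sub>R c) \<partial>M) = (\<integral>x. \<bar>indicator A x - \<phi> x\<bar> * norm c \<partial>M)"
        by (simp only: scaleR_diff_left[symmetric] norm_scaleR)
      also have "\<dots> = (\<integral>x. \<bar>indicator A x - \<phi> x\<bar> \<partial>M) * norm c" by simp
      also have "\<dots> \<le> (\<integral>x. \<bar>indicator A x - \<phi> x\<bar> \<partial>M) * (norm c + 1)"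
        by (intro mult_left_mono) auto
      also have "\<dots> < e" using \<phi>(2) by (simp add: pos_less_divide_eq add_nonneg_pos)
      finally show ?thesis .
    qed
    ultimately show "\<exists>\<phi>\<in>Cc. (\<integral>x. norm (indicator A x *\<^sub>R c - \<phi> x) \<partial>M) < e"
      by (intro bexI[of _ "\<lambda>x. \<phi> x *\<^sub>R c"])
  qed
next
  case (add f g)
  show ?case
  proof (intro allI impI)
    fix e :: real assume e: "e > 0"
    then have "e / 2 > 0" by simp
    then obtain \<phi> \<psi> where 1: "\<phi> \<in> Cc" "(\<integral>x. norm (f x - \<phi> x) \<partial>M) < e/2" "\<psi> \<in> Cc" "(\<integral>x. norm (g x - \<psi> x) \<partial>M) < e/2"
      using add by meson
    have "(\<integral>x. norm (f x + g x - (\<phi> x + \<psi> x)) \<partial>M) \<le> (\<integral>x. norm (f x - \<phi> x) + norm (g x - \<psi> x) \<partial>M)"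
      using add 1 Cc_integrable[OF 1(1)] Cc_integrable[OF 1(3)]
      by (intro integral_mono) (auto intro: norm_diff_triangle_ineq)
    also have "\<dots> = (\<integral>x. norm (f x - \<phi> x) \<partial>M) + (\<integral>x. norm (g x - \<psi> x) \<partial>M)"
      using add Cc_integrable[OF 1(1)] Cc_integrable[OF 1(3)] by simp
    also have "\<dots> < e" using 1 by simp
    finally show "\<exists>\<phi>\<in>Cc. (\<integral>x. norm (f x + g x - \<phi> x) \<partial>M) < e"
      using Cc_add[OF 1(1,3)] by (intro bexI[of _ "\<lambda>x. \<phi> x + \<psi> x"]) auto
  qed
next
  case (lim f s)
  show ?case
  proof (intro allI impI)
    fix e :: real assume e: "e > 0"
    have [measurable]: "f \<in> borel_measurable M" "\<And>i. s i \<in> borel_measurable M" using lim by auto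
    have "(\<lambda>i. \<integral>x. norm (f x - s i x) \<partial>M) \<longlonglongrightarrow> (\<integral>x. norm (f x - f x) \<partial>M)"
    proof (rule integral_dominated_convergence)
      show "integrable M (\<lambda>x. 3 * norm (f x))" using lim by simp
      show "AE x in M. (\<lambda>i. norm (f x - s i x)) \<longlonglongrightarrow> norm (f x - f x)"
        using lim(2) by (intro AE_I2 tendsto_intros) simp
      show "AE x in M. norm (norm (f x - s i x)) \<le> 3 * norm (f x)" for i
      proof (rule AE_I2)
        fix x assume x: "x \<in> space M"
        then show "norm (norm (f x - s i x)) \<le> 3 * norm (f x)"
          using lim(3)[OF x, of i] norm_triangle_ineq4[of "f x" "s i x"] by simp
      qed
    qed measurable
    then have "\<forall>\<^sub>F i in sequentially. (\<integral>x. norm (f x - s i x) \<partial>M) < e/2"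
      using e by (intro order_tendstoD(2)[of _ 0]) auto
    then obtain i where i: "(\<integral>x. norm (f x - s i x) \<partial>M) < e/2"
      using eventually_happens'[OF sequentially_bot] by blast
    obtain \<phi> where \<phi>: "\<phi> \<in> Cc" "(\<integral>x. norm (s i x - \<phi> x) \<partial>M) < e/2"
      using lim(5)[of i] e by (meson half_gt_zero)
    have "(\<integral>x. norm (f x - \<phi> x) \<partial>M) < e"
      using integral_norm_triangle[OF lim(4) lim(1)[of i] Cc_integrable[OF \<phi>(1)]] i \<phi>(2) by simp
    then show "\<exists>\<phi>\<in>Cc. (\<integral>x. norm (f x - \<phi> x) \<partial>M) < e" using \<phi>(1) by blast
  qed
qed

text \<open>The geometric rate makes the increments summable, which yields the majorants of
  \<open>fast_approx_dominating\<close>; convergence almost everywhere is the other ingredient of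
  dominated convergence.\<close>

definition fast_approx :: "(nat \<Rightarrow> 'a \<Rightarrow> complex) \<Rightarrow> ('a \<Rightarrow> complex) \<Rightarrow> bool" where
  "fast_approx \<phi> f \<longleftrightarrow> (\<forall>n. \<phi> n \<in> Cc) \<and> (\<forall>n. (\<integral>x. norm (f x - \<phi> n x) \<partial>M) \<le> (1/2) ^ n)
     \<and> (AE x in M. (\<lambda>n. \<phi> n x) \<longlonglongrightarrow> f x)"

lemma fast_approx_exists:
  assumes f: "integrable M f" shows "\<exists>\<phi>. fast_approx \<phi> f"
proof -
  have "\<exists>\<phi>. \<phi> \<in> Cc \<and> (\<integral>x. norm (f x - \<phi> x) \<partial>M) < (1/2) ^ n" for n :: nat
    using Cc_dense_L1[OF f] by (metis half_gt_zero_iff zero_less_one zero_less_power)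
  then obtain \<psi> where \<psi>: "\<And>n. \<psi> n \<in> Cc" "\<And>n. (\<integral>x. norm (f x - \<psi> n x) \<partial>M) < (1/2) ^ n"
    by metis
  have i: "integrable M (\<lambda>x. f x - \<psi> n x)" for n using f Cc_integrable[OF \<psi>(1)] by simp
  have "(\<lambda>n. \<integral>x. norm (f x - \<psi> n x) \<partial>M) \<longlonglongrightarrow> 0"
  proof (rule tendsto_sandwich[where f = "\<lambda>n. 0" and h = "\<lambda>n. (1/2) ^ n"])
    show "(\<lambda>n. (1/2::real) ^ n) \<longlonglongrightarrow> 0" by (rule LIMSEQ_realpow_zero) auto
  qed (use \<psi>(2) in \<open>auto intro!: always_eventually less_imp_le\<close>)
  from tendsto_L1_AE_subseq[OF i this]
  obtain r :: "nat \<Rightarrow> nat" where r: "strict_mono r" "AE x in M. (\<lambda>n. f x - \<psi> (r n) x) \<longlonglongrightarrow> 0" by blast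
  have "AE x in M. (\<lambda>n. \<psi> (r n) x) \<longlonglongrightarrow> f x"
    using r(2)
  proof eventually_elim
    fix x assume "(\<lambda>n. f x - \<psi> (r n) x) \<longlonglongrightarrow> 0"
    from tendsto_diff[OF tendsto_const[of "f x"] this] show "(\<lambda>n. \<psi> (r n) x) \<longlonglongrightarrow> f x" by simp
  qed
  moreover have "(\<integral>x. norm (f x - \<psi> (r n) x) \<partial>M) \<le> (1/2) ^ n" for n
  proof -
    have "(1/2::real) ^ r n \<le> (1/2) ^ n" using seq_suble[OF r(1)] by (intro power_decreasing) auto
    then show ?thesis using \<psi>(2)[of "r n"] by linarith
  qed
  ultimately have "fast_approx (\<lambda>n. \<psi> (r n)) f" using \<psi>(1) unfolding fast_approx_def by blast
  then show ?thesis by blast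
qed

lemma fast_approx_const: "h \<in> Cc \<Longrightarrow> fast_approx (\<lambda>n. h) h"
  unfolding fast_approx_def by simp

text \<open>The majorants are the norm of the first term plus the partial sums of the increments.
  Keeping an increasing sequence in \<open>Cc\<close>, rather than its integrable limit, lets their
  convolutions be integrated by the Fubini rule for \<open>Cc\<close>.\<close>

lemma fast_approx_dominating:
  assumes f: "integrable M f" and a: "fast_approx \<phi> f"
  obtains d :: "nat \<Rightarrow> 'a \<Rightarrow> real" and B where "\<And>n. d n \<in> Cc" "\<And>n x. norm (\<phi> n x) \<le> d n x" "\<And>n x. d n x \<le> d (Suc n) x"
    "\<And>n. (\<integral>x. d n x \<partial>M) \<le> B"
proof -
  have c: "\<phi> n \<in> Cc" and b: "(\<integral>x. norm (f x - \<phi> n x) \<partial>M) \<le> (1/2) ^ n" for n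
    using a unfolding fast_approx_def by auto
  define d where "d n x = norm (\<phi> 0 x) + (\<Sum>k<n. norm (\<phi> (Suc k) x - \<phi> k x))" for n x
  have dc: "d n \<in> Cc" for n
    unfolding d_def by (intro Cc_add Cc_sum Cc_norm Cc_diff c)
  have nd: "norm (\<phi> n x) \<le> d n x" for n x
  proof (induction n)
    case (Suc n)
    have "norm (\<phi> (Suc n) x) \<le> norm (\<phi> n x) + norm (\<phi> (Suc n) x - \<phi> n x)"
      by (rule norm_triangle_sub)
    then show ?case using Suc by (simp add: d_def)
  qed (simp add: d_def)
  have dd: "(\<integral>x. norm (\<phi> (Suc k) x - \<phi> k x) \<partial>M) \<le> 2 * (1/2) ^ k" for k
  proof -
    have "(\<integral>x. norm (\<phi> (Suc k) x - \<phi> k x) \<partial>M) \<le> (\<integral>x. norm (\<phi> (Suc k) x - f x) \<partial>M) + (\<integral>x. norm (f x - \<phi> k x) \<partial>M)"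
      by (rule integral_norm_triangle) (auto intro: f Cc_integrable c)
    also have "\<dots> \<le> (1/2) ^ Suc k + (1/2) ^ k"
      using b[of "Suc k"] b[of k] by (intro add_mono) (simp_all add: norm_minus_commute)
    also have "\<dots> \<le> 2 * (1/2) ^ k" by simp
    finally show ?thesis .
  qed
  have "(\<integral>x. d n x \<partial>M) \<le> (\<integral>x. norm (\<phi> 0 x) \<partial>M) + 4" for n
  proof -
    have i: "integrable M (\<lambda>x. norm (\<phi> (Suc k) x - \<phi> k x))" for k
      by (intro Cc_integrable Cc_norm Cc_diff c)
    have "(\<integral>x. d n x \<partial>M) = (\<integral>x. norm (\<phi> 0 x) \<partial>M) + (\<integral>x. (\<Sum>k<n. norm (\<phi> (Suc k) x - \<phi> k x)) \<partial>M)"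
      unfolding d_def
      by (intro Bochner_Integration.integral_add Cc_integrable Cc_sum Cc_norm Cc_diff c)
    also have "(\<integral>x. (\<Sum>k<n. norm (\<phi> (Suc k) x - \<phi> k x)) \<partial>M) = (\<Sum>k<n. \<integral>x. norm (\<phi> (Suc k) x - \<phi> k x) \<partial>M)"
      by (intro Bochner_Integration.integral_sum i)
    also have "\<dots> \<le> (\<Sum>k<n. 2 * (1/2) ^ k)" by (intro sum_mono dd)
    also have "\<dots> = 4 * (1 - (1/2) ^ n)" by (simp add: sum_distrib_left[symmetric] sum_gp_strict)
    also have "\<dots> \<le> 4" by simp
    finally show ?thesis by simp
  qed
  with that[of d] dc nd show ?thesis by (auto simp: d_def)
qed

text \<open>The product \<open>\<sigma>\<close>-algebra of the Borel sets may be smaller than the Borel \<open>\<sigma>\<close>-algebra of the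
  product, so joint continuity alone does not give measurability.\<close>

lemma product_measurable_Cc_kernel:
  fixes k :: "'a \<Rightarrow> 'a \<Rightarrow> complex"
  assumes k: "continuous_on UNIV (\<lambda>(x, y). k x y)"
    and K: "compact K1" "compact K2" "\<And>x y. x \<notin> K1 \<Longrightarrow> k x y = 0" "\<And>x y. y \<notin> K2 \<Longrightarrow> k x y = 0"
  shows "(\<lambda>(x, y). k x y) \<in> borel_measurable (borel \<Otimes>\<^sub>M borel)"
proof -
  have kx [measurable]: "(\<lambda>x. k x c) \<in> borel_measurable borel" for c
    using continuous_on_compose2[OF k, of UNIV "\<lambda>x. (x, c)"]
    by (intro borel_measurable_continuous_onI) (simp add: continuous_on_Pair)
  have "\<exists>F \<in> borel_measurable (borel \<Otimes>\<^sub>M borel). \<forall>x y. norm (F (x, y) - k x y) < e" if e: "e > 0" for e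
  proof -
    have "\<exists>V. open V \<and> s \<in> V \<and> (\<forall>y\<in>V. \<forall>x. norm (k x y - k x s) < e)" for s
    proof -
      obtain V where V: "open V" "s \<in> V" "\<And>x y. x \<in> K1 \<Longrightarrow> y \<in> V \<Longrightarrow> dist (k x y) (k x s) < e"
        using tube_uniform[OF k K(1) e] by metis
      have "norm (k x y - k x s) < e" if "y \<in> V" for x y
        using V(3)[of x y] that K(3)[of x] e by (cases "x \<in> K1") (auto simp: dist_norm)
      then show ?thesis using V by blast
    qed
    then obtain V where V: "\<And>s. open (V s)" "\<And>s. s \<in> V s" "\<And>s x y. y \<in> V s \<Longrightarrow> norm (k x y - k x s) < e"
      by metis
    have "K2 \<subseteq> (\<Union>s\<in>K2. V s)" using V(2) by blast
    then obtain D where D: "D \<subseteq> K2" "finite D" "K2 \<subseteq> (\<Union>s\<in>D. V s)"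
      using compactE_image[OF K(2), of K2 V] V(1) by metis
    obtain A where A: "\<And>c. c \<in> D \<Longrightarrow> A c \<in> sets borel" "\<And>c. c \<in> D \<Longrightarrow> A c \<subseteq> V c"
      "disjoint_family_on A D" "(\<Union>c\<in>D. A c) = (\<Union>c\<in>D. V c)"
      using finite_borel_partition[OF D(2), of V] V(1) by metis
    \<comment> \<open>Each summand is a Borel function of \<open>x\<close> times an indicator in
      \<open>y\<close>, hence measurable for the product; the kernel is a uniform limit of such
      sums.\<close>
    define F where "F p = (\<Sum>c\<in>D. indicator (A c \<inter> K2) (snd p) * k (fst p) c)" for p
    have [measurable]: "A c \<inter> K2 \<in> sets borel" if "c \<in> D" for c using A(1)[OF that] compact_sets[OF K(2)] by (rule sets.Int)
    have "F \<in> borel_measurable (borel \<Otimes>\<^sub>M borel)"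
      unfolding F_def by (intro borel_measurable_sum) measurable
    moreover have "norm (F (x, y) - k x y) < e" for x y
    proof (cases "y \<in> K2")
      case True
      then obtain c where c: "c \<in> D" "y \<in> A c" using D(3) A(4) by blast
      have "y \<notin> A c'" if "c' \<in> D" "c' \<noteq> c" for c'
        using A(3) c that unfolding disjoint_family_on_def by blast
      then have "F (x, y) = (\<Sum>c'\<in>D. if c' = c then k x c else 0)"
        unfolding F_def using c True by (intro sum.cong refl) auto
      then show ?thesis using D(2) c V(3)[of y c x] A(2)[OF c(1)]
        by (auto simp: norm_minus_commute)
    qed (use K(4) e in \<open>simp add: F_def\<close>)
    ultimately show ?thesis by blast
  qed
  then have "\<exists>F \<in> borel_measurable (borel \<Otimes>\<^sub>M borel). \<forall>x y. norm (F (x, y) - k x y) < inverse (real (Suc n))" for n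
    by (metis inverse_positive_iff_positive of_nat_0_less_iff zero_less_Suc)
  then obtain F where F: "\<And>n. F n \<in> borel_measurable (borel \<Otimes>\<^sub>M borel)"
    "\<And>n x y. norm (F n (x, y) - k x y) < inverse (real (Suc n))" by metis
  show ?thesis
  proof (rule borel_measurable_LIMSEQ_metric[OF F(1)])
    fix p
    have "(\<lambda>n. F n p - k (fst p) (snd p)) \<longlonglongrightarrow> 0"
    proof (rule Lim_null_comparison)
      show "\<forall>\<^sub>F n in sequentially. norm (F n p - k (fst p) (snd p)) \<le> inverse (real (Suc n))"
        using F(2)[of _ "fst p" "snd p"] by (auto intro!: always_eventually less_imp_le)
    qed (rule LIMSEQ_inverse_real_of_nat)
    then show "(\<lambda>n. F n p) \<longlonglongrightarrow> (case p of (x, y) \<Rightarrow> k x y)"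
      by (simp add: Lim_null[of _ "k (fst p) (snd p)"] case_prod_unfold)
  qed
qed

subsection \<open>Convolution\<close>

lemma conv_kernel_support:
  fixes f g :: "'a \<Rightarrow> complex"
  assumes f: "f \<in> Cc" and g: "g \<in> Cc"
  shows "\<exists>K1 K2. compact K1 \<and> compact K2 \<and> (\<forall>x y. x \<notin> K1 \<longrightarrow> f y * g (- y + x) = 0)
    \<and> (\<forall>x y. y \<notin> K2 \<longrightarrow> f y * g (- y + x) = 0)"
proof -
  obtain Kf where Kf: "compact Kf" "\<And>x. x \<notin> Kf \<Longrightarrow> f x = 0" using CcE[OF f] by metis
  obtain Kg where Kg: "compact Kg" "\<And>x. x \<notin> Kg \<Longrightarrow> g x = 0" using CcE[OF g] by metis
  have "f y * g (- y + x) = 0" if "x \<notin> {a + b | a b. a \<in> Kf \<and> b \<in> Kg}" for x y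
  proof (rule ccontr)
    assume "\<not> ?thesis"
    then have "y \<in> Kf" "- y + x \<in> Kg" using Kg Kf by auto
    then have "x \<in> {a + b | a b. a \<in> Kf \<and> b \<in> Kg}"
      by (intro mem_set_add[of y _ "- y + x"]) (simp_all only: group_normalize)
    with that show False by blast
  qed
  then show ?thesis
    using compact_set_add[OF Kf(1) Kg(1)] Kf
    by (intro exI[of _ "{a + b | a b. a \<in> Kf \<and> b \<in> Kg}"] exI[of _ Kf]) simp
qed

lemma conv_kernel_continuous:
  fixes f g :: "'a \<Rightarrow> complex"
  assumes f: "f \<in> Cc" and g: "g \<in> Cc"
  shows "continuous_on UNIV (\<lambda>(x, y). f y * g (- y + x))"
    and "continuous_on UNIV (\<lambda>(y, x). f y * g (- y + x))"
    and "continuous_on UNIV (\<lambda>y. f y * g (- y + x))"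
  by (auto simp: case_prod_unfold intro!: continuous_on_Cc[OF g] continuous_on_Cc[OF f] continuous_intros)

lemma conv_Cc:
  assumes f: "f \<in> Cc" and g: "g \<in> Cc" shows "conv M f g \<in> Cc"
proof -
  obtain K1 K2 where K: "compact K1" "compact K2" "\<And>x y. x \<notin> K1 \<Longrightarrow> f y * g (- y + x) = 0"
    "\<And>x y. y \<notin> K2 \<Longrightarrow> f y * g (- y + x) = 0"
    using conv_kernel_support[OF f g] by metis
  show ?thesis
  proof (rule CcI[OF _ K(1)])
    show "continuous_on UNIV (conv M f g)" unfolding conv_def
      by (rule continuous_parameter_integral[OF conv_kernel_continuous(2)[OF f g]],
          rule exI[of _ UNIV], rule exI[of _ K2]) (simp add: K)
  qed (simp add: conv_def K)
qed

lemma integral_conv_Cc: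
  assumes f: "f \<in> Cc" and g: "g \<in> Cc"
  shows "(\<integral>x. conv M f g x \<partial>M) = (\<integral>x. f x \<partial>M) * (\<integral>x. g x \<partial>M)"
proof -
  obtain K1 K2 where K: "compact K1" "compact K2" "\<And>x y. x \<notin> K1 \<Longrightarrow> f y * g (- y + x) = 0"
    "\<And>x y. y \<notin> K2 \<Longrightarrow> f y * g (- y + x) = 0"
    using conv_kernel_support[OF f g] by metis
  have "(\<integral>x. conv M f g x \<partial>M) = (\<integral>y. (\<integral>x. f y * g (- y + x) \<partial>M) \<partial>M)"
    unfolding conv_def by (rule fubini_Cc_1[OF conv_kernel_continuous(2)[OF f g] K(2,1)]) (use K in auto)
  then show ?thesis by (simp add: integral_left_translate[OF Cc_borel[OF g]])
qed

end

context fc_haar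
begin

lemma reflect_measurable: "(\<lambda>y. - y + x) \<in> measurable M M"
  unfolding measurable_M by (intro borel_measurable_continuous_onI continuous_intros)

lemma distr_reflect: "distr M M (\<lambda>y. - y + x) = M"
proof -
  have "(\<lambda>y. - y + x) = (\<lambda>y. y + x) \<circ> uminus" by auto
  then have "distr M M (\<lambda>y. - y + x) = distr (distr M M uminus) M (\<lambda>y. y + x)"
    by (simp only: distr_distr[OF right_translate_measurable uminus_measurable])
  then show ?thesis by (simp add: distr_uminus distr_right_translate)
qed

lemma AE_reflect: "AE z in M. P z \<Longrightarrow> AE y in M. P (- y + x)"
  by (rule AE_distrD[OF reflect_measurable]) (simp only: distr_reflect)

text \<open>An integral depends measurably on a parameter when the measure is sigma-finite, which
  \<open>M\<close> need not be. Up to a null set \<open>f\<close> lives on the union of the supports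
  \<open>Y n\<close>, and restricting \<open>M\<close> to that union gives the sigma-finite
  \<open>P\<close>.\<close>

lemma conv_measurable:
  assumes f: "integrable M f" "fast_approx \<phi> f" and g: "integrable M g" "fast_approx \<gamma> g"
  shows "conv M f g \<in> borel_measurable M"
proof -
  have c: "\<phi> n \<in> Cc" "\<gamma> n \<in> Cc" for n using f g unfolding fast_approx_def by auto
  have l: "AE y in M. (\<lambda>n. \<phi> n y) \<longlonglongrightarrow> f y" "AE y in M. (\<lambda>n. \<gamma> n y) \<longlonglongrightarrow> g y"
    using f g unfolding fast_approx_def by auto
  have "\<exists>K. compact K \<and> (\<forall>y. y \<notin> K \<longrightarrow> \<phi> n y = 0)" for n using CcE[OF c(1)] by metis
  then obtain Y where Y: "\<And>n. compact (Y n)" "\<And>n y. y \<notin> Y n \<Longrightarrow> \<phi> n y = 0" by metis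
  define P where "P = density M (indicator (\<Union>n. Y n))"
  have Ym [measurable]: "Y n \<in> sets M" for n unfolding sets_M by (rule compact_sets) (rule Y(1))
  have sP [measurable_cong]: "sets P = sets borel" unfolding P_def by simp
  have spP: "space P = UNIV" unfolding P_def by simp
  interpret P: sigma_finite_measure P
  proof
    \<comment> \<open>The complement of all \<open>Y n\<close> may be large for \<open>M\<close> but
      is null for \<open>P\<close>, so it can complete the countable cover.\<close>
    show "\<exists>A. countable A \<and> A \<subseteq> sets P \<and> \<Union> A = space P \<and> (\<forall>a\<in>A. emeasure P a \<noteq> \<infinity>)"
    proof (intro exI[of _ "insert (- (\<Union>n. Y n)) (range Y)"] conjI ballI)
      show "insert (- (\<Union>n. Y n)) (range Y) \<subseteq> sets P"
        using Ym unfolding sP by (auto intro!: borel_comp)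
      fix a assume "a \<in> insert (- (\<Union>n. Y n)) (range Y)"
      then consider "a = - (\<Union>n. Y n)" | n where "a = Y n" by blast
      then show "emeasure P a \<noteq> \<infinity>"
      proof cases
        case 1
        then have "a \<in> sets M" using Ym by (auto intro!: borel_comp)
        then have "emeasure P a = (\<integral>\<^sup>+x. indicator (\<Union>n. Y n) x * indicator a x \<partial>M)"
          unfolding P_def by (subst emeasure_density) auto
        also have "\<dots> = (\<integral>\<^sup>+x. 0 \<partial>M)" using 1 by (intro nn_integral_cong) (auto simp: indicator_def)
        finally show ?thesis by simp
      next
        case 2
        have "emeasure P a = (\<integral>\<^sup>+x. indicator (\<Union>n. Y n) x * indicator a x \<partial>M)"
          unfolding P_def 2 using Ym[unfolded sets_M] by (subst emeasure_density) auto
        also have "\<dots> \<le> (\<integral>\<^sup>+x. indicator a x \<partial>M)"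
          by (intro nn_integral_mono) (auto simp: indicator_def)
        also have "\<dots> = emeasure M a" unfolding 2 using Ym by simp
        finally show ?thesis using emeasure_compact[OF Y(1)[of n]] unfolding 2
          by (metis infinity_ennreal_def leD top.not_eq_extremum)
      qed
    qed (auto simp: spP)
  qed
  \<comment> \<open>The product \<open>f y * g (- y + x)\<close> is not known to be jointly
    measurable, whereas the limit of the approximating kernels is. For each \<open>x\<close> the two
    agree for almost every \<open>y\<close>, since the reflection sending \<open>y\<close> to
    \<open>- y + x\<close> preserves \<open>M\<close>; where the sequence diverges,
    \<open>lim\<close> takes a default value.\<close>
  define k where "k x y = lim (\<lambda>n. \<phi> n y * \<gamma> n (- y + x))" for x y
  have kn: "(\<lambda>(x, y). \<phi> n y * \<gamma> n (- y + x)) \<in> borel_measurable (borel \<Otimes>\<^sub>M borel)" for n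
  proof -
    obtain K1 K2 where K: "compact K1" "compact K2" "\<And>x y. x \<notin> K1 \<Longrightarrow> \<phi> n y * \<gamma> n (- y + x) = 0"
      "\<And>x y. y \<notin> K2 \<Longrightarrow> \<phi> n y * \<gamma> n (- y + x) = 0"
      using conv_kernel_support[OF c(1)[of n] c(2)[of n]] by metis
    show ?thesis by (rule product_measurable_Cc_kernel[OF conv_kernel_continuous(1)[OF c] K])
  qed
  have "(\<lambda>p. lim (\<lambda>n. (case p of (x, y) \<Rightarrow> \<phi> n y * \<gamma> n (- y + x)))) \<in> borel_measurable (borel \<Otimes>\<^sub>M borel)"
    by (rule borel_measurable_lim_metric[OF kn])
  also have "(\<lambda>p. lim (\<lambda>n. (case p of (x, y) \<Rightarrow> \<phi> n y * \<gamma> n (- y + x)))) = case_prod k"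
    by (auto simp: k_def)
  finally have km: "case_prod k \<in> borel_measurable (borel \<Otimes>\<^sub>M borel)" .
  then have "case_prod k \<in> borel_measurable (borel \<Otimes>\<^sub>M P)"
    by (simp cong: measurable_cong_sets sets_pair_measure_cong add: sP)
  from P.borel_measurable_lebesgue_integral[OF this]
  have "(\<lambda>x. \<integral>y. k x y \<partial>P) \<in> borel_measurable borel" .
  moreover have "(\<integral>y. k x y \<partial>P) = conv M f g x" for x
  proof -
    have kx [measurable]: "k x \<in> borel_measurable M"
      unfolding measurable_M using measurable_compose[OF measurable_Pair1'[of x borel borel] km] by simp
    have [measurable]: "g \<in> borel_measurable M" "f \<in> borel_measurable M" using f g by auto
    have gr [measurable]: "(\<lambda>y. g (- y + x)) \<in> borel_measurable M"
      by (rule measurable_compose[OF reflect_measurable]) measurable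
    have U: "(\<Union>n. Y n) \<in> sets M" by measurable
    have "P = density M (\<lambda>y. ennreal (indicator (\<Union>n. Y n) y))"
      unfolding P_def by (simp add: ennreal_indicator)
    then have "(\<integral>y. k x y \<partial>P) = (\<integral>y. indicator (\<Union>n. Y n) y *\<^sub>R k x y \<partial>M)"
      using U by (simp only:, subst integral_density[OF kx]) auto
    also have "\<dots> = (\<integral>y. k x y \<partial>M)"
    proof (rule Bochner_Integration.integral_cong[OF refl])
      fix y
      have "k x y = 0" if "y \<notin> (\<Union>n. Y n)" unfolding k_def using that Y(2) by (simp add: limI)
      then show "indicator (\<Union>n. Y n) y *\<^sub>R k x y = k x y" by (auto simp: indicator_def)
    qed
    also have "\<dots> = (\<integral>y. f y * g (- y + x) \<partial>M)"
    proof (rule integral_cong_AE)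
      show "AE y in M. k x y = f y * g (- y + x)"
        using l(1) AE_reflect[OF l(2), of x]
      proof eventually_elim
        fix y assume "(\<lambda>n. \<phi> n y) \<longlonglongrightarrow> f y" "(\<lambda>n. \<gamma> n (- y + x)) \<longlonglongrightarrow> g (- y + x)"
        then show "k x y = f y * g (- y + x)" unfolding k_def by (intro limI tendsto_mult)
      qed
    qed (use kx in measurable)
    finally show ?thesis by (simp add: conv_def)
  qed
  ultimately show ?thesis unfolding measurable_M by simp
qed

text \<open>Carries identities between pairings from \<open>Cc\<close> to \<open>L1\<close>.
  Dominated convergence is needed in \<open>y\<close> inside the convolution and in \<open>x\<close>
  outside it. The majorants \<open>F n\<close> and \<open>G n\<close> serve both: their convolutions
  \<open>a n\<close> increase with integrals at most \<open>Bf * Bg\<close>, hence have a common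
  integrable majorant \<open>W\<close>.\<close>

lemma conv_limit:
  assumes T: "T \<in> Linf M" and f: "integrable M f" "fast_approx \<phi> f" and g: "integrable M g" "fast_approx \<gamma> g"
  shows "(\<lambda>n. pairing M T (conv M (\<phi> n) (\<gamma> n))) \<longlonglongrightarrow> pairing M T (conv M f g)"
proof -
  have c: "\<phi> n \<in> Cc" "\<gamma> n \<in> Cc" for n using f g unfolding fast_approx_def by auto
  have l: "AE y in M. (\<lambda>n. \<phi> n y) \<longlonglongrightarrow> f y" "AE y in M. (\<lambda>n. \<gamma> n y) \<longlonglongrightarrow> g y"
    using f g unfolding fast_approx_def by auto
  have [measurable]: "f \<in> borel_measurable M" "g \<in> borel_measurable M"
    "\<phi> n \<in> borel_measurable M" "\<gamma> n \<in> borel_measurable M" for n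
    using f g Cc_borel c by auto
  obtain F Bf where F: "\<And>n. F n \<in> Cc" "\<And>n x. norm (\<phi> n x) \<le> F n x" "\<And>n x. F n x \<le> F (Suc n) x"
    "\<And>n. (\<integral>x. F n x \<partial>M) \<le> Bf" using fast_approx_dominating[OF f] by metis
  obtain G Bg where G: "\<And>n. G n \<in> Cc" "\<And>n x. norm (\<gamma> n x) \<le> G n x" "\<And>n x. G n x \<le> G (Suc n) x"
    "\<And>n. (\<integral>x. G n x \<partial>M) \<le> Bg" using fast_approx_dominating[OF g] by metis
  have F0: "0 \<le> F n x" and G0: "0 \<le> G n x" for n x
    using F(2)[of n x] G(2)[of n x] norm_ge_zero order_trans by blast+
  define e where "e n x y = F n y * G n (- y + x)" for n x y
  have e0: "0 \<le> e n x y" for n x y using F0 G0 by (simp add: e_def)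
  have emono: "e n x y \<le> e (Suc n) x y" for n x y
    unfolding e_def by (intro mult_mono F G F0 G0)
  have ke: "norm (\<phi> n y * \<gamma> n (- y + x)) \<le> e n x y" for n x y
    unfolding e_def norm_mult by (intro mult_mono F G F0 norm_ge_zero)
  have eCc: "(\<lambda>y. e n x y) \<in> Cc" for n x
  proof -
    obtain K where K: "compact K" "\<And>y. y \<notin> K \<Longrightarrow> F n y = 0" using CcE[OF F(1)] by metis
    have "continuous_on UNIV (\<lambda>y. e n x y)" unfolding e_def
      by (intro continuous_on_Cc[OF F(1)] continuous_on_Cc[OF G(1)] continuous_intros)
    then show ?thesis by (rule CcI[OF _ K(1)]) (simp add: e_def K)
  qed
  define a where "a n x = (\<integral>y. e n x y \<partial>M)" for n x
  have a0: "0 \<le> a n x" for n x unfolding a_def by (simp add: e0)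
  have amono: "a n x \<le> a (Suc n) x" for n x
    unfolding a_def by (intro integral_mono Cc_integrable eCc emono)
  define F' G' where "F' n x = complex_of_real (F n x)" and "G' n x = complex_of_real (G n x)" for n x
  have FG': "F' n \<in> Cc" "G' n \<in> Cc" for n
    unfolding F'_def G'_def by (intro Cc_complex_of_real F G)+
  have aconv: "complex_of_real (a n x) = conv M (F' n) (G' n) x" for n x
    unfolding a_def conv_def e_def F'_def G'_def by (simp flip: of_real_mult)
  have aeq: "a n = (\<lambda>x. Re (conv M (F' n) (G' n) x))" for n
    by (simp flip: aconv)
  have aCc: "a n \<in> Cc" for n unfolding aeq
    by (rule Cc_compose0[OF conv_Cc[OF FG']]) (auto intro!: continuous_intros)
  have aint: "(\<integral>x. a n x \<partial>M) \<le> Bf * Bg" for n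
  proof -
    have "complex_of_real (\<integral>x. a n x \<partial>M) = (\<integral>x. conv M (F' n) (G' n) x \<partial>M)"
      by (simp flip: aconv)
    also have "\<dots> = complex_of_real ((\<integral>x. F n x \<partial>M) * (\<integral>x. G n x \<partial>M))"
      unfolding integral_conv_Cc[OF FG'] unfolding F'_def G'_def by simp
    finally have "(\<integral>x. a n x \<partial>M) = (\<integral>x. F n x \<partial>M) * (\<integral>x. G n x \<partial>M)"
      unfolding of_real_eq_iff .
    also have "\<dots> \<le> Bf * Bg"
    proof (rule mult_mono[OF F(4) G(4)])
      have "0 \<le> (\<integral>x. F n x \<partial>M)" by (simp add: F0)
      then show "0 \<le> Bf" using F(4)[of n] by linarith
      show "0 \<le> (\<integral>x. G n x \<partial>M)" by (simp add: G0)
    qed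
    finally show ?thesis .
  qed
  have "\<exists>w. integrable M w \<and> (AE x in M. \<forall>n. a n x \<le> w x)"
  proof (rule nn_monotone_dominated[where a = a, OF Cc_borel[OF aCc] a0 amono])
    show "(\<integral>\<^sup>+x. ennreal (a n x) \<partial>M) \<le> ennreal (Bf * Bg)" for n
      by (subst nn_integral_eq_integral[OF Cc_integrable[OF aCc]]) (auto simp: a0 intro: ennreal_leI aint)
  qed
  then obtain W where W: "integrable M W" "AE x in M. \<forall>n. a n x \<le> W x" by blast
  \<comment> \<open>Where \<open>W\<close> bounds all \<open>a n x\<close>, the increasing functions
    \<open>e n x\<close> have integrals at most \<open>W x\<close>, so they too have an integrable
    majorant, now in \<open>y\<close>.\<close>
  have lim_conv: "(\<lambda>n. conv M (\<phi> n) (\<gamma> n) x) \<longlonglongrightarrow> conv M f g x" if x: "\<forall>n. a n x \<le> W x" for x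
  proof -
    have "\<exists>w. integrable M w \<and> (AE y in M. \<forall>n. e n x y \<le> w y)"
    proof (rule nn_monotone_dominated[where a = "\<lambda>n. e n x", OF Cc_borel[OF eCc] e0 emono])
      show "(\<integral>\<^sup>+y. ennreal (e n x y) \<partial>M) \<le> ennreal (W x)" for n
        using x unfolding a_def
        by (subst nn_integral_eq_integral[OF Cc_integrable[OF eCc]]) (auto simp: e0 intro: ennreal_leI)
    qed
    then obtain w where w: "integrable M w" "AE y in M. \<forall>n. e n x y \<le> w y" by blast
    have r [measurable]: "(\<lambda>y. g (- y + x)) \<in> borel_measurable M" "(\<lambda>y. \<gamma> n (- y + x)) \<in> borel_measurable M" for n
      by (rule measurable_compose[OF reflect_measurable], simp)+
    show ?thesis unfolding conv_def
    proof (rule integral_dominated_convergence[OF _ _ w(1)])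
      show "AE y in M. (\<lambda>n. \<phi> n y * \<gamma> n (- y + x)) \<longlonglongrightarrow> f y * g (- y + x)"
        using l(1) AE_reflect[OF l(2), of x] by eventually_elim (rule tendsto_mult)
      show "AE y in M. norm (\<phi> n y * \<gamma> n (- y + x)) \<le> w y" for n
        using w(2) by eventually_elim (use ke[of n _ x] order_trans in blast)
    qed measurable
  qed
  have conv_le: "norm (conv M (\<phi> n) (\<gamma> n) x) \<le> a n x" for n x
  proof -
    have "norm (conv M (\<phi> n) (\<gamma> n) x) \<le> (\<integral>y. norm (\<phi> n y * \<gamma> n (- y + x)) \<partial>M)"
      unfolding conv_def by (rule integral_norm_bound)
    also have "\<dots> \<le> a n x" unfolding a_def
    proof (rule integral_mono[OF _ Cc_integrable[OF eCc] ke])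
      obtain K1 K2 where K: "compact K2" "\<And>x y. y \<notin> K2 \<Longrightarrow> \<phi> n y * \<gamma> n (- y + x) = 0"
        using conv_kernel_support[OF c(1)[of n] c(2)[of n]] by metis
      have "(\<lambda>y. \<phi> n y * \<gamma> n (- y + x)) \<in> Cc"
        by (rule CcI[OF _ K]) (intro continuous_on_Cc[OF c(1)] continuous_on_Cc[OF c(2)] continuous_intros)
      then show "integrable M (\<lambda>y. norm (\<phi> n y * \<gamma> n (- y + x)))"
        by (intro integrable_norm Cc_integrable)
    qed
    finally show ?thesis .
  qed
  have lim_AE: "AE x in M. (\<lambda>n. conv M (\<phi> n) (\<gamma> n) x) \<longlonglongrightarrow> conv M f g x"
    using W(2) by eventually_elim (rule lim_conv)
  have cint: "integrable M (conv M (\<phi> n) (\<gamma> n))" for n by (intro Cc_integrable conv_Cc c)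
  have cW: "AE x in M. norm (conv M (\<phi> n) (\<gamma> n) x) \<le> W x" for n
    using W(2) by eventually_elim (use conv_le order_trans in blast)
  have cfg: "integrable M (conv M f g)"
    by (rule integrable_dominated_convergence[OF conv_measurable[OF f g] borel_measurable_integrable[OF cint] W(1) lim_AE cW])
  obtain B where B: "B > 0" "\<And>x. norm (T x) \<le> B" using LinfE[OF T] by metis
  show ?thesis unfolding pairing_def
  proof (rule integral_dominated_convergence[OF Linf_mult_measurable[OF T cfg] Linf_mult_measurable[OF T cint]])
    show "integrable M (\<lambda>x. B * W x)" using W(1) by simp
    show "AE x in M. (\<lambda>n. T x * conv M (\<phi> n) (\<gamma> n) x) \<longlonglongrightarrow> T x * conv M f g x"
      using lim_AE by eventually_elim (intro tendsto_intros)
    show "AE x in M. norm (T x * conv M (\<phi> n) (\<gamma> n) x) \<le> B * W x" for n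
      using cW[of n] by eventually_elim (use B in \<open>auto simp: norm_mult intro!: mult_mono intro: less_imp_le\<close>)
  qed
qed

end

section \<open>Uniqueness of representatives in \<open>Linf\<close>, and continuity of translation
  in \<open>L1\<close>\<close>

text \<open>Testing with the conjugate of \<open>S - S'\<close> cut off to \<open>F\<close> gives
  the integral of \<open>|S - S'|^2\<close> over \<open>F\<close>. This makes the choice by
  \<open>SOME\<close> in the module actions harmless for functionals that respect locally null
  sets.\<close>

lemma Linf_unique:
  assumes S: "S \<in> Linf M" "S' \<in> Linf M" and eq: "\<And>g. g \<in> L1 M \<Longrightarrow> pairing M S g = pairing M S' g"
  shows "locally_null M {x. S x \<noteq> S' x}"
  unfolding locally_null_def
proof (intro ballI impI)
  fix F assume F [measurable]: "F \<in> sets M" and fin: "emeasure M F < \<infinity>"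
  obtain B where B: "B > 0" "\<And>x. norm (S x) \<le> B" using LinfE[OF S(1)] by metis
  obtain B' where B': "B' > 0" "\<And>x. norm (S' x) \<le> B'" using LinfE[OF S(2)] by metis
  have m: "(\<lambda>x. indicator F x *\<^sub>R (S x - S' x)) \<in> borel_measurable M"
  proof -
    have "S \<in> borel_measurable (restrict_space M F)" "S' \<in> borel_measurable (restrict_space M F)"
      using S F fin unfolding Linf_def locally_measurable_def by blast+
    then have "(\<lambda>x. S x - S' x) \<in> borel_measurable (restrict_space M F)" by measurable
    then show ?thesis by (subst (asm) borel_measurable_restrict_space_iff) auto
  qed
  define d where "d x = indicator F x *\<^sub>R (S x - S' x)" for x
  have d [measurable]: "d \<in> borel_measurable M" using m unfolding d_def .
  define g where "g x = cnj (d x)" for x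
  have gm: "g \<in> borel_measurable M" unfolding g_def
    by (rule measurable_compose[OF d]) (intro borel_measurable_continuous_onI continuous_intros)
  have gi: "integrable M g"
  proof (rule Bochner_Integration.integrable_bound[OF _ gm])
    show "integrable M (\<lambda>x. (B + B') * indicator F x)" using fin F by simp
    show "AE x in M. norm (g x) \<le> norm ((B + B') * indicator F x)"
    proof (rule AE_I2)
      fix x
      have "norm (S x - S' x) \<le> B + B'"
        using norm_triangle_ineq4[of "S x" "S' x"] B(2)[of x] B'(2)[of x] by linarith
      then show "norm (g x) \<le> norm ((B + B') * indicator F x)"
        using B(1) B'(1) unfolding g_def complex_mod_cnj d_def by (auto simp: indicator_def)
    qed
  qed
  have 0: "(\<integral>x. S x * g x - S' x * g x \<partial>M) = 0"
    using eq[of g] gi Linf_mult_integrable[OF S(1) gi] Linf_mult_integrable[OF S(2) gi]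
    by (simp add: pairing_def L1_def)
  have eq2: "S x * g x - S' x * g x = complex_of_real ((norm (d x))\<^sup>2)" for x
    unfolding complex_norm_square by (auto simp: g_def d_def indicator_def algebra_simps)
  have i2: "integrable M (\<lambda>x. (norm (d x))\<^sup>2)"
  proof -
    have "integrable M (\<lambda>x. S x * g x - S' x * g x)"
      using Linf_mult_integrable[OF S(1) gi] Linf_mult_integrable[OF S(2) gi] by simp
    then have "integrable M (\<lambda>x. Re (complex_of_real ((norm (d x))\<^sup>2)))"
      unfolding eq2 by (rule integrable_Re)
    then show ?thesis by simp
  qed
  have "(\<integral>x. complex_of_real ((norm (d x))\<^sup>2) \<partial>M) = 0" using 0 unfolding eq2 .
  then have "(\<integral>x. (norm (d x))\<^sup>2 \<partial>M) = 0" by (simp del: of_real_power)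
  then have "AE x in M. (norm (d x))\<^sup>2 = 0"
    by (subst (asm) integral_nonneg_eq_0_iff_AE[OF i2]) simp_all
  then have "AE x in M. x \<notin> {x. S x \<noteq> S' x} \<inter> F"
    by eventually_elim (auto simp: d_def)
  moreover have "{x. S x \<noteq> S' x} \<inter> F = {x \<in> space M. d x \<noteq> 0}"
    using sets.sets_into_space[OF F] by (auto simp: d_def indicator_def)
  moreover have "{x \<in> space M. d x \<noteq> 0} \<in> sets M" by measurable
  ultimately show "{x. S x \<noteq> S' x} \<inter> F \<in> null_sets M"
    by (simp add: AE_iff_null_sets)
qed

lemma pairing_diff_le:
  assumes S: "S \<in> Linf M" "\<And>x. norm (S x) \<le> B" and g: "integrable M g" "integrable M g'"
  shows "norm (pairing M S g - pairing M S g') \<le> B * (\<integral>x. norm (g x - g' x) \<partial>M)"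
proof -
  have "pairing M S g - pairing M S g' = (\<integral>x. S x * (g x - g' x) \<partial>M)"
    unfolding pairing_def using Linf_mult_integrable[OF S(1)] g by (simp add: right_diff_distrib)
  then show ?thesis using norm_Linf_integral_le[OF S, of "\<lambda>x. g x - g' x"] g by simp
qed

context lc_haar
begin

lemma integrable_left_translate:
  fixes f :: "'a \<Rightarrow> complex"
  shows "integrable M f \<Longrightarrow> integrable M (\<lambda>x. f (g + x))"
  using integrable_distr[OF translate_measurable[of g], of f] by (simp add: distr_translate)

lemma L1_right_continuous:
  fixes h :: "'a \<Rightarrow> complex"
  assumes h: "h \<in> Cc" and e: "e > 0"
  shows "\<exists>V. open V \<and> 0 \<in> V \<and> (\<forall>u\<in>V. (\<integral>y. norm (h (y + u) - h y) \<partial>M) < e)"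
proof -
  obtain K where K: "compact K" "\<And>x. x \<notin> K \<Longrightarrow> h x = 0" using CcE[OF h] by metis
  obtain W L where W: "open W" "compact L" "0 \<in> W" "W \<subseteq> (L :: 'a set)"
    by (rule locally_compact_nbhd[OF lc, where x = 0])
  define K' where "K' = K \<union> {a + b | a b. a \<in> K \<and> b \<in> uminus ` L}"
  have K': "compact K'" unfolding K'_def by (intro compact_Un compact_set_add compact_uminus_image K W)
  define e' where "e' = e / (measure M K' + 1)"
  have e': "e' > 0" using e by (simp add: e'_def add_nonneg_pos)
  obtain V where V: "open V" "0 \<in> V" "\<And>u x. u \<in> V \<Longrightarrow> norm (h (x + u) - h x) < e'"
    using Cc_right_uniformly_continuous[OF lc h e'] by metis
  have "(\<integral>y. norm (h (y + u) - h y) \<partial>M) < e" if u: "u \<in> V \<inter> W" for u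
  proof -
    have "norm (\<integral>y. norm (h (y + u) - h y) \<partial>M) \<le> e' * measure M K'"
    proof (rule norm_integral_bounded_support[OF _ K'])
      show "(\<lambda>y. norm (h (y + u) - h y)) \<in> borel_measurable M"
        by (intro continuous_borel continuous_intros continuous_on_Cc[OF h])
      show "norm (h (y + u) - h y) = 0" if y: "y \<notin> K'" for y
      proof -
        have "y + u \<notin> K"
        proof
          assume "y + u \<in> K"
          then have "y \<in> {a + b | a b. a \<in> K \<and> b \<in> uminus ` L}"
            using u W by (intro mem_set_add[of "y + u" _ "- u"] imageI) (auto simp only: group_normalize)
          then show False using y by (simp add: K'_def)
        qed
        moreover have "y \<notin> K" using y by (simp add: K'_def)
        ultimately show ?thesis by (simp add: K)
      qed
      show "norm (norm (h (y + u) - h y)) \<le> e'" for y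
        using V(3)[of u y] u by simp
    qed
    also have "\<dots> < e' * (measure M K' + 1)" using e' by simp
    also have "\<dots> = e" unfolding e'_def
      by (metis add_nonneg_pos measure_nonneg nonzero_eq_divide_eq order_less_irrefl zero_less_one)
    finally show ?thesis by simp
  qed
  then show ?thesis using V W by (intro exI[of _ "V \<inter> W"]) auto
qed

end

context fc_haar
begin

lemma integrable_right_translate:
  fixes f :: "'a \<Rightarrow> complex"
  shows "integrable M f \<Longrightarrow> integrable M (\<lambda>x. f (x + g))"
  using integrable_distr[OF right_translate_measurable[of g], of f] by (simp add: distr_right_translate)

lemma integral_flip:
  fixes \<psi> :: "'a \<Rightarrow> complex"
  assumes "\<psi> \<in> borel_measurable M"
  shows "(\<integral>w. \<psi> (z - w + x) \<partial>M) = (\<integral>y. \<psi> y \<partial>M)"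
proof -
  have m: "(\<lambda>y. \<psi> (y + x)) \<in> borel_measurable M"
    by (rule measurable_compose[OF right_translate_measurable assms])
  have m': "(\<lambda>y. \<psi> (z + y + x)) \<in> borel_measurable M"
    by (rule measurable_compose[OF translate_measurable m])
  have "(\<integral>w. \<psi> (z - w + x) \<partial>M) = (\<integral>w. \<psi> (z + w + x) \<partial>M)"
    using integral_uminus[OF m'] by simp
  also have "\<dots> = (\<integral>w. \<psi> (w + x) \<partial>M)"
    using integral_left_translate[OF m, of z] by simp
  also have "\<dots> = (\<integral>w. \<psi> w \<partial>M)" by (rule integral_right_translate[OF assms])
  finally show ?thesis .
qed

lemma L1_left_continuous:
  fixes f :: "'a \<Rightarrow> complex"
  assumes f: "f \<in> Cc" and e: "e > 0"
  shows "\<exists>V. open V \<and> 0 \<in> V \<and> (\<forall>u\<in>V. (\<integral>y. norm (f (u + y) - f y) \<partial>M) < e)"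
proof -
  obtain V where V: "open V" "0 \<in> V" "\<And>u. u \<in> V \<Longrightarrow> (\<integral>y. norm (f (- (y + u)) - f (- y)) \<partial>M) < e"
    using L1_right_continuous[OF Cc_compose_uminus[OF f] e] by metis
  have "(\<integral>y. norm (f (u + y) - f y) \<partial>M) < e" if "u \<in> uminus -` V" for u
  proof -
    have "(\<lambda>y. norm (f (u + y) - f y)) \<in> borel_measurable M"
      by (intro continuous_borel continuous_intros continuous_on_Cc[OF f])
    from integral_uminus[OF this] show ?thesis
      using V(3)[of "- u"] that by (simp add: minus_add)
  qed
  moreover have "open (uminus -` V)" by (intro open_vimage_cont V continuous_intros)
  ultimately show ?thesis using V by (intro exI[of _ "uminus -` V"]) auto
qed

subsection \<open>Representatives of the module actions\<close>

text \<open>An explicit representative of \<open>hT\<close>. Writing the convolution of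
  \<open>h\<close> and \<open>g\<close> at \<open>y\<close> as the integral of
  \<open>h (y - x) * g x\<close> over \<open>x\<close> brings in no modular factor, because the
  group is unimodular.\<close>

definition lact :: "('a \<Rightarrow> complex) \<Rightarrow> ('a \<Rightarrow> complex) \<Rightarrow> 'a \<Rightarrow> complex" where
  "lact h T x = (\<integral>y. T y * h (y - x) \<partial>M)"

definition ract :: "('a \<Rightarrow> complex) \<Rightarrow> ('a \<Rightarrow> complex) \<Rightarrow> 'a \<Rightarrow> complex" where
  "ract T f x = (\<integral>y. T y * f (- x + y) \<partial>M)"

lemma integrable_diff_translate: "integrable M f \<Longrightarrow> integrable M (\<lambda>y. f (y - x) :: complex)"
  using integrable_right_translate[of f "- x"] by simp

lemma lact_diff_bound:
  assumes T: "T \<in> Linf M" "\<And>x. norm (T x) \<le> B" and h: "integrable M h" "integrable M h'"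
  shows "norm (lact h T x - lact h' T x) \<le> B * (\<integral>y. norm (h y - h' y) \<partial>M)"
proof -
  have "norm (lact h T x - lact h' T x) \<le> B * (\<integral>y. norm (h (y - x) - h' (y - x)) \<partial>M)"
    using pairing_diff_le[OF T integrable_diff_translate[OF h(1)] integrable_diff_translate[OF h(2)], of x x]
    unfolding lact_def pairing_def .
  also have "(\<integral>y. norm (h (y - x) - h' (y - x)) \<partial>M) = (\<integral>y. norm (h y - h' y) \<partial>M)"
    using integral_right_translate[of "\<lambda>y. norm (h y - h' y)" "- x"] h by simp
  finally show ?thesis .
qed

lemma ract_diff_bound:
  assumes T: "T \<in> Linf M" "\<And>x. norm (T x) \<le> B" and f: "integrable M f" "integrable M f'"
  shows "norm (ract T f x - ract T f' x) \<le> B * (\<integral>y. norm (f y - f' y) \<partial>M)"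
proof -
  have "norm (ract T f x - ract T f' x) \<le> B * (\<integral>y. norm (f (- x + y) - f' (- x + y)) \<partial>M)"
    using pairing_diff_le[OF T integrable_left_translate[OF f(1)] integrable_left_translate[OF f(2)], of "- x" "- x"]
    unfolding ract_def pairing_def .
  also have "(\<integral>y. norm (f (- x + y) - f' (- x + y)) \<partial>M) = (\<integral>y. norm (f y - f' y) \<partial>M)"
    using integral_left_translate[of "\<lambda>y. norm (f y - f' y)" "- x"] f by simp
  finally show ?thesis .
qed

text \<open>Moving the argument of \<open>hT\<close> by \<open>u\<close> on the left amounts to
  moving \<open>h\<close> by \<open>- u\<close> on the right, so continuity of right translation in
  \<open>L1\<close> gives a bound that is uniform in \<open>x\<close>. This is the gain from
  replacing \<open>T\<close> by \<open>hT\<close>.\<close>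

lemma lact_left_uniformly_continuous:
  assumes T: "T \<in> Linf M" and h: "h \<in> Cc" and e: "e > 0"
  shows "\<exists>V. open V \<and> 0 \<in> V \<and> (\<forall>u\<in>V. \<forall>x. norm (lact h T (u + x) - lact h T x) < e)"
proof -
  obtain B where B: "B > 0" "\<And>x. norm (T x) \<le> B" using LinfE[OF T] by metis
  have eB: "e / B > 0" using e B by simp
  obtain V where V: "open V" "0 \<in> V" "\<And>u. u \<in> V \<Longrightarrow> (\<integral>y. norm (h (y + u) - h y) \<partial>M) < e / B"
    using L1_right_continuous[OF h eB] by metis
  have "norm (lact h T (u + x) - lact h T x) < e" if u: "u \<in> uminus -` V" for u x
  proof -
    have "lact h T (u + x) = lact (\<lambda>y. h (y + - u)) T x"
      unfolding lact_def by (simp only: group_normalize)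
    then have "norm (lact h T (u + x) - lact h T x) \<le> B * (\<integral>y. norm (h (y + - u) - h y) \<partial>M)"
      using lact_diff_bound[OF T B(2) integrable_right_translate[OF Cc_integrable[OF h]] Cc_integrable[OF h]] by metis
    also have "\<dots> < B * (e / B)" using V(3)[of "- u"] u B(1) by (intro mult_strict_left_mono) auto
    also have "\<dots> = e" using B(1) by simp
    finally show ?thesis .
  qed
  moreover have "open (uminus -` V)" by (intro open_vimage_cont V continuous_intros)
  ultimately show ?thesis using V by (intro exI[of _ "uminus -` V"]) auto
qed

lemma lact_BC:
  assumes T: "T \<in> Linf M" and h: "h \<in> Cc" shows "lact h T \<in> BC"
proof -
  obtain B where B: "B > 0" "\<And>x. norm (T x) \<le> B" using LinfE[OF T] by metis
  show ?thesis
  proof (rule BCI)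
    show "norm (lact h T x) \<le> B * (\<integral>y. norm (h y) \<partial>M)" for x
      using lact_diff_bound[OF T B(2) Cc_integrable[OF h], of "\<lambda>x. 0" x] by (simp add: lact_def)
    show "continuous_on UNIV (lact h T)"
      unfolding continuous_on_def
    proof (intro ballI tendstoI)
      fix x0 and e :: real assume e: "e > 0"
      obtain V where V: "open V" "0 \<in> V" "\<And>u x. u \<in> V \<Longrightarrow> norm (lact h T (u + x) - lact h T x) < e"
        using lact_left_uniformly_continuous[OF T h e] by metis
      have "open ((\<lambda>x. x - x0) -` V)" by (intro open_vimage_cont V continuous_intros)
      moreover have "dist (lact h T x) (lact h T x0) < e" if "x - x0 \<in> V" for x
        using V(3)[OF that, of x0] by (simp add: dist_norm)
      ultimately show "\<forall>\<^sub>F x in at x0 within UNIV. dist (lact h T x) (lact h T x0) < e"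
        unfolding eventually_at_topological using V(2) by (intro exI[of _ "(\<lambda>x. x - x0) -` V"]) auto
    qed
  qed
qed

text \<open>The estimate depends on \<open>- x + x0\<close>, so it is uniform for right translation.
  The final argument wants uniformity for left translation, which has to come from
  \<open>lact\<close>.\<close>

lemma ract_continuous_Cc:
  assumes T: "T \<in> Linf M" and f: "f \<in> Cc" shows "continuous_on UNIV (ract T f)"
  unfolding continuous_on_def
proof (intro ballI tendstoI)
  obtain B where B: "B > 0" "\<And>x. norm (T x) \<le> B" using LinfE[OF T] by metis
  fix x0 and e :: real assume e: "e > 0"
  then have eB: "e / B > 0" using B by simp
  obtain V where V: "open V" "0 \<in> V" "\<And>u. u \<in> V \<Longrightarrow> (\<integral>y. norm (f (u + y) - f y) \<partial>M) < e / B"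
    using L1_left_continuous[OF f eB] by metis
  have "dist (ract T f x) (ract T f x0) < e" if x: "- x + x0 \<in> V" for x
  proof -
    have "ract T f x = ract T (\<lambda>y. f (- x + x0 + y)) x0"
      unfolding ract_def by (simp only: group_normalize)
    then have "norm (ract T f x - ract T f x0) \<le> B * (\<integral>y. norm (f (- x + x0 + y) - f y) \<partial>M)"
      using ract_diff_bound[OF T B(2) integrable_left_translate[OF Cc_integrable[OF f]] Cc_integrable[OF f]] by metis
    also have "\<dots> < B * (e / B)" using V(3)[OF x] B(1) by (intro mult_strict_left_mono) auto
    also have "\<dots> = e" using B(1) by simp
    finally show ?thesis by (simp add: dist_norm)
  qed
  moreover have "open ((\<lambda>x. - x + x0) -` V)" by (intro open_vimage_cont V continuous_intros)
  ultimately show "\<forall>\<^sub>F x in at x0 within UNIV. dist (ract T f x) (ract T f x0) < e"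
    unfolding eventually_at_topological using V(2) by (intro exI[of _ "(\<lambda>x. - x + x0) -` V"]) auto
qed

lemma fast_approxD:
  assumes "fast_approx \<phi> f"
  shows "\<phi> n \<in> Cc" "(\<integral>x. norm (f x - \<phi> n x) \<partial>M) \<le> (1/2) ^ n" "(\<integral>x. norm (\<phi> n x - f x) \<partial>M) \<le> (1/2) ^ n"
  using assms unfolding fast_approx_def by (auto simp: norm_minus_commute)

lemma ract_fast_approx:
  assumes T: "T \<in> Linf M" "\<And>x. norm (T x) \<le> B" "B > 0" and f: "integrable M f" "fast_approx \<phi> f"
  shows "norm (ract T (\<phi> n) x - ract T f x) \<le> B * (1/2) ^ n"
proof -
  have "norm (ract T (\<phi> n) x - ract T f x) \<le> B * (\<integral>y. norm (\<phi> n y - f y) \<partial>M)"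
    by (rule ract_diff_bound[OF T(1,2) Cc_integrable[OF fast_approxD(1)[OF f(2)]] f(1)])
  also have "\<dots> \<le> B * (1/2) ^ n"
    using fast_approxD(3)[OF f(2)] T(3) by (intro mult_left_mono) auto
  finally show ?thesis .
qed

lemma power_half_tendsto: "(\<lambda>n. B * (1/2::real) ^ n) \<longlonglongrightarrow> 0"
  using tendsto_mult[OF tendsto_const LIMSEQ_realpow_zero[of "1/2"], of B] by simp

lemma ract_BC:
  assumes T: "T \<in> Linf M" and f: "integrable M f" shows "ract T f \<in> BC"
proof -
  obtain B where B: "B > 0" "\<And>x. norm (T x) \<le> B" using LinfE[OF T] by metis
  obtain \<phi> where \<phi>: "fast_approx \<phi> f" using fast_approx_exists[OF f] by blast
  show ?thesis
  proof (rule BCI)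
    show "norm (ract T f x) \<le> B * (\<integral>y. norm (f y) \<partial>M)" for x
      using ract_diff_bound[OF T B(2) f, of "\<lambda>x. 0" x] by (simp add: ract_def)
    show "continuous_on UNIV (ract T f)"
    proof (rule uniform_limit_theorem)
      show "\<forall>\<^sub>F n in sequentially. continuous_on UNIV (ract T (\<phi> n))"
        by (intro always_eventually allI ract_continuous_Cc T fast_approxD(1)[OF \<phi>])
      show "uniform_limit UNIV (\<lambda>n. ract T (\<phi> n)) (ract T f) sequentially"
      proof (rule uniform_limitI)
        fix e :: real assume "e > 0"
        then have "\<forall>\<^sub>F n in sequentially. B * (1/2) ^ n < e"
          using order_tendstoD(2)[OF power_half_tendsto] by blast
        then show "\<forall>\<^sub>F n in sequentially. \<forall>x\<in>UNIV. dist (ract T (\<phi> n) x) (ract T f x) < e"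
          by eventually_elim
            (use ract_fast_approx[OF T B(2,1) f \<phi>] le_less_trans in \<open>unfold dist_norm, blast\<close>)
      qed
    qed simp
  qed
qed

lemma pairing_ract_Cc:
  assumes T: "T \<in> Linf M" and f: "f \<in> Cc" and g: "g \<in> Cc"
  shows "pairing M T (conv M f g) = pairing M (ract T g) f"
proof -
  obtain K1 K2 where K: "compact K1" "compact K2" "\<And>x y. x \<notin> K1 \<Longrightarrow> f y * g (- y + x) = 0"
    "\<And>x y. y \<notin> K2 \<Longrightarrow> f y * g (- y + x) = 0"
    using conv_kernel_support[OF f g] by metis
  have "pairing M T (conv M f g) = (\<integral>y. (\<integral>x. T x * (f y * g (- y + x)) \<partial>M) \<partial>M)"
    unfolding pairing_def conv_def
    by (rule fubini_Cc[OF T conv_kernel_continuous(2)[OF f g] K(2,1)]) (use K in auto)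
  also have "\<dots> = pairing M (ract T g) f"
    unfolding pairing_def ract_def
  proof (rule Bochner_Integration.integral_cong[OF refl])
    fix y
    have "(\<integral>x. T x * (f y * g (- y + x)) \<partial>M) = (\<integral>x. f y * (T x * g (- y + x)) \<partial>M)"
      by (simp only: mult.left_commute)
    then show "(\<integral>x. T x * (f y * g (- y + x)) \<partial>M) = (\<integral>x. T x * g (- y + x) \<partial>M) * f y"
      by simp
  qed
  finally show ?thesis .
qed

lemma pairing_lact_Cc:
  assumes T: "T \<in> Linf M" and f: "f \<in> Cc" and g: "g \<in> Cc"
  shows "pairing M T (conv M f g) = pairing M (lact f T) g"
proof -
  obtain Kf where Kf: "compact Kf" "\<And>x. x \<notin> Kf \<Longrightarrow> f x = 0" using CcE[OF f] by metis
  obtain Kg where Kg: "compact Kg" "\<And>x. x \<notin> Kg \<Longrightarrow> g x = 0" using CcE[OF g] by metis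
  have conv_eq: "conv M f g x = (\<integral>y. f (x - y) * g y \<partial>M)" for x
  proof -
    have "(\<lambda>y. f y * g (- y + x)) \<in> borel_measurable M"
      by (intro continuous_borel conv_kernel_continuous(3) f g)
    from integral_flip[OF this, of x 0] show ?thesis
      unfolding conv_def by (simp add: minus_diff_eq)
  qed
  have "pairing M T (conv M f g) = (\<integral>y. (\<integral>x. T x * (f (x - y) * g y) \<partial>M) \<partial>M)"
    unfolding pairing_def conv_eq
  proof (rule fubini_Cc[OF T _ Kg(1) compact_set_add[OF Kf(1) Kg(1)]])
    show "continuous_on UNIV (\<lambda>(y, x). f (x - y) * g y)"
      by (auto simp: case_prod_unfold intro!: continuous_on_Cc[OF g] continuous_on_Cc[OF f] continuous_intros)
    show "f (x - y) * g y = 0" if "x \<notin> {a + b | a b. a \<in> Kf \<and> b \<in> Kg}" for x y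
    proof (rule ccontr)
      assume "\<not> ?thesis"
      then have "y \<in> Kg" "x - y \<in> Kf" using Kg Kf by auto
      then have "x \<in> {a + b | a b. a \<in> Kf \<and> b \<in> Kg}"
        by (intro mem_set_add[of "x - y" _ y]) (simp_all only: group_normalize)
      with that show False by blast
    qed
  qed (simp add: Kg)
  also have "\<dots> = pairing M (lact f T) g"
    unfolding pairing_def lact_def by (simp add: mult.assoc[symmetric])
  finally show ?thesis .
qed

lemma pairing_fast_approx:
  assumes S: "S \<in> Linf M" and g: "integrable M g" "fast_approx \<gamma> g"
  shows "(\<lambda>n. pairing M S (\<gamma> n)) \<longlonglongrightarrow> pairing M S g"
proof -
  obtain B where B: "B > 0" "\<And>x. norm (S x) \<le> B" using LinfE[OF S] by metis
  have "(\<lambda>n. pairing M S (\<gamma> n) - pairing M S g) \<longlonglongrightarrow> 0"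
  proof (rule Lim_null_comparison[OF always_eventually power_half_tendsto], rule allI)
    fix n
    have "norm (pairing M S (\<gamma> n) - pairing M S g) \<le> B * (\<integral>x. norm (\<gamma> n x - g x) \<partial>M)"
      by (rule pairing_diff_le[OF S B(2) Cc_integrable[OF fast_approxD(1)[OF g(2)]] g(1)])
    also have "\<dots> \<le> B * (1/2) ^ n"
      using fast_approxD(3)[OF g(2)] B(1) by (intro mult_left_mono) auto
    finally show "norm (pairing M S (\<gamma> n) - pairing M S g) \<le> B * (1/2) ^ n" .
  qed
  then show ?thesis by (rule LIM_zero_cancel)
qed

lemma pairing_lact:
  assumes T: "T \<in> Linf M" and h: "h \<in> Cc" and g: "integrable M g"
  shows "pairing M (lact h T) g = pairing M T (conv M h g)"
proof -
  obtain \<gamma> where \<gamma>: "fast_approx \<gamma> g" using fast_approx_exists[OF g] by blast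
  have "(\<lambda>n. pairing M T (conv M h (\<gamma> n))) \<longlonglongrightarrow> pairing M T (conv M h g)"
    using conv_limit[OF T Cc_integrable[OF h] fast_approx_const[OF h] g \<gamma>] .
  moreover have "pairing M T (conv M h (\<gamma> n)) = pairing M (lact h T) (\<gamma> n)" for n
    by (rule pairing_lact_Cc[OF T h fast_approxD(1)[OF \<gamma>]])
  ultimately show ?thesis
    using LIMSEQ_unique pairing_fast_approx[OF BC_subset_Linf[OF lact_BC[OF T h]] g \<gamma>] by simp
qed

text \<open>Both factors are approximated along the same index: \<open>ract T (\<phi> n)\<close>
  tends to \<open>ract T f\<close> uniformly while the norms of the \<open>\<gamma> n\<close> stay
  bounded, so the error in the pairing tends to 0.\<close>

lemma pairing_ract:
  assumes T: "T \<in> Linf M" and f: "integrable M f" and g: "integrable M g"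
  shows "pairing M (ract T f) g = pairing M T (conv M g f)"
proof -
  obtain B where B: "B > 0" "\<And>x. norm (T x) \<le> B" using LinfE[OF T] by metis
  obtain \<gamma> where \<gamma>: "fast_approx \<gamma> g" using fast_approx_exists[OF g] by blast
  obtain \<phi> where \<phi>: "fast_approx \<phi> f" using fast_approx_exists[OF f] by blast
  note gi = Cc_integrable[OF fast_approxD(1)[OF \<gamma>]]
  note fi = Cc_integrable[OF fast_approxD(1)[OF \<phi>]]
  define C where "C = (\<integral>x. norm (g x) \<partial>M) + 1"
  have C: "(\<integral>x. norm (\<gamma> n x) \<partial>M) \<le> C" for n
  proof -
    have "(\<integral>x. norm (\<gamma> n x) \<partial>M) \<le> (\<integral>x. norm (\<gamma> n x - g x) \<partial>M) + (\<integral>x. norm (g x) \<partial>M)"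
      using integral_norm_triangle[OF gi g, of "\<lambda>x. 0" n] by simp
    also have "\<dots> \<le> (1/2) ^ n + (\<integral>x. norm (g x) \<partial>M)" using fast_approxD(3)[OF \<gamma>, of n] by simp
    also have "(1/2::real) ^ n \<le> 1" by (simp add: power_le_one)
    finally show ?thesis by (simp add: C_def)
  qed
  have "(\<lambda>n. pairing M (ract T (\<phi> n)) (\<gamma> n) - pairing M (ract T f) (\<gamma> n)) \<longlonglongrightarrow> 0"
  proof (rule Lim_null_comparison[OF always_eventually power_half_tendsto], rule allI)
    fix n
    let ?d = "\<lambda>x. ract T (\<phi> n) x - ract T f x"
    have dL: "?d \<in> Linf M"
      using BC_subset_Linf[OF BC_add[OF ract_BC[OF T fi] BC_cmult[OF ract_BC[OF T f], of "-1"]]] by simp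
    have "pairing M (ract T (\<phi> n)) (\<gamma> n) - pairing M (ract T f) (\<gamma> n) = (\<integral>x. ?d x * \<gamma> n x \<partial>M)"
      unfolding pairing_def
      using Linf_mult_integrable[OF BC_subset_Linf[OF ract_BC[OF T fi]] gi]
        Linf_mult_integrable[OF BC_subset_Linf[OF ract_BC[OF T f]] gi]
      by (simp add: left_diff_distrib)
    also have "norm \<dots> \<le> (B * (1/2) ^ n) * (\<integral>x. norm (\<gamma> n x) \<partial>M)"
      by (rule norm_Linf_integral_le[OF dL ract_fast_approx[OF T B(2,1) f \<phi>] gi])
    also have "\<dots> \<le> (B * (1/2) ^ n) * C" using C B(1) by (intro mult_left_mono) auto
    finally show "norm (pairing M (ract T (\<phi> n)) (\<gamma> n) - pairing M (ract T f) (\<gamma> n)) \<le> (B * C) * (1/2) ^ n"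
      by (simp add: mult_ac)
  qed
  from tendsto_add[OF this pairing_fast_approx[OF BC_subset_Linf[OF ract_BC[OF T f]] g \<gamma>]]
  have "(\<lambda>n. pairing M (ract T (\<phi> n)) (\<gamma> n)) \<longlonglongrightarrow> pairing M (ract T f) g" by simp
  moreover have "pairing M T (conv M (\<gamma> n) (\<phi> n)) = pairing M (ract T (\<phi> n)) (\<gamma> n)" for n
    by (rule pairing_ract_Cc[OF T fast_approxD(1)[OF \<gamma>] fast_approxD(1)[OF \<phi>]])
  ultimately show ?thesis
    using LIMSEQ_unique conv_limit[OF T g \<gamma> f \<phi>] by simp
qed

text \<open>\<open>lact\<close> witnesses that the choice is possible, and
  \<open>Linf_unique\<close> identifies it with the chosen function up to a locally null set. Only
  \<open>h\<close> in \<open>Cc\<close> is treated, because left invariance is applied to averages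
  of one's own choosing; \<open>right_act_eq\<close> must cover every integrable
  \<open>f\<close>.\<close>

lemma left_act_eq:
  assumes m: "linear_functional M m" and T: "T \<in> Linf M" and h: "h \<in> Cc"
  shows "m (left_act M h T) = m (lact h T)"
proof -
  have L: "lact h T \<in> Linf M" by (rule BC_subset_Linf[OF lact_BC[OF T h]])
  have "\<exists>S. S \<in> Linf M \<and> (\<forall>g \<in> L1 M. pairing M S g = pairing M T (conv M h g))"
    using L pairing_lact[OF T h] by (auto simp: L1_def)
  from someI_ex[OF this] have S: "left_act M h T \<in> Linf M"
    "\<And>g. g \<in> L1 M \<Longrightarrow> pairing M (left_act M h T) g = pairing M T (conv M h g)"
    unfolding left_act_def by auto
  have "locally_null M {x. left_act M h T x \<noteq> lact h T x}"
    using S pairing_lact[OF T h] by (intro Linf_unique L) (auto simp: L1_def)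
  then show ?thesis using m S(1) L unfolding linear_functional_def by blast
qed

lemma right_act_eq:
  assumes m: "linear_functional M m" and T: "T \<in> Linf M" and f: "integrable M f"
  shows "m (right_act M T f) = m (ract T f)"
proof -
  have L: "ract T f \<in> Linf M" by (rule BC_subset_Linf[OF ract_BC[OF T f]])
  have "\<exists>S. S \<in> Linf M \<and> (\<forall>g \<in> L1 M. pairing M S g = pairing M T (conv M g f))"
    using L pairing_ract[OF T f] by (auto simp: L1_def)
  from someI_ex[OF this] have S: "right_act M T f \<in> Linf M"
    "\<And>g. g \<in> L1 M \<Longrightarrow> pairing M (right_act M T f) g = pairing M T (conv M g f)"
    unfolding right_act_def by auto
  have "locally_null M {x. right_act M T f x \<noteq> ract T f x}"
    using S pairing_ract[OF T f] by (intro Linf_unique L) (auto simp: L1_def)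
  then show ?thesis using m S(1) L unfolding linear_functional_def by blast
qed

subsection \<open>Means\<close>

text \<open>Positivity bounds \<open>m\<close> on real functions by comparison with the constant
  \<open>B\<close>. Treating real and imaginary parts separately costs the factor 2, which is
  harmless since \<open>interchange\<close> accepts any bound.\<close>

lemma mean_BC_bound:
  assumes m: "mean M m" and F: "F \<in> BC" "\<And>x. norm (F x) \<le> B"
  shows "norm (m F) \<le> 2 * B"
proof -
  have add: "m (\<lambda>x. S x + T x) = m S + m T" if "S \<in> BC" "T \<in> BC" for S T
    using m BC_subset_Linf that unfolding mean_def linear_functional_def by blast
  have scale: "m (\<lambda>x. c * T x) = c * m T" if "T \<in> BC" for c T
    using m BC_subset_Linf that unfolding mean_def linear_functional_def by blast
  have one: "m (\<lambda>x. 1) = 1" using m unfolding mean_def by blast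
  have pos: "m T \<in> \<real>\<^sub>\<ge>\<^sub>0" if T: "T \<in> BC" "\<And>x. T x \<in> \<real>\<^sub>\<ge>\<^sub>0" for T
  proof -
    have "locally_null M {x. T x \<notin> \<real>\<^sub>\<ge>\<^sub>0}" using T(2) by (simp add: locally_null_def)
    then show ?thesis using m BC_subset_Linf[OF T(1)] unfolding mean_def by blast
  qed
  have real: "norm (m (\<lambda>x. complex_of_real (R x))) \<le> B"
    if R: "(\<lambda>x. complex_of_real (R x)) \<in> BC" "\<And>x. \<bar>R x\<bar> \<le> B" for R
  proof -
    have c: "m (\<lambda>x. complex_of_real B) = complex_of_real B"
      using scale[OF BC_const[of 1], of "complex_of_real B"] one by simp
    have "m (\<lambda>x. complex_of_real B + complex_of_real (R x)) \<in> \<real>\<^sub>\<ge>\<^sub>0"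
    proof (rule pos[OF BC_add[OF BC_const R(1)]])
      show "complex_of_real B + complex_of_real (R x) \<in> \<real>\<^sub>\<ge>\<^sub>0" for x
        using R(2)[of x] by (simp flip: of_real_add add: nonneg_Reals_of_real_iff)
    qed
    then have 1: "complex_of_real B + m (\<lambda>x. complex_of_real (R x)) \<in> \<real>\<^sub>\<ge>\<^sub>0"
      using add[OF BC_const R(1)] c by simp
    have "m (\<lambda>x. complex_of_real B + (-1) * complex_of_real (R x)) \<in> \<real>\<^sub>\<ge>\<^sub>0"
    proof (rule pos[OF BC_add[OF BC_const BC_cmult[OF R(1)]]])
      show "complex_of_real B + (-1) * complex_of_real (R x) \<in> \<real>\<^sub>\<ge>\<^sub>0" for x
        using R(2)[of x] by (simp flip: of_real_diff add: nonneg_Reals_of_real_iff)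
    qed
    then have 2: "complex_of_real B - m (\<lambda>x. complex_of_real (R x)) \<in> \<real>\<^sub>\<ge>\<^sub>0"
      using add[OF BC_const BC_cmult[OF R(1), of "-1"]] scale[OF R(1), of "-1"] c by simp
    define z where "z = m (\<lambda>x. complex_of_real (R x))"
    have z: "Im z = 0" "0 \<le> B + Re z" "0 \<le> B - Re z"
      using 1 2 unfolding z_def[symmetric] complex_nonneg_Reals_iff by simp_all
    then have "norm z = \<bar>Re z\<bar>" by (metis norm_of_real complex_is_Real_iff of_real_Re)
    with z show ?thesis unfolding z_def[symmetric] by linarith
  qed
  have Fc: "continuous_on UNIV F" using F(1) by (simp add: BC_def)
  have re: "(\<lambda>x. complex_of_real (Re (F x))) \<in> BC"
    by (rule BCI[where B = B]) (auto intro!: continuous_intros Fc intro: order_trans[OF abs_Re_le_cmod F(2)])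
  have im: "(\<lambda>x. complex_of_real (Im (F x))) \<in> BC"
    by (rule BCI[where B = B]) (auto intro!: continuous_intros Fc intro: order_trans[OF abs_Im_le_cmod F(2)])
  have "m F = m (\<lambda>x. complex_of_real (Re (F x)) + \<i> * complex_of_real (Im (F x)))"
    by (simp flip: complex_eq)
  also have "\<dots> = m (\<lambda>x. complex_of_real (Re (F x))) + \<i> * m (\<lambda>x. complex_of_real (Im (F x)))"
    using add[OF re BC_cmult[OF im]] scale[OF im] by simp
  finally have "norm (m F) \<le> norm (m (\<lambda>x. complex_of_real (Re (F x)))) + norm (\<i> * m (\<lambda>x. complex_of_real (Im (F x))))"
    using norm_triangle_ineq by metis
  also have "\<dots> \<le> B + B"
    using real[OF re order_trans[OF abs_Re_le_cmod F(2)]] real[OF im order_trans[OF abs_Im_le_cmod F(2)]]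
    by (simp add: norm_mult)
  finally show ?thesis by simp
qed

lemma Cc_P1_exists: "\<exists>h. h \<in> Cc \<and> h \<in> P1 M"
proof -
  obtain \<phi> :: "'a \<Rightarrow> real" where \<phi>: "\<phi> \<in> Cc" "\<And>x. 0 \<le> \<phi> x" "\<And>x. x \<in> {0} \<Longrightarrow> \<phi> x = 1"
    using Cc_Urysohn[OF lc compact_sing[of 0] open_UNIV] by (metis subset_UNIV)
  define c where "c = (\<integral>x. \<phi> x \<partial>M)"
  have "c \<noteq> 0"
  proof
    assume "c = 0"
    then have "AE x in M. \<phi> x = 0"
      unfolding c_def by (subst (asm) integral_nonneg_eq_0_iff_AE[OF Cc_integrable[OF \<phi>(1)]]) (simp_all add: \<phi>(2))
    then have "AE x in M. \<not> \<phi> x > 0" by auto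
    moreover have op: "open {x. \<phi> x > 0}"
      by (intro open_Collect_less Cc_continuous[OF \<phi>(1)] continuous_intros)
    ultimately have "emeasure M {x. \<phi> x > 0} = 0"
      using AE_iff_measurable[of "{x. \<phi> x > 0}" M "\<lambda>x. \<not> \<phi> x > 0"] by (simp add: borel_open)
    moreover have "0 \<in> {x. \<phi> x > 0}" using \<phi>(3)[of 0] by simp
    ultimately show False using open_pos[OF op] by auto
  qed
  moreover have "c \<ge> 0" unfolding c_def by (simp add: \<phi>(2))
  ultimately have c: "c > 0" by simp
  define h where "h x = complex_of_real (\<phi> x / c)" for x
  have h: "h \<in> Cc" unfolding h_def
    by (rule Cc_compose0[OF \<phi>(1), where h = "\<lambda>t. complex_of_real (t / c)"]) (use c in \<open>auto intro!: continuous_intros\<close>)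
  have "(\<integral>x. norm (h x) \<partial>M) = (\<integral>x. \<phi> x / c \<partial>M)"
    unfolding h_def using \<phi>(2) c by (intro Bochner_Integration.integral_cong refl) (simp only: norm_of_real abs_of_nonneg divide_nonneg_pos)
  also have "\<dots> = 1" using c by (simp add: c_def[symmetric])
  finally have "h \<in> P1 M"
    using Cc_integrable[OF h] \<phi>(2) c unfolding P1_def L1_def
    by (auto simp: h_def nonneg_Reals_of_real_iff simp del: of_real_divide)
  with h show ?thesis by blast
qed

lemma integral_P1:
  assumes "f \<in> P1 M" shows "(\<integral>x. f x \<partial>M) = 1"
proof -
  have f: "integrable M f" "AE x in M. f x \<in> \<real>\<^sub>\<ge>\<^sub>0" "(\<integral>x. norm (f x) \<partial>M) = 1"
    using assms unfolding P1_def L1_def by auto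
  have "(\<integral>x. f x \<partial>M) = (\<integral>x. complex_of_real (norm (f x)) \<partial>M)"
  proof (rule integral_cong_AE)
    show "AE x in M. f x = complex_of_real (norm (f x))"
      using f(2) by eventually_elim (auto elim!: nonneg_Reals_cases)
  qed (use f(1) in auto)
  then show ?thesis using f(3) by simp
qed

text \<open>This is \<open>h(Tf) = (hT)f\<close>, the associativity of convolution transferred to
  \<open>Linf\<close>; for the explicit representatives it holds at every point.\<close>

lemma ract_lact_commute:
  assumes T: "T \<in> Linf M" and f: "f \<in> Cc" and h: "h \<in> Cc"
  shows "lact h (ract T f) = ract (lact h T) f"
proof
  fix x
  obtain Kf where Kf: "compact Kf" "\<And>x. x \<notin> Kf \<Longrightarrow> f x = 0" using CcE[OF f] by metis
  obtain Kh where Kh: "compact Kh" "\<And>x. x \<notin> Kh \<Longrightarrow> h x = 0" using CcE[OF h] by metis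
  define A where "A = {a + b | a b. a \<in> Kh \<and> b \<in> {x}}"
  have A: "compact A" unfolding A_def by (intro compact_set_add Kh compact_sing)
  have yA: "y \<in> A" if "h (y - x) \<noteq> 0" for y
    unfolding A_def using that Kh(2) by (intro mem_set_add[of "y - x" _ x]) (auto simp only: group_normalize)
  have "lact h (ract T f) x = (\<integral>y. (\<integral>z. T z * (f (- y + z) * h (y - x)) \<partial>M) \<partial>M)"
    unfolding lact_def ract_def by (simp add: mult.assoc[symmetric])
  also have "\<dots> = (\<integral>z. T z * (\<integral>y. f (- y + z) * h (y - x) \<partial>M) \<partial>M)"
  proof (rule fubini_Cc[OF T _ A compact_set_add[OF A Kf(1)], symmetric])
    show "continuous_on UNIV (\<lambda>(y, z). f (- y + z) * h (y - x))"
      by (auto simp: case_prod_unfold intro!: continuous_on_Cc[OF h] continuous_on_Cc[OF f] continuous_intros)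
    show "f (- y + z) * h (y - x) = 0" if "y \<notin> A" for y z using yA that by auto
    show "f (- y + z) * h (y - x) = 0" if "z \<notin> {a + b | a b. a \<in> A \<and> b \<in> Kf}" for y z
    proof (rule ccontr)
      assume nz: "\<not> ?thesis"
      then have "- y + z \<in> Kf" using Kf(2) by auto
      then have "z \<in> {a + b | a b. a \<in> A \<and> b \<in> Kf}"
        using yA nz by (intro mem_set_add[of y _ "- y + z"]) (auto simp only: group_normalize mult_eq_0_iff)
      with that show False by blast
    qed
  qed
  \<comment> \<open>\<open>integral_flip\<close> substitutes \<open>y = z - w + x\<close>, which
    turns \<open>- y + z\<close> into \<open>- x + w\<close> and \<open>y - x\<close> into
    \<open>z - w\<close>.\<close>
  also have "\<dots> = (\<integral>z. T z * (\<integral>w. f (- x + w) * h (z - w) \<partial>M) \<partial>M)"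
  proof -
    have "(\<integral>y. f (- y + z) * h (y - x) \<partial>M) = (\<integral>w. f (- x + w) * h (z - w) \<partial>M)" for z
    proof -
      have "(\<lambda>y. f (- y + z) * h (y - x)) \<in> borel_measurable M"
        by (intro continuous_borel continuous_on_mult continuous_on_Cc[OF h] continuous_on_Cc[OF f] continuous_intros)
      from integral_flip[OF this, of z x] show ?thesis by (simp only: group_normalize)
    qed
    then show ?thesis by simp
  qed
  also have "\<dots> = (\<integral>w. (\<integral>z. T z * (f (- x + w) * h (z - w)) \<partial>M) \<partial>M)"
  proof -
    define A' where "A' = {a + b | a b. a \<in> {x} \<and> b \<in> Kf}"
    have A': "compact A'" unfolding A'_def by (intro compact_set_add Kf compact_sing)
    have wA: "w \<in> A'" if "f (- x + w) \<noteq> 0" for w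
      unfolding A'_def using that Kf(2) by (intro mem_set_add[of x _ "- x + w"]) (auto simp only: group_normalize)
    show ?thesis
    proof (rule fubini_Cc[OF T _ A' compact_set_add[OF Kh(1) A']])
      show "continuous_on UNIV (\<lambda>(w, z). f (- x + w) * h (z - w))"
        by (auto simp: case_prod_unfold intro!: continuous_on_Cc[OF h] continuous_on_Cc[OF f] continuous_intros)
      show "f (- x + w) * h (z - w) = 0" if "w \<notin> A'" for w z using wA that by auto
      show "f (- x + w) * h (z - w) = 0" if "z \<notin> {a + b | a b. a \<in> Kh \<and> b \<in> A'}" for w z
      proof (rule ccontr)
        assume nz: "\<not> ?thesis"
        then have "z - w \<in> Kh" using Kh(2) by auto
        then have "z \<in> {a + b | a b. a \<in> Kh \<and> b \<in> A'}"
          using wA nz by (intro mem_set_add[of "z - w" _ w]) (auto simp only: group_normalize mult_eq_0_iff)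
        with that show False by blast
      qed
    qed
  qed
  also have "\<dots> = ract (lact h T) f x"
    unfolding lact_def ract_def
  proof (rule Bochner_Integration.integral_cong[OF refl])
    fix w
    have "(\<integral>z. T z * (f (- x + w) * h (z - w)) \<partial>M) = (\<integral>z. f (- x + w) * (T z * h (z - w)) \<partial>M)"
      by (simp only: mult.left_commute)
    then show "(\<integral>z. T z * (f (- x + w) * h (z - w)) \<partial>M) = (\<integral>y. T y * h (y - w) \<partial>M) * f (- x + w)"
      by simp
  qed
  finally show "lact h (ract T f) x = ract (lact h T) f x" .
qed

subsection \<open>Right invariance\<close>

text \<open>For fixed \<open>y\<close> this is, as a function of \<open>s\<close>, the density of
  \<open>z + (y + x - y)\<close> when \<open>z\<close> and \<open>x\<close> have densities
  \<open>h\<close> and \<open>f\<close>: the convolution of \<open>h\<close> with the conjugate of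
  \<open>f\<close> by \<open>y\<close>.\<close>

definition qker :: "('a \<Rightarrow> complex) \<Rightarrow> ('a \<Rightarrow> complex) \<Rightarrow> 'a \<Rightarrow> 'a \<Rightarrow> complex" where
  "qker f h s y = (\<integral>x. f x * h (s + y - x - y) \<partial>M)"

lemma qker_integrable:
  fixes f h :: "'a \<Rightarrow> complex"
  assumes f: "f \<in> Cc" and h: "h \<in> Cc" shows "integrable M (\<lambda>x. f x * h (s + y - x - y))"
proof -
  obtain K where K: "compact K" "\<And>x. x \<notin> K \<Longrightarrow> f x = 0" using CcE[OF f] by metis
  have "continuous_on UNIV (\<lambda>x. f x * h (s + y - x - y))"
    by (auto intro!: continuous_on_Cc[OF h] Cc_continuous[OF f] continuous_intros)
  from Cc_integrable[OF CcI[OF this K(1)]] show ?thesis by (simp add: K)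
qed

lemma qker_diff:
  assumes f: "f \<in> Cc" and h: "h \<in> Cc"
    and e: "\<And>x. norm (h (s' + y' - x - y') - h (s + y - x - y)) \<le> e"
  shows "norm (qker f h s' y' - qker f h s y) \<le> e * (\<integral>x. norm (f x) \<partial>M)"
proof -
  note i = qker_integrable[OF f h]
  have "qker f h s' y' - qker f h s y = (\<integral>x. f x * (h (s' + y' - x - y') - h (s + y - x - y)) \<partial>M)"
    unfolding qker_def using i by (simp add: right_diff_distrib)
  also have "norm \<dots> \<le> (\<integral>x. norm (f x * (h (s' + y' - x - y') - h (s + y - x - y))) \<partial>M)"
    by (rule integral_norm_bound)
  also have "\<dots> \<le> (\<integral>x. e * norm (f x) \<partial>M)"
  proof (rule integral_mono)
    show "integrable M (\<lambda>x. norm (f x * (h (s' + y' - x - y') - h (s + y - x - y))))"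
      using i by (simp add: right_diff_distrib)
    show "integrable M (\<lambda>x. e * norm (f x))" using Cc_integrable[OF f] by simp
    show "norm (f x * (h (s' + y' - x - y') - h (s + y - x - y))) \<le> e * norm (f x)" for x
      using mult_left_mono[OF e[of x], of "norm (f x)"] by (simp add: norm_mult mult.commute)
  qed
  finally show ?thesis by simp
qed

lemma qker_continuous:
  assumes f: "f \<in> Cc" and h: "h \<in> Cc"
  shows "continuous_on UNIV (\<lambda>p. qker f h (fst p) (snd p))"
proof -
  obtain K where K: "compact K" "\<And>x. x \<notin> K \<Longrightarrow> f x = 0" using CcE[OF f] by metis
  show ?thesis unfolding qker_def
  proof (rule continuous_parameter_integral)
    show "continuous_on UNIV (\<lambda>(x, p). f x * h (fst p + snd p - x - snd p))"
      by (auto simp: case_prod_unfold intro!: continuous_on_Cc[OF h] continuous_on_Cc[OF f] continuous_intros)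
    show "\<exists>U K. open U \<and> p \<in> U \<and> compact K \<and>
        (\<forall>x p. x \<notin> K \<longrightarrow> p \<in> U \<longrightarrow> f x * h (fst p + snd p - x - snd p) = 0)" for p :: "'a \<times> 'a"
      by (rule exI[of _ UNIV], rule exI[of _ K]) (simp add: K)
  qed
qed

lemma qker_bounded:
  assumes f: "f \<in> Cc" and h: "h \<in> Cc"
  obtains B where "B > 0" "\<And>s y. norm (qker f h s y) \<le> B"
proof -
  obtain H where H: "H > 0" "\<And>x. norm (h x) \<le> H" using Cc_bounded[OF h] by metis
  have "norm (qker f h s y) \<le> H * (\<integral>x. norm (f x) \<partial>M)" for s y
  proof -
    have "norm (qker f h s y) \<le> (\<integral>x. norm (f x * h (s + y - x - y)) \<partial>M)"
      unfolding qker_def by (rule integral_norm_bound)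
    also have "\<dots> \<le> (\<integral>x. H * norm (f x) \<partial>M)"
    proof (rule integral_mono)
      show "integrable M (\<lambda>x. norm (f x * h (s + y - x - y)))" using qker_integrable[OF f h] by simp
      show "integrable M (\<lambda>x. H * norm (f x))" using Cc_integrable[OF f] by simp
      show "norm (f x * h (s + y - x - y)) \<le> H * norm (f x)" for x
        using mult_left_mono[OF H(2), of "norm (f x)"] by (simp add: norm_mult mult.commute)
    qed
    finally show ?thesis by simp
  qed
  moreover have "H * (\<integral>x. norm (f x) \<partial>M) \<ge> 0" using H(1) by simp
  ultimately show ?thesis
    using that[of "H * (\<integral>x. norm (f x) \<partial>M) + 1"] by (smt (verit))
qed

lemma conjugates_of_support:
  fixes f :: "'a \<Rightarrow> complex"
  assumes f: "f \<in> Cc"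
  obtains C where "compact C" "\<And>x y. f x \<noteq> 0 \<Longrightarrow> y + x - y \<in> C"
proof -
  obtain K where K: "compact K" "\<And>x. x \<notin> K \<Longrightarrow> f x = 0" using CcE[OF f] by metis
  obtain C where "compact C" "\<And>k g. k \<in> K \<Longrightarrow> g + k - g \<in> C"
    using compact_conjugates[OF lc fc K(1)] by metis
  then show ?thesis using that[of C] K(2) by metis
qed

text \<open>Substituting \<open>s = z + (y + x - y)\<close> turns the double average over \<open>z\<close> and \<open>x\<close> of
  \<open>S (z + y + x)\<close> into an average of left translates of \<open>S\<close>.\<close>

lemma lact_ract_qker:
  assumes S: "S \<in> BC" and f: "f \<in> Cc" and h: "h \<in> Cc"
  shows "lact h (ract S f) y = (\<integral>s. qker f h s y * S (s + y) \<partial>M)"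
proof -
  have Sc: "continuous_on UNIV S" using S by (simp add: BC_def)
  have Sc': "continuous_on A (\<lambda>x. S (g x))" if "continuous_on A g" for A and g :: "'c::topological_space \<Rightarrow> 'a"
    using continuous_on_compose2[OF Sc that] by simp
  obtain Kf where Kf: "compact Kf" "\<And>x. x \<notin> Kf \<Longrightarrow> f x = 0" using CcE[OF f] by metis
  obtain Kh where Kh: "compact Kh" "\<And>x. x \<notin> Kh \<Longrightarrow> h x = 0" using CcE[OF h] by metis
  obtain C where C: "compact C" "\<And>x y. f x \<noteq> 0 \<Longrightarrow> y + x - y \<in> C"
    using conjugates_of_support[OF f] by metis
  have r: "ract S f w = (\<integral>x. S (w + x) * f x \<partial>M)" for w
  proof -
    have "(\<lambda>x. S x * f (- w + x)) \<in> borel_measurable M"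
      by (intro continuous_borel continuous_on_mult Sc continuous_on_Cc[OF f] continuous_intros)
    from integral_left_translate[OF this, of w] show ?thesis
      unfolding ract_def by (simp only: group_normalize)
  qed
  have rc: "continuous_on UNIV (ract S f)"
    using ract_BC[OF BC_subset_Linf[OF S] Cc_integrable[OF f]] by (simp add: BC_def)
  have "lact h (ract S f) y = (\<integral>z. ract S f (z + y) * h z \<partial>M)"
  proof -
    have "(\<lambda>z. ract S f z * h (z - y)) \<in> borel_measurable M"
      by (intro continuous_borel continuous_on_mult rc continuous_on_Cc[OF h] continuous_intros)
    from integral_right_translate[OF this, of y] show ?thesis
      unfolding lact_def by (simp only: group_normalize)
  qed
  also have "\<dots> = (\<integral>z. (\<integral>x. S (z + y + x) * f x * h z \<partial>M) \<partial>M)"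
    unfolding r by simp
  also have "\<dots> = (\<integral>x. (\<integral>z. S (z + y + x) * f x * h z \<partial>M) \<partial>M)"
  proof (rule fubini_Cc_1[OF _ Kf(1) Kh(1)])
    show "continuous_on UNIV (\<lambda>(x, z). S (z + y + x) * f x * h z)"
      by (auto simp: case_prod_unfold intro!: Sc' continuous_on_Cc[OF h] continuous_on_Cc[OF f] continuous_intros)
  qed (simp_all add: Kf Kh)
  \<comment> \<open>For fixed \<open>x\<close>, putting \<open>z = s + (y - x - y)\<close> turns
    \<open>z + y + x\<close> into \<open>s + y\<close>; this uses right invariance of
    \<open>M\<close>.\<close>
  also have "\<dots> = (\<integral>x. (\<integral>s. S (s + y) * (f x * h (s + y - x - y)) \<partial>M) \<partial>M)"
  proof (rule Bochner_Integration.integral_cong[OF refl])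
    fix x
    have "(\<lambda>z. S (z + y + x) * f x * h z) \<in> borel_measurable M"
      by (intro continuous_borel continuous_on_mult Sc' Cc_continuous[OF h] continuous_intros)
    from integral_right_translate[OF this, of "y - x - y"]
    show "(\<integral>z. S (z + y + x) * f x * h z \<partial>M) = (\<integral>s. S (s + y) * (f x * h (s + y - x - y)) \<partial>M)"
      by (simp only: group_normalize mult.assoc)
  qed
  also have "\<dots> = (\<integral>s. (\<integral>x. S (s + y) * (f x * h (s + y - x - y)) \<partial>M) \<partial>M)"
  proof (rule fubini_Cc_1[OF _ compact_set_add[OF Kh(1) C(1)] Kf(1)])
    show "continuous_on UNIV (\<lambda>(s, x). S (s + y) * (f x * h (s + y - x - y)))"
      by (auto simp: case_prod_unfold intro!: Sc' continuous_on_Cc[OF h] continuous_on_Cc[OF f] continuous_intros)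
    show "S (s + y) * (f x * h (s + y - x - y)) = 0" if "s \<notin> {a + b | a b. a \<in> Kh \<and> b \<in> C}" for s x
    proof (rule ccontr)
      assume "\<not> ?thesis"
      then have "s + y - x - y \<in> Kh" "y + x - y \<in> C" using Kh(2) C(2)[of x y] by auto
      then have "s \<in> {a + b | a b. a \<in> Kh \<and> b \<in> C}"
        by (intro mem_set_add[of "s + y - x - y" _ "y + x - y"]) (simp_all only: group_normalize)
      with that show False by blast
    qed
  qed (simp add: Kf)
  also have "\<dots> = (\<integral>s. qker f h s y * S (s + y) \<partial>M)"
    unfolding qker_def by (simp add: mult.commute)
  finally show ?thesis .
qed

text \<open>With \<open>- s + y\<close> in place of \<open>y\<close> the argument of
  \<open>h\<close> becomes \<open>y - x - y + s\<close>. Now \<open>s\<close> stands alone on the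
  right, so left invariance removes \<open>x\<close> and \<open>y\<close> from the integral over
  \<open>s\<close>.\<close>

lemma integral_qker_shifted:
  assumes f: "f \<in> Cc" and h: "h \<in> Cc"
  shows "(\<integral>s. qker f h s (- s + y) \<partial>M) = (\<integral>x. f x \<partial>M) * (\<integral>x. h x \<partial>M)"
proof -
  obtain Kf where Kf: "compact Kf" "\<And>x. x \<notin> Kf \<Longrightarrow> f x = 0" using CcE[OF f] by metis
  obtain Kh where Kh: "compact Kh" "\<And>x. x \<notin> Kh \<Longrightarrow> h x = 0" using CcE[OF h] by metis
  obtain C where C: "compact C" "\<And>x y. f x \<noteq> 0 \<Longrightarrow> y + x - y \<in> C"
    using conjugates_of_support[OF f] by metis
  have "(\<integral>s. qker f h s (- s + y) \<partial>M) = (\<integral>s. (\<integral>x. f x * h (y - x - y + s) \<partial>M) \<partial>M)"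
    unfolding qker_def by (simp only: group_normalize)
  also have "\<dots> = (\<integral>x. (\<integral>s. f x * h (y - x - y + s) \<partial>M) \<partial>M)"
  proof (rule fubini_Cc_1[OF _ Kf(1) compact_set_add[OF C(1) Kh(1)]])
    show "continuous_on UNIV (\<lambda>(x, s). f x * h (y - x - y + s))"
      by (auto simp: case_prod_unfold intro!: continuous_on_Cc[OF h] continuous_on_Cc[OF f] continuous_intros)
    show "f x * h (y - x - y + s) = 0" if "s \<notin> {a + b | a b. a \<in> C \<and> b \<in> Kh}" for s x
    proof (rule ccontr)
      assume "\<not> ?thesis"
      then have "y - x - y + s \<in> Kh" "y + x - y \<in> C" using Kh(2) C(2)[of x y] by auto
      then have "s \<in> {a + b | a b. a \<in> C \<and> b \<in> Kh}"
        by (intro mem_set_add[of "y + x - y" _ "y - x - y + s"]) (simp_all only: group_normalize)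
      with that show False by blast
    qed
  qed (simp add: Kf)
  also have "\<dots> = (\<integral>x. f x * (\<integral>s. h s \<partial>M) \<partial>M)"
    by (simp add: integral_left_translate[OF Cc_borel[OF h]])
  finally show ?thesis by simp
qed

text \<open>Topological invariance yields invariance under single points: averaging the translate of
  \<open>F\<close> with \<open>h\<close> is the same as averaging \<open>F\<close> with the
  translate \<open>h'\<close>, which again lies in \<open>P1\<close>.\<close>

lemma mean_left_translate:
  assumes m: "m \<in> TLIM M" and F: "F \<in> BC"
  shows "m (\<lambda>y. F (s + y)) = m F"
proof -
  have lin: "linear_functional M m" using m unfolding TLIM_def mean_def by blast
  have inv: "m (lact h T) = m T" if "h \<in> Cc" "h \<in> P1 M" "T \<in> BC" for h T
    using m that left_act_eq[OF lin BC_subset_Linf[OF that(3)] that(1)] BC_subset_Linf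
    unfolding TLIM_def top_left_invariant_def by auto
  obtain h where h: "h \<in> Cc" "h \<in> P1 M" using Cc_P1_exists by blast
  obtain B where B: "continuous_on UNIV F" "B > 0" "\<And>x. norm (F x) \<le> B" using BCE[OF F] by metis
  have sF: "(\<lambda>y. F (s + y)) \<in> BC"
    by (rule BCI[OF continuous_on_compose2[OF B(1)] B(3)]) (auto intro!: continuous_intros)
  define h' where "h' y = h (- s + y)" for y
  have h'C: "h' \<in> Cc" unfolding h'_def using Cc_translate[OF h(1), of "- s" 0] by simp
  have h'P: "h' \<in> P1 M"
  proof -
    have d: "distr M M (\<lambda>x. - s + x) = M" by (rule distr_translate)
    have "AE x in M. h (- s + x) \<in> \<real>\<^sub>\<ge>\<^sub>0"
      by (rule AE_distrD[OF translate_measurable]) (use h(2) in \<open>simp only: d P1_def mem_Collect_eq\<close>)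
    moreover have "(\<integral>x. norm (h (- s + x)) \<partial>M) = (\<integral>x. norm (h x) \<partial>M)"
      by (rule integral_left_translate[of "\<lambda>x. norm (h x)"]) (use Cc_borel[OF h(1)] in simp)
    ultimately show ?thesis
      using h(2) Cc_integrable[OF h'C] unfolding P1_def L1_def h'_def by simp
  qed
  have "lact h (\<lambda>y. F (s + y)) = lact h' F"
  proof
    fix x
    have "(\<lambda>y. F y * h (- s + y - x)) \<in> borel_measurable M"
      by (intro continuous_borel continuous_on_mult B(1) continuous_on_Cc[OF h(1)] continuous_intros)
    from integral_left_translate[OF this, of s]
    show "lact h (\<lambda>y. F (s + y)) x = lact h' F x"
      unfolding lact_def h'_def by (simp only: group_normalize)
  qed
  then show ?thesis using inv[OF h sF] inv[OF h'C h'P F] by simp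
qed

text \<open>\<open>interchange\<close> is used in both directions, since the translation that turns
  \<open>F' s\<close> into \<open>F s\<close> depends on \<open>s\<close> and can be undone only
  while \<open>m\<close> stands under the integral. Left uniform continuity of \<open>S\<close> is
  what makes \<open>F\<close> norm continuous in \<open>s\<close>.\<close>

lemma mean_lact_ract:
  assumes m: "m \<in> TLIM M" and f: "f \<in> Cc" and h: "h \<in> Cc" and S: "S \<in> BC"
    and luc: "\<And>e. e > 0 \<Longrightarrow> \<exists>V. open V \<and> 0 \<in> V \<and> (\<forall>u\<in>V. \<forall>x. norm (S (u + x) - S x) < e)"
  shows "m (lact h (ract S f)) = (\<integral>x. f x \<partial>M) * (\<integral>x. h x \<partial>M) * m S"
proof -
  have mean: "mean M m" and lin: "linear_functional M m" using m unfolding TLIM_def mean_def by blast+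
  have add: "m (\<lambda>y. F y + G y) = m F + m G" if "F \<in> BC" "G \<in> BC" for F G
    using lin BC_subset_Linf that unfolding linear_functional_def by blast
  have scale: "m (\<lambda>y. c * F y) = c * m F" if "F \<in> BC" for c F
    using lin BC_subset_Linf that unfolding linear_functional_def by blast
  obtain BS where BS: "continuous_on UNIV S" "BS > 0" "\<And>x. norm (S x) \<le> BS" using BCE[OF S] by metis
  obtain Bq where Bq: "Bq > 0" "\<And>s y. norm (qker f h s y) \<le> Bq" using qker_bounded[OF f h] by metis
  obtain Kh where Kh: "compact Kh" "\<And>x. x \<notin> Kh \<Longrightarrow> h x = 0" using CcE[OF h] by metis
  obtain C where C: "compact C" "\<And>x y. f x \<noteq> 0 \<Longrightarrow> y + x - y \<in> C"
    using conjugates_of_support[OF f] by metis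
  define I where "I = (\<integral>x. norm (f x) \<partial>M) + 1"
  have I: "I > 0" "(\<integral>x. norm (f x) \<partial>M) \<le> I"
    unfolding I_def by (simp_all add: add_nonneg_pos)
  have qc: "continuous_on UNIV (\<lambda>y. qker f h (a y) (b y))"
    if "continuous_on UNIV a" "continuous_on UNIV b" for a b :: "'a \<Rightarrow> 'a"
    using continuous_on_compose2[OF qker_continuous[OF f h], of UNIV "\<lambda>y. (a y, b y)"] that
    by (simp add: continuous_on_Pair)
  have sS: "(\<lambda>y. S (s + y)) \<in> BC" for s
    by (rule BCI[OF continuous_on_compose2[OF BS(1)] BS(3)]) (auto intro!: continuous_intros)
  define F where "F s y = qker f h s y * S (s + y)" for s y
  have FBC: "F s \<in> BC" for s
    unfolding F_def by (intro BC_mult sS BCI[OF qc Bq(2)] continuous_intros)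
  define F' where "F' s y = qker f h s (- s + y) * S y" for s y
  have F'BC: "F' s \<in> BC" for s
    unfolding F'_def by (intro BC_mult S BCI[OF qc Bq(2)] continuous_intros)
  have eq: "lact h (ract S f) = (\<lambda>y. \<integral>s. F s y \<partial>M)"
    unfolding F_def using lact_ract_qker[OF S f h] by auto
  have "m (\<lambda>y. \<integral>s. F s y \<partial>M) = (\<integral>s. m (F s) \<partial>M)"
  proof (rule interchange[where C = 2 and L = "{a + b | a b. a \<in> Kh \<and> b \<in> C}"])
    show "F s y = 0" if s: "s \<notin> {a + b | a b. a \<in> Kh \<and> b \<in> C}" for s y
    proof -
      have "f x * h (s + y - x - y) = 0" for x
      proof (rule ccontr)
        assume "\<not> ?thesis"
        then have "s + y - x - y \<in> Kh" "y + x - y \<in> C" using Kh(2) C(2)[of x y] by auto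
        then have "s \<in> {a + b | a b. a \<in> Kh \<and> b \<in> C}"
          by (intro mem_set_add[of "s + y - x - y" _ "y + x - y"]) (simp_all only: group_normalize)
        with s show False by blast
      qed
      then show ?thesis by (simp only: F_def qker_def Bochner_Integration.integral_zero mult_zero_left)
    qed
    show "\<exists>V. open V \<and> s \<in> V \<and> (\<forall>s'\<in>V. \<forall>y. norm (F s' y - F s y) < e)" if e: "e > 0" for s e
    proof -
      \<comment> \<open>The difference of products has two parts. The change of \<open>qker\<close>,
        at most \<open>e1 * I\<close>, multiplies \<open>S\<close>, bounded by \<open>BS\<close>;
        the change of \<open>S\<close>, at most \<open>e2\<close>, multiplies \<open>qker\<close>,
        bounded by \<open>Bq\<close>. Each part is at most \<open>e / 3\<close>, which leaves the
        final inequality strict.\<close>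
      define e1 where "e1 = e / (3 * I * BS)"
      define e2 where "e2 = e / (3 * Bq)"
      have e1: "e1 > 0" and e2: "e2 > 0" using e I BS Bq by (simp_all add: e1_def e2_def)
      obtain V1 where V1: "open V1" "0 \<in> V1" "\<And>u x. u \<in> V1 \<Longrightarrow> norm (h (u + x) - h x) < e1"
        using Cc_left_uniformly_continuous[OF lc h e1] by metis
      obtain V2 where V2: "open V2" "0 \<in> V2" "\<And>u x. u \<in> V2 \<Longrightarrow> norm (S (u + x) - S x) < e2"
        using luc[OF e2] by metis
      have "norm (F s' y - F s y) < e" if "s' - s \<in> V1 \<inter> V2" for s' y
      proof -
        have "norm (h (s' + y - x - y) - h (s + y - x - y)) \<le> e1" for x
        proof -
          have "s' + y - x - y = s' - s + (s + y - x - y)" by (simp only: group_normalize)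
          then show ?thesis using V1(3)[of "s' - s" "s + y - x - y"] that by simp
        qed
        from qker_diff[OF f h this]
        have 1: "norm (qker f h s' y - qker f h s y) \<le> e1 * I"
          using mult_left_mono[OF I(2), of e1] e1 by linarith
        have 2: "norm (S (s' + y) - S (s + y)) \<le> e2"
        proof -
          have "s' + y = s' - s + (s + y)" by (simp only: group_normalize)
          then show ?thesis using V2(3)[of "s' - s" "s + y"] that by simp
        qed
        have "F s' y - F s y = (qker f h s' y - qker f h s y) * S (s' + y) + qker f h s y * (S (s' + y) - S (s + y))"
          by (simp add: F_def algebra_simps)
        then have "norm (F s' y - F s y) \<le> norm (qker f h s' y - qker f h s y) * norm (S (s' + y))
            + norm (qker f h s y) * norm (S (s' + y) - S (s + y))"
          by (metis norm_mult norm_triangle_ineq)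
        also have "\<dots> \<le> (e1 * I) * BS + Bq * e2"
          using 1 2 Bq BS e1 I by (intro add_mono mult_mono) auto
        also have "\<dots> = e / 3 + e / 3" using I(1) BS(2) Bq(1) by (simp add: e1_def e2_def)
        also have "\<dots> < e" using e by simp
        finally show ?thesis .
      qed
      moreover have "open ((\<lambda>s'. s' - s) -` (V1 \<inter> V2))"
        by (intro open_vimage_cont open_Int V1 V2 continuous_intros)
      ultimately show ?thesis
        using V1(2) V2(2) by (intro exI[of _ "(\<lambda>s'. s' - s) -` (V1 \<inter> V2)"]) auto
    qed
    show "(\<lambda>y. \<integral>s. F s y \<partial>M) \<in> BC"
      unfolding eq[symmetric]
      by (intro lact_BC BC_subset_Linf ract_BC S h Cc_integrable f)
  qed (use mean_BC_bound[OF mean] add scale FBC compact_set_add[OF Kh(1) C(1)] in auto)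
  also have "\<dots> = (\<integral>s. m (F' s) \<partial>M)"
  proof -
    have "m (F s) = m (F' s)" for s
    proof -
      have "(\<lambda>y. F' s (s + y)) = F s"
        unfolding F_def F'_def by (simp only: group_normalize)
      then show ?thesis using mean_left_translate[OF m F'BC, of s s] by simp
    qed
    then show ?thesis by simp
  qed
  also have "\<dots> = m (\<lambda>y. \<integral>s. F' s y \<partial>M)"
  proof (rule interchange[where C = 2 and L = "{a + b | a b. a \<in> C \<and> b \<in> Kh}", symmetric])
    have q': "s + (- s + y) - x - (- s + y) = y - x - y + s" for s y x :: 'a
      by (simp only: group_normalize)
    show "F' s y = 0" if s: "s \<notin> {a + b | a b. a \<in> C \<and> b \<in> Kh}" for s y
    proof -
      have "f x * h (y - x - y + s) = 0" for x
      proof (rule ccontr)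
        assume "\<not> ?thesis"
        then have "y - x - y + s \<in> Kh" "y + x - y \<in> C" using Kh(2) C(2)[of x y] by auto
        then have "s \<in> {a + b | a b. a \<in> C \<and> b \<in> Kh}"
          by (intro mem_set_add[of "y + x - y" _ "y - x - y + s"]) (simp_all only: group_normalize)
        with s show False by blast
      qed
      then show ?thesis by (simp only: F'_def qker_def q') simp
    qed
    show "\<exists>V. open V \<and> s \<in> V \<and> (\<forall>s'\<in>V. \<forall>y. norm (F' s' y - F' s y) < e)" if e: "e > 0" for s e
    proof -
      \<comment> \<open>In \<open>F'\<close> only the weight varies with \<open>s\<close>, and
        \<open>s\<close> sits on the right in the argument of \<open>h\<close>. So right uniform
        continuity of \<open>h\<close> is the one to use, and \<open>S\<close> contributes no
        variation.\<close>
      define e1 where "e1 = e / (2 * I * BS)"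
      have e1: "e1 > 0" using e I BS by (simp add: e1_def)
      obtain V where V: "open V" "0 \<in> V" "\<And>u x. u \<in> V \<Longrightarrow> norm (h (x + u) - h x) < e1"
        using Cc_right_uniformly_continuous[OF lc h e1] by metis
      have "norm (F' s' y - F' s y) < e" if "- s + s' \<in> V" for s' y
      proof -
        have "norm (h (s' + (- s' + y) - x - (- s' + y)) - h (s + (- s + y) - x - (- s + y))) \<le> e1" for x
        proof -
          have "y - x - y + s' = y - x - y + s + (- s + s')" by (simp only: group_normalize)
          then show ?thesis unfolding q' using V(3)[OF that, of "y - x - y + s"] by simp
        qed
        from qker_diff[OF f h this]
        have 1: "norm (qker f h s' (- s' + y) - qker f h s (- s + y)) \<le> e1 * I"
          using mult_left_mono[OF I(2), of e1] e1 by linarith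
        have "norm (F' s' y - F' s y) = norm (qker f h s' (- s' + y) - qker f h s (- s + y)) * norm (S y)"
          by (simp add: F'_def flip: left_diff_distrib norm_mult)
        also have "\<dots> \<le> (e1 * I) * BS"
          using 1 BS e1 I by (intro mult_mono) auto
        also have "\<dots> = e / 2" using I(1) BS(2) by (simp add: e1_def)
        also have "\<dots> < e" using e by simp
        finally show ?thesis .
      qed
      moreover have "open ((\<lambda>s'. - s + s') -` V)"
        by (intro open_vimage_cont V continuous_intros)
      ultimately show ?thesis
        using V(2) by (intro exI[of _ "(\<lambda>s'. - s + s') -` V"]) auto
    qed
    show "(\<lambda>y. \<integral>s. F' s y \<partial>M) \<in> BC"
      unfolding F'_def using integral_qker_shifted[OF f h] S by (simp add: BC_cmult)
  qed (use mean_BC_bound[OF mean] add scale F'BC compact_set_add[OF C(1) Kh(1)] in auto)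
  also have "\<dots> = (\<integral>x. f x \<partial>M) * (\<integral>x. h x \<partial>M) * m S"
    unfolding F'_def using integral_qker_shifted[OF f h] scale[OF S] by simp
  finally show ?thesis unfolding eq .
qed

text \<open>The factor \<open>\<integral>x. f x\<close> is kept for general \<open>f\<close> because
  the functions in \<open>Cc\<close> that approximate an element of \<open>P1\<close> need not lie
  in \<open>P1\<close>.\<close>

lemma mean_ract_Cc:
  assumes m: "m \<in> TLIM M" and f: "f \<in> Cc" and T: "T \<in> Linf M"
  shows "m (ract T f) = (\<integral>x. f x \<partial>M) * m T"
proof -
  have lin: "linear_functional M m" using m unfolding TLIM_def mean_def by blast
  have inv: "m (lact h T) = m T" if "h \<in> Cc" "h \<in> P1 M" "T \<in> Linf M" for h T
    using m that left_act_eq[OF lin that(3,1)] unfolding TLIM_def top_left_invariant_def by auto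
  obtain h where h: "h \<in> Cc" "h \<in> P1 M" using Cc_P1_exists by blast
  note fi = Cc_integrable[OF f]
  define S where "S = lact h T"
  have S: "S \<in> BC" unfolding S_def by (rule lact_BC[OF T h(1)])
  have "m (ract T f) = m (lact h (ract T f))"
    by (rule inv[OF h BC_subset_Linf[OF ract_BC[OF T fi]], symmetric])
  also have "\<dots> = m (ract S f)" unfolding S_def ract_lact_commute[OF T f h(1)] ..
  also have "\<dots> = m (lact h (ract S f))"
    by (rule inv[OF h BC_subset_Linf[OF ract_BC[OF BC_subset_Linf[OF S] fi]], symmetric])
  also have "\<dots> = (\<integral>x. f x \<partial>M) * (\<integral>x. h x \<partial>M) * m S"
    by (rule mean_lact_ract[OF m f h(1) S]) (unfold S_def, rule lact_left_uniformly_continuous[OF T h(1)])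
  also have "\<dots> = (\<integral>x. f x \<partial>M) * m T"
    using inv[OF h T] integral_P1[OF h(2)] by (simp add: S_def)
  finally show ?thesis .
qed

text \<open>\<open>Tf\<close> depends continuously on \<open>f\<close>, from the \<open>L1\<close>
  norm to the supremum norm, and \<open>m\<close> is bounded for the latter; both sides thus pass to
  the limit along a sequence in \<open>Cc\<close>.\<close>

lemma mean_ract:
  assumes m: "m \<in> TLIM M" and f: "integrable M f" and T: "T \<in> Linf M"
  shows "m (ract T f) = (\<integral>x. f x \<partial>M) * m T"
proof -
  have mean: "mean M m" and lin: "linear_functional M m" using m unfolding TLIM_def mean_def by blast+
  obtain B where B: "B > 0" "\<And>x. norm (T x) \<le> B" using LinfE[OF T] by metis
  obtain \<phi> where \<phi>: "fast_approx \<phi> f" using fast_approx_exists[OF f] by blast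
  note pc = fast_approxD(1)[OF \<phi>]
  have "(\<lambda>n. m (ract T (\<phi> n)) - m (ract T f)) \<longlonglongrightarrow> 0"
  proof (rule Lim_null_comparison[OF always_eventually power_half_tendsto], rule allI)
    fix n
    note r = ract_BC[OF T Cc_integrable[OF pc[of n]]] ract_BC[OF T f]
    have "m (\<lambda>x. ract T (\<phi> n) x + (-1) * ract T f x) = m (ract T (\<phi> n)) + (-1) * m (ract T f)"
      using lin BC_subset_Linf[OF r(1)] BC_subset_Linf[OF r(2)] BC_subset_Linf[OF BC_cmult[OF r(2), of "-1"]]
      unfolding linear_functional_def by metis
    then have "m (ract T (\<phi> n)) - m (ract T f) = m (\<lambda>x. ract T (\<phi> n) x + (-1) * ract T f x)" by simp
    also have "norm \<dots> \<le> 2 * (B * (1/2) ^ n)"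
      by (rule mean_BC_bound[OF mean BC_add[OF r(1) BC_cmult[OF r(2)]]])
         (use ract_fast_approx[OF T B(2,1) f \<phi>] in simp)
    finally show "norm (m (ract T (\<phi> n)) - m (ract T f)) \<le> (2 * B) * (1/2) ^ n" by simp
  qed
  then have "(\<lambda>n. m (ract T (\<phi> n))) \<longlonglongrightarrow> m (ract T f)" by (rule LIM_zero_cancel)
  moreover have "(\<lambda>n. m (ract T (\<phi> n))) \<longlonglongrightarrow> (\<integral>x. f x \<partial>M) * m T"
  proof -
    have "(\<lambda>n. pairing M (\<lambda>x. 1) (\<phi> n)) \<longlonglongrightarrow> pairing M (\<lambda>x. 1) f"
      by (rule pairing_fast_approx[OF BC_subset_Linf[OF BC_const] f \<phi>])
    then show ?thesis
      unfolding mean_ract_Cc[OF m pc T] pairing_def by (intro tendsto_mult tendsto_const) simp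
  qed
  ultimately show ?thesis by (rule LIMSEQ_unique)
qed

end

theorem mainTheorem3:
  fixes M :: "'a::{topological_group_add, t2_space} measure"
  assumes "locally_compact_space (euclidean :: 'a topology)"
    and "left_haar_measure M"
    and "\<And>t::'a. precompact (conj_class t)"
  shows "TLIM M \<subseteq> TIM M"
proof
  interpret fc_haar M by unfold_locales (fact assms)+
  fix m assume m: "m \<in> TLIM M"
  then have lin: "linear_functional M m" unfolding TLIM_def mean_def by blast
  have "m (right_act M T f) = m T" if f: "f \<in> P1 M" and T: "T \<in> Linf M" for f T
  proof -
    have fi: "integrable M f" using f unfolding P1_def L1_def by blast
    show ?thesis
      using right_act_eq[OF lin T fi] mean_ract[OF m fi T] integral_P1[OF f] by simp
  qed
  with m show "m \<in> TIM M" unfolding TLIM_def TIM_def top_right_invariant_def by blast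
qed

end
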